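(* For every integer $n\ge 1$ there exists an isomorphism of $k$-algebras $$U_{q}^{+}(sl_{n+1})\simeq U\big((sl_{n+1}^{+})_{q}\big).$$
   Context: Let $\mathbb{K}$ be a field of characteristic zero, $q=\exp(t)\in\mathbb{K}[[t]]$, $k=\mathbb{K}[q,q^{-1}]$; $\otimes$ means $\otimes_k$. **$(sl_{n+1}^+)_q$** is the free $k$-module with basis $\mathcal{B}=\{e_{ij}\mid 1\le i<j\le n+1\}$ (symbols for the matrix units), totally ordered by: $e_{ab}<e_{uv}$ iff $a+b<u+v$, or $a+b=u+v$ and $b<v$. It carries the following $k$-linear maps: - $S(e_{ab}\otimes e_{uv})=q^{c_{ab,uv}}e_{uv}\otimes e_{ab}$ for $e_{ab}<e_{uv}$, where $c_{ab,uv}\in\mathbb{Z}$ is given by $[e_{aa}-e_{bb},e_{uv}]=c_{ab,uv}e_{uv}$ (matrix commutator); $S(x\otimes x)=x\otimes x$ for $x\in\mathcal{B}$; for $e_{ab}>e_{uv}$, $S$ is determined by $S^2=Id$. - Bracket: $[x,y]_q=[x,y]$ (matrix commutator) if $x<y$ in $\mathcal{B}$; $[x,x]_q=0$; for $x<y$ with $S(x\otimes y)=q^{c}y\otimes x$, $[y,x]_q=-q^{-c}[x,y]_q$. - $\langle e_{ij},e_{uv}\rangle=(q-q^{-1})e_{iv}\otimes e_{uj}$ if $i<u<j<v$; $=(q^{-1}-q)e_{uj}\otimes e_{iv}$ if $u<i<v<j$; $=0$ otherwise. - $T=S+\langle,\rangle$. **$U((sl_{n+1}^+)_q)$** is the tensor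 $k$-algebra of $(sl_{n+1}^+)_q$ modulo the two-sided ideal generated by $x\otimes y-T(x\otimes y)-[x,y]_q$, $x,y\in\mathcal{B}$. **$U_q^+(sl_{n+1})$** is the positive part of the Drinfeld–Jimbo quantum group of type $A_n$ over $k$: the $k$-subalgebra generated by $E_1,\ldots,E_n$ in the $\mathbb{K}(q)$-algebra with generators $E_1,\ldots,E_n$ and relations $E_iE_j=E_jE_i$ for $|i-j|>1$, $E_i^2E_j-(q+q^{-1})E_iE_jE_i+E_jE_i^2=0$ for $|i-j|=1$. *)

theory Defs
  imports "HOL-Algebra.Algebra" "HOL-Algebra.Algebraic_Closure_Type"
    "HOL-Computational_Algebra.Computational_Algebra"
begin

section \<open>Algebras over a subring of a commutative ring type\<close>

text \<open>
  A \<open>k\<close>-algebra is an HOL-Algebra ring record with a scalar multiplication; it need not be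
  commutative, so the library locale \<open>algebra\<close> does not apply. The scalars form a subring
  (given as a set) of the type \<open>'r\<close>; the scalar multiplication is only meaningful on this subring.
\<close>

definition alg_isomorphic ::
    "'r set \<Rightarrow> ('r, 'a, 'm) module_scheme \<Rightarrow> ('r, 'b, 'n) module_scheme \<Rightarrow> bool" where
  "alg_isomorphic k A B \<longleftrightarrow>
     (\<exists>h \<in> ring_iso A B. \<forall>c \<in> k. \<forall>x \<in> carrier A. h (c \<odot>\<^bsub>A\<^esub> x) = c \<odot>\<^bsub>B\<^esub> h x)"

definition gen_subalgebra :: "'r set \<Rightarrow> ('r, 'a) module \<Rightarrow> 'a set \<Rightarrow> ('r, 'a) module" where
  "gen_subalgebra k A S =
     A\<lparr>carrier := \<Inter>{B. subring B A \<and> (\<forall>c \<in> k. \<forall>x \<in> B. c \<odot>\<^bsub>A\<^esub> x \<in> B) \<and> S \<subseteq> B}\<rparr>"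

text \<open>The scalar multiplication on the quotient: \<open>c \<cdot> (I + x) = I + c \<cdot> x\<close>.\<close>

definition quot_algebra :: "('r, 'a) module \<Rightarrow> 'a set \<Rightarrow> ('r, 'a set) module" where
  "quot_algebra A I =
     ring.extend (A Quot I) (module.fields (\<lambda>c C. \<Union>x\<in>C. I +>\<^bsub>A\<^esub> (c \<odot>\<^bsub>A\<^esub> x)))"

text \<open>
  The free associative algebra on \<open>B\<close> over \<open>R\<close>: finitely supported functions from words over \<open>B\<close>
  to \<open>R\<close>, multiplied by concatenating words. It is the tensor algebra of the free \<open>R\<close>-module \<open>M\<close>
  with basis \<open>B\<close>: its part of degree \<open>d\<close> (spanned by the words of length \<open>d\<close>) is the \<open>d\<close>-th tensor
  power of \<open>M\<close>, and \<open>word [x\<^sub>1, \<dots>, x\<^sub>d]\<close> is the tensor \<open>x\<^sub>1 \<otimes> \<dots> \<otimes> x\<^sub>d\<close>.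
\<close>

definition free_algebra :: "'r::comm_ring_1 set \<Rightarrow> 'x set \<Rightarrow> ('r, 'x list \<Rightarrow> 'r) module" where
  "free_algebra R B =
     \<lparr>carrier = {f. range f \<subseteq> R \<and> finite {w. f w \<noteq> 0} \<and> (\<forall>w. f w \<noteq> 0 \<longrightarrow> set w \<subseteq> B)},
      monoid.mult = (\<lambda>f g w. \<Sum>i\<le>length w. f (take i w) * g (drop i w)),
      monoid.one = (\<lambda>w. if w = [] then 1 else 0),
      ring.zero = (\<lambda>w. 0),
      ring.add = (\<lambda>f g w. f w + g w),
      module.smult = (\<lambda>c f w. c * f w)\<rparr>"

definition word :: "'x list \<Rightarrow> 'x list \<Rightarrow> 'r::comm_ring_1" where
  "word v = (\<lambda>w. if w = v then 1 else 0)"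

lemma subring_typeD:
  assumes "subring R (ring_of_type_algebra :: 'r::comm_ring_1 ring)"
  shows "0 \<in> R" "1 \<in> R" "a \<in> R \<Longrightarrow> b \<in> R \<Longrightarrow> a + b \<in> R"
    "a \<in> R \<Longrightarrow> b \<in> R \<Longrightarrow> a * b \<in> R" "a \<in> R \<Longrightarrow> - a \<in> R"
proof -
  interpret ring "ring_of_type_algebra :: 'r ring" by (rule ring_from_type_algebra)
  note s = ring_of_type_algebra_def
  have neg: "\<ominus>\<^bsub>ring_of_type_algebra\<^esub> a = - a" for a :: 'r
    by (rule minus_equality) (simp_all add: s)
  show "0 \<in> R" "1 \<in> R" "a \<in> R \<Longrightarrow> b \<in> R \<Longrightarrow> a + b \<in> R"
    "a \<in> R \<Longrightarrow> b \<in> R \<Longrightarrow> a * b \<in> R" "a \<in> R \<Longrightarrow> - a \<in> R"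
    using subringE(2,3,5,6,7)[OF assms] unfolding neg by (auto simp: s)
qed

lemma ring_free_algebra:
  assumes "subring R (ring_of_type_algebra :: 'r::comm_ring_1 ring)"
  shows "ring (free_algebra R B)"
proof -
  note R = subring_typeD[OF assms]
  let ?m = "\<lambda>f g w. \<Sum>i\<le>length w. f (take i w) * g (drop i w) :: 'r"
  have sumR: "(\<Sum>i\<in>I. h i) \<in> R" if "\<And>i. h i \<in> R" for h :: "nat \<Rightarrow> 'r" and I
    by (induction I rule: infinite_finite_induct) (auto simp: R that)
  have nz: "\<exists>u v. w = u @ v \<and> f u \<noteq> 0 \<and> g v \<noteq> 0" if h: "?m f g w \<noteq> 0" for f g :: "'b list \<Rightarrow> 'r" and w
  proof -
    obtain i where "f (take i w) * g (drop i w) \<noteq> 0"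
      using h by (meson sum.not_neutral_contains_not_neutral)
    then show ?thesis by (intro exI[of _ "take i w"] exI[of _ "drop i w"]) auto
  qed
  have fin: "finite {w. ?m f g w \<noteq> 0}"
    if "finite {w. f w \<noteq> 0}" "finite {w. g w \<noteq> 0}" for f g :: "'b list \<Rightarrow> 'r"
  proof (rule finite_subset)
    show "{w. ?m f g w \<noteq> 0} \<subseteq> (\<lambda>(u, v). u @ v) ` ({w. f w \<noteq> 0} \<times> {w. g w \<noteq> 0})"
      using nz by fastforce
  qed (use that in auto)
  have assoc: "?m (?m f g) h w = ?m f (?m g h) w" for f g h :: "'b list \<Rightarrow> 'r" and w
  proof -
    let ?t = "\<lambda>j k. f (take j w) * g (take k (drop j w)) * h (drop (j + k) w)"
    have "?m (?m f g) h w = (\<Sum>i\<le>length w. \<Sum>j\<le>i. ?t j (i - j))"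
      by (intro sum.cong refl)
        (auto simp: sum_distrib_right drop_take min_def intro!: sum.cong)
    also have "\<dots> = (\<Sum>(j, k)\<in>{(j, k). j + k \<le> length w}. ?t j k)"
      by (rule sum.triangle_reindex_eq[symmetric])
    also have "{(j, k). j + k \<le> length w} = (SIGMA j:{..length w}. {..length w - j})"
      by auto
    also have "(\<Sum>(j, k)\<in>\<dots>. ?t j k) = (\<Sum>j\<le>length w. \<Sum>k\<le>length w - j. ?t j k)"
      by (rule sum.Sigma[symmetric]) auto
    also have "\<dots> = ?m f (?m g h) w"
      by (auto simp: sum_distrib_left add.commute mult.assoc intro!: sum.cong)
    finally show ?thesis .
  qed
  have one_l: "?m (\<lambda>w. if w = [] then 1 else 0) f w = f w" for f :: "'b list \<Rightarrow> 'r" and w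
  proof -
    have "?m (\<lambda>w. if w = [] then 1 else 0) f w = (\<Sum>i\<le>length w. if i = 0 then f w else 0)"
      by (intro sum.cong refl) auto
    then show ?thesis by simp
  qed
  have one_r: "?m f (\<lambda>w. if w = [] then 1 else 0) w = f w" for f :: "'b list \<Rightarrow> 'r" and w
  proof -
    have "?m f (\<lambda>w. if w = [] then 1 else 0) w = (\<Sum>i\<le>length w. if i = length w then f w else 0)"
      by (intro sum.cong refl) auto
    then show ?thesis by simp
  qed
  have fin_add: "finite {w. f w + g w \<noteq> 0}"
    if "finite {w. f w \<noteq> 0}" "finite {w. g w \<noteq> 0}" for f g :: "'b list \<Rightarrow> 'r"
    by (rule finite_subset[of _ "{w. f w \<noteq> 0} \<union> {w. g w \<noteq> 0}"]) (use that in auto)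
  have supp_add: "f w \<noteq> 0 \<or> g w \<noteq> 0" if "f w + g w \<noteq> 0" for f g :: "'b list \<Rightarrow> 'r" and w
    using that by auto
  show ?thesis
  proof (rule ringI, goal_cases)
    case 1
    show ?case
    proof (rule abelian_groupI, goal_cases)
      case (1 f g)
      then show ?case
        by (auto simp: free_algebra_def image_subset_iff R fin_add dest!: supp_add)
    next
      case (6 f)
      then show ?case
        by (intro bexI[of _ "\<lambda>w. - f w"]) (auto simp: free_algebra_def image_subset_iff R)
    qed (auto simp: free_algebra_def image_subset_iff R algebra_simps)
  next
    case 2
    show ?case
    proof (rule Group.monoidI, goal_cases)
      case (1 f g)
      then show ?case
        by (auto simp: free_algebra_def image_subset_iff intro!: sumR R fin dest!: nz) blast+
    next
      case 3
      show ?case by (rule ext) (simp only: free_algebra_def monoid.select_convs assoc)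
    next
      case (4 f)
      show ?case by (rule ext) (simp only: free_algebra_def monoid.select_convs one_l)
    next
      case (5 f)
      show ?case by (rule ext) (simp only: free_algebra_def monoid.select_convs one_r)
    qed (auto simp: free_algebra_def image_subset_iff R)
  next
    case (3 f g h)
    then show ?case by (simp add: free_algebra_def algebra_simps sum.distrib)
  next
    case (4 f g h)
    then show ?case by (simp add: free_algebra_def algebra_simps sum.distrib)
  qed
qed

lemma finsum_free_algebra:
  assumes "subring R (ring_of_type_algebra :: 'r::comm_ring_1 ring)"
    and "\<And>i. i \<in> I \<Longrightarrow> h i \<in> carrier (free_algebra R B)" "finite I"
  shows "(\<Oplus>\<^bsub>free_algebra R B\<^esub>i\<in>I. h i) = (\<lambda>w. \<Sum>i\<in>I. h i w)"
proof -
  interpret ring "free_algebra R B" by (rule ring_free_algebra) fact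
  show ?thesis
    using assms(3,2)
  proof (induction I rule: finite_induct)
    case empty
    show ?case by (simp only: finsum_empty sum.empty) (simp add: free_algebra_def)
  next
    case (insert i I)
    then have step: "(\<Oplus>\<^bsub>free_algebra R B\<^esub>i\<in>insert i I. h i)
        = h i \<oplus>\<^bsub>free_algebra R B\<^esub> (\<Oplus>\<^bsub>free_algebra R B\<^esub>i\<in>I. h i)"
      by (intro finsum_insert) auto
    have IH: "(\<Oplus>\<^bsub>free_algebra R B\<^esub>i\<in>I. h i) = (\<lambda>w. \<Sum>i\<in>I. h i w)"
      using insert by blast
    show ?case
      unfolding step IH using insert(1,2) by (simp add: free_algebra_def)
  qed
qed

text \<open>
  For \<open>A\<close> the tensor algebra of the free module \<open>M\<close>, this is the linear map from
  \<open>M \<otimes> M\<close> to \<open>A\<close> sending \<open>x \<otimes> y\<close> to \<open>F x y\<close> for basis elements \<open>x\<close>, \<open>y\<close>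
  (extended by \<open>0\<close> to the tensors of degree other than \<open>2\<close>).
\<close>

definition lin_ext2 ::
    "('r::comm_ring_1, 'x list \<Rightarrow> 'r) module \<Rightarrow> ('x \<Rightarrow> 'x \<Rightarrow> 'x list \<Rightarrow> 'r)
      \<Rightarrow> ('x list \<Rightarrow> 'r) \<Rightarrow> 'x list \<Rightarrow> 'r" where
  "lin_ext2 A F f =
     (\<Oplus>\<^bsub>A\<^esub>w\<in>{w. f w \<noteq> 0 \<and> length w = 2}. f w \<odot>\<^bsub>A\<^esub> F (w ! 0) (w ! 1))"


section \<open>The ground rings\<close>

text \<open>
  Everything takes place in the field \<open>K((t))\<close> of formal Laurent series, which contains \<open>K[[t]]\<close>
  and hence both \<open>k = K[q, q\<^sup>-\<^sup>1]\<close> and its field of fractions \<open>K(q)\<close>.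
\<close>

definition qpar :: "'a::field_char_0 fls" where
  "qpar = fps_to_fls (fps_exp 1)"

definition k_ring :: "'a::field_char_0 fls set" where
  "k_ring = generate_ring ring_of_type_algebra (range fls_const \<union> {qpar, inverse qpar})"

definition Kq :: "'a::field_char_0 fls set" where
  "Kq = generate_field ring_of_type_algebra (range fls_const \<union> {qpar})"

lemma subring_k_ring: "subring k_ring (ring_of_type_algebra :: 'a::field_char_0 fls ring)"
proof -
  interpret ring "ring_of_type_algebra :: 'a fls ring" by (rule ring_from_type_algebra)
  show ?thesis
    unfolding k_ring_def by (rule generate_ring_is_subring) (simp add: ring_of_type_algebra_def)
qed

lemma subfield_Kq: "subfield Kq (ring_of_type_algebra :: 'a::field_char_0 fls ring)"
proof -
  interpret field "ring_of_type_algebra :: 'a fls ring" by (rule field_from_type_algebra)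
  show ?thesis
    unfolding Kq_def by (rule generate_field_is_subfield) (simp add: ring_of_type_algebra_def)
qed

lemma qpar_nonzero [simp]: "qpar \<noteq> 0"
  by (simp add: qpar_def fps_to_fls_eq_0_iff)

lemma qpar_powi_in: "qpar powi m \<in> k_ring"
proof -
  have pow: "x ^ i \<in> k_ring" if "x \<in> k_ring" for x :: "'a fls" and i
    by (induction i) (use that in \<open>auto intro: subring_typeD[OF subring_k_ring]\<close>)
  have "qpar \<in> k_ring" "inverse qpar \<in> k_ring"
    unfolding k_ring_def by (auto intro: generate_ring.incl)
  then show ?thesis
    by (auto simp: power_int_def intro: pow)
qed


section \<open>The braided Lie algebra and its enveloping algebra\<close>

text \<open>
  The pair \<open>(i, j)\<close> stands for the matrix unit \<open>e\<^sub>i\<^sub>j\<close>. Matrices of size \<open>n + 1\<close> are functions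
  of a row and a column index in \<open>{1..n + 1}\<close>.
\<close>

definition sl_basis :: "nat \<Rightarrow> (nat \<times> nat) set" where
  "sl_basis n = {(i, j). 1 \<le> i \<and> i < j \<and> j \<le> n + 1}"

definition basis_less :: "nat \<times> nat \<Rightarrow> nat \<times> nat \<Rightarrow> bool" where
  "basis_less x y \<longleftrightarrow> fst x + snd x < fst y + snd y
     \<or> fst x + snd x = fst y + snd y \<and> snd x < snd y"

definition munit :: "nat \<times> nat \<Rightarrow> nat \<Rightarrow> nat \<Rightarrow> int" where
  "munit x = (\<lambda>r s. if (r, s) = x then 1 else 0)"

definition commutator ::
    "nat \<Rightarrow> (nat \<Rightarrow> nat \<Rightarrow> int) \<Rightarrow> (nat \<Rightarrow> nat \<Rightarrow> int) \<Rightarrow> nat \<Rightarrow> nat \<Rightarrow> int" where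
  "commutator n P Q = (\<lambda>r s. (\<Sum>l = 1..n + 1. P r l * Q l s) - (\<Sum>l = 1..n + 1. Q r l * P l s))"

definition weight :: "nat \<Rightarrow> nat \<times> nat \<Rightarrow> nat \<times> nat \<Rightarrow> int" where
  "weight n x y =
     (THE c. commutator n (\<lambda>r s. munit (fst x, fst x) r s - munit (snd x, snd x) r s) (munit y)
        = (\<lambda>r s. c * munit y r s))"

lemma weight_eq:
  assumes "x \<in> sl_basis n" "y \<in> sl_basis n"
  shows "weight n x y = (if fst x = fst y then 1 else 0) - (if fst x = snd y then 1 else 0)
     - (if snd x = fst y then 1 else 0) + (if snd x = snd y then 1 else 0)" (is "_ = ?c")
proof -
  obtain a b where x: "x = (a, b)" by (cases x)
  obtain u v where y: "y = (u, v)" by (cases y)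
  have bd: "a \<in> {1..n+1}" "b \<in> {1..n+1}" "u \<in> {1..n+1}" "v \<in> {1..n+1}"
    using assms by (auto simp: sl_basis_def x y)
  let ?C = "commutator n (\<lambda>r s. munit (fst x, fst x) r s - munit (snd x, snd x) r s) (munit y)"
  have m1: "(\<Sum>l = 1..n+1. munit (p, p) r l * munit (u, v) l s)
      = (if p = u then munit (u, v) r s else 0)" if "p \<in> {1..n+1}" for p r s
  proof -
    have "(\<Sum>l = 1..n+1. munit (p, p) r l * munit (u, v) l s)
        = (\<Sum>l = 1..n+1. if l = p then (if r = p \<and> p = u \<and> s = v then 1 else 0) else 0)"
      by (intro sum.cong) (auto simp: munit_def)
    then show ?thesis using that by (auto simp: munit_def)
  qed
  have m2: "(\<Sum>l = 1..n+1. munit (u, v) r l * munit (p, p) l s)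
      = (if p = v then munit (u, v) r s else 0)" if "p \<in> {1..n+1}" for p r s
  proof -
    have "(\<Sum>l = 1..n+1. munit (u, v) r l * munit (p, p) l s)
        = (\<Sum>l = 1..n+1. if l = p then (if r = u \<and> p = v \<and> s = p then 1 else 0) else 0)"
      by (intro sum.cong) (auto simp: munit_def)
    then show ?thesis using that by (auto simp: munit_def)
  qed
  have C: "?C = (\<lambda>r s. ?c * munit y r s)"
    unfolding commutator_def x y fst_conv snd_conv left_diff_distrib right_diff_distrib
      sum_subtractf m1[OF bd(1)] m1[OF bd(2)] m2[OF bd(1)] m2[OF bd(2)]
    by (intro ext) auto
  show ?thesis
    unfolding weight_def
  proof (rule the_equality, rule C)
    fix c assume "?C = (\<lambda>r s. c * munit y r s)"
    then have "c * munit y u v = ?c * munit y u v"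
      using C by metis
    then show "c = ?c" by (simp add: munit_def y)
  qed
qed

text \<open>A strictly upper triangular matrix, as an element of the free module on \<open>sl_basis n\<close>.\<close>

definition of_matrix ::
    "nat \<Rightarrow> (nat \<Rightarrow> nat \<Rightarrow> int) \<Rightarrow> (nat \<times> nat) list \<Rightarrow> 'a::field_char_0 fls" where
  "of_matrix n P w =
     (if length w = 1 \<and> hd w \<in> sl_basis n then of_int (P (fst (hd w)) (snd (hd w))) else 0)"

abbreviation sl_tensor ::
    "nat \<Rightarrow> ('a::field_char_0 fls, (nat \<times> nat) list \<Rightarrow> 'a fls) module" where
  "sl_tensor n \<equiv> free_algebra k_ring (sl_basis n)"

text \<open>
  In the definition of \<open>S\<close>, the last case is the one forced by \<open>S\<^sup>2 = Id\<close>; see \<open>sl_S_sl_S\<close> below.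
\<close>

definition sl_S ::
    "nat \<Rightarrow> ((nat \<times> nat) list \<Rightarrow> 'a::field_char_0 fls) \<Rightarrow> (nat \<times> nat) list \<Rightarrow> 'a fls" where
  "sl_S n = lin_ext2 (sl_tensor n) (\<lambda>x y.
     if basis_less x y then (qpar powi weight n x y) \<odot>\<^bsub>sl_tensor n\<^esub> word [y, x]
     else if x = y then word [x, x]
     else (qpar powi (- weight n y x)) \<odot>\<^bsub>sl_tensor n\<^esub> word [y, x])"

lemma sl_S_sl_S:
  fixes z :: "(nat \<times> nat) list \<Rightarrow> 'a::field_char_0 fls"
  assumes "z \<in> carrier (sl_tensor n)" and "\<And>w. z w \<noteq> 0 \<Longrightarrow> length w = 2"
  shows "sl_S n (sl_S n z) = z"
proof -
  define c where "c x y = (if basis_less x y then qpar powi weight n x y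
     else if x = y then 1 else qpar powi (- weight n y x) :: 'a fls)" for x y
  define F where "F x y = (\<lambda>w. c x y * word [y, x] w)" for x y
  have F: "sl_S n = lin_ext2 (sl_tensor n) F"
    unfolding sl_S_def F_def c_def
    by (rule arg_cong[where f = "lin_ext2 _"]) (auto simp: free_algebra_def fun_eq_iff)
  note k = subring_typeD[OF subring_k_ring]
  have c_in: "c x y \<in> k_ring" for x y
    by (auto simp: c_def qpar_powi_in k)
  have cc: "c x y * c y x = 1" for x y
    by (cases x; cases y) (auto simp: c_def basis_less_def power_int_minus)
  let ?h = "\<lambda>g w. if length w = 2 then c (w ! 1) (w ! 0) * g [w ! 1, w ! 0] else (0 :: 'a fls)"
  have S: "sl_S n g = ?h g" and Sc: "?h g \<in> carrier (sl_tensor n)"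
    if g: "g \<in> carrier (sl_tensor n)" for g
  proof -
    let ?W = "{w. g w \<noteq> 0 \<and> length w = 2}"
    have W: "finite ?W" "\<And>w. w \<in> ?W \<Longrightarrow> w = [w ! 0, w ! 1]"
      using g by (auto simp: free_algebra_def length_Suc_conv numeral_2_eq_2)
    have inc: "(\<lambda>v. g w * F (w ! 0) (w ! 1) v) \<in> carrier (sl_tensor n)" if "w \<in> ?W" for w
    proof -
      have "set w \<subseteq> sl_basis n" "g w \<in> k_ring"
        using g that by (auto simp: free_algebra_def)
      moreover have "set [w ! 1, w ! 0] = set w"
        using arg_cong[OF W(2)[OF that], of set] by auto
      ultimately show ?thesis
        by (auto simp: free_algebra_def F_def word_def image_subset_iff k c_in)
    qed
    have "sl_S n g = (\<Oplus>\<^bsub>sl_tensor n\<^esub>w\<in>?W. (\<lambda>v. g w * F (w ! 0) (w ! 1) v))"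
      by (simp add: F lin_ext2_def free_algebra_def)
    also have "\<dots> = (\<lambda>v. \<Sum>w\<in>?W. g w * F (w ! 0) (w ! 1) v)"
      using inc W(1) by (intro finsum_free_algebra subring_k_ring)
    also have "\<dots> = ?h g"
    proof
      fix v
      have "(\<Sum>w\<in>?W. g w * F (w ! 0) (w ! 1) v)
          = (\<Sum>w\<in>?W. if w = [v ! 1, v ! 0] then (if length v = 2 then c (v ! 1) (v ! 0) * g w else 0) else 0)"
      proof (rule sum.cong)
        fix w assume "w \<in> ?W"
        then obtain a b where "w = [a, b]" by (auto simp: length_Suc_conv numeral_2_eq_2)
        then show "g w * F (w ! 0) (w ! 1) v
            = (if w = [v ! 1, v ! 0] then (if length v = 2 then c (v ! 1) (v ! 0) * g w else 0) else 0)"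
        proof (cases "length v = 2")
          case True
          then obtain p q where "v = [p, q]" by (auto simp: length_Suc_conv numeral_2_eq_2)
          with \<open>w = [a, b]\<close> show ?thesis by (simp add: F_def word_def)
        next
          case False
          with \<open>w = [a, b]\<close> show ?thesis by (auto simp: F_def word_def)
        qed
      qed simp
      also have "\<dots> = ?h g v"
        using W(1) by (auto simp: sum.delta)
      finally show "(\<Sum>w\<in>?W. g w * F (w ! 0) (w ! 1) v) = ?h g v" .
    qed
    finally show "sl_S n g = ?h g" .
    have supp: "{w. ?h g w \<noteq> 0} \<subseteq> rev ` ?W"
    proof
      fix w assume w: "w \<in> {w. ?h g w \<noteq> 0}"
      then have "length w = 2" "g [w ! 1, w ! 0] \<noteq> 0" by (auto split: if_splits)
      then have "rev w \<in> ?W" by (auto simp: length_Suc_conv numeral_2_eq_2)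
      then show "w \<in> rev ` ?W" by (rule rev_image_eqI) simp
    qed
    show "?h g \<in> carrier (sl_tensor n)"
    proof -
      have "range g \<subseteq> k_ring" "\<And>w. g w \<noteq> 0 \<Longrightarrow> set w \<subseteq> sl_basis n"
        using g by (auto simp: free_algebra_def)
      then have "range (?h g) \<subseteq> k_ring" "\<forall>w. ?h g w \<noteq> 0 \<longrightarrow> set w \<subseteq> sl_basis n"
        by (auto simp: image_subset_iff k c_in length_Suc_conv numeral_2_eq_2) fastforce+
      moreover have "finite {w. ?h g w \<noteq> 0}"
        using supp W(1) by (meson finite_imageI finite_subset)
      ultimately show ?thesis by (simp add: free_algebra_def)
    qed
  qed
  show ?thesis
  proof
    fix w
    show "sl_S n (sl_S n z) w = z w"
    proof (cases "length w = 2")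
      case True
      then obtain a b where w: "w = [a, b]" by (auto simp: length_Suc_conv numeral_2_eq_2)
      have "sl_S n (sl_S n z) w = (c b a * c a b) * z [a, b]"
        unfolding S[OF assms(1)] S[OF Sc[OF assms(1)]] by (simp add: w mult.assoc)
      then show ?thesis by (simp add: cc w)
    next
      case False
      then show ?thesis
        using assms(2)[of w] unfolding S[OF assms(1)] S[OF Sc[OF assms(1)]] by auto
    qed
  qed
qed

definition sl_bracket ::
    "nat \<Rightarrow> ((nat \<times> nat) list \<Rightarrow> 'a::field_char_0 fls) \<Rightarrow> (nat \<times> nat) list \<Rightarrow> 'a fls" where
  "sl_bracket n = lin_ext2 (sl_tensor n) (\<lambda>x y.
     if basis_less x y then of_matrix n (commutator n (munit x) (munit y))
     else if x = y then \<zero>\<^bsub>sl_tensor n\<^esub>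
     else (- (qpar powi (- weight n y x))) \<odot>\<^bsub>sl_tensor n\<^esub>
            of_matrix n (commutator n (munit y) (munit x)))"

definition sl_pairing ::
    "nat \<Rightarrow> ((nat \<times> nat) list \<Rightarrow> 'a::field_char_0 fls) \<Rightarrow> (nat \<times> nat) list \<Rightarrow> 'a fls" where
  "sl_pairing n = lin_ext2 (sl_tensor n) (\<lambda>(i, j) (u, v).
     if i < u \<and> u < j \<and> j < v
       then (qpar - inverse qpar) \<odot>\<^bsub>sl_tensor n\<^esub> word [(i, v), (u, j)]
     else if u < i \<and> i < v \<and> v < j
       then (inverse qpar - qpar) \<odot>\<^bsub>sl_tensor n\<^esub> word [(u, j), (i, v)]
     else \<zero>\<^bsub>sl_tensor n\<^esub>)"

definition sl_T ::
    "nat \<Rightarrow> ((nat \<times> nat) list \<Rightarrow> 'a::field_char_0 fls) \<Rightarrow> (nat \<times> nat) list \<Rightarrow> 'a fls" where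
  "sl_T n z = sl_S n z \<oplus>\<^bsub>sl_tensor n\<^esub> sl_pairing n z"

definition U_sl ::
    "nat \<Rightarrow> ('a::field_char_0 fls, ((nat \<times> nat) list \<Rightarrow> 'a fls) set) module" where
  "U_sl n = quot_algebra (sl_tensor n) (Idl\<^bsub>sl_tensor n\<^esub>
     {word [x, y] \<ominus>\<^bsub>sl_tensor n\<^esub> sl_T n (word [x, y]) \<ominus>\<^bsub>sl_tensor n\<^esub> sl_bracket n (word [x, y])
       | x y. x \<in> sl_basis n \<and> y \<in> sl_basis n})"


section \<open>The positive part of the quantum group\<close>

definition qserre :: "nat \<Rightarrow> (nat list \<Rightarrow> 'a::field_char_0 fls) set" where
  "qserre n =
     (let A = free_algebra Kq {1..n}; E = (\<lambda>i. word [i]) in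
       {E i \<otimes>\<^bsub>A\<^esub> E j \<ominus>\<^bsub>A\<^esub> E j \<otimes>\<^bsub>A\<^esub> E i
         | i j. i \<in> {1..n} \<and> j \<in> {1..n} \<and> \<bar>int i - int j\<bar> > 1} \<union>
       {E i \<otimes>\<^bsub>A\<^esub> E i \<otimes>\<^bsub>A\<^esub> E j
          \<ominus>\<^bsub>A\<^esub> (qpar + inverse qpar) \<odot>\<^bsub>A\<^esub> (E i \<otimes>\<^bsub>A\<^esub> E j \<otimes>\<^bsub>A\<^esub> E i)
          \<oplus>\<^bsub>A\<^esub> E j \<otimes>\<^bsub>A\<^esub> E i \<otimes>\<^bsub>A\<^esub> E i
         | i j. i \<in> {1..n} \<and> j \<in> {1..n} \<and> \<bar>int i - int j\<bar> = 1})"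

definition Uq_plus_Kq :: "nat \<Rightarrow> ('a::field_char_0 fls, (nat list \<Rightarrow> 'a fls) set) module" where
  "Uq_plus_Kq n =
     quot_algebra (free_algebra Kq {1..n}) (Idl\<^bsub>free_algebra Kq {1..n}\<^esub> (qserre n))"

definition Uq_plus :: "nat \<Rightarrow> ('a::field_char_0 fls, (nat list \<Rightarrow> 'a fls) set) module" where
  "Uq_plus n = gen_subalgebra k_ring (Uq_plus_Kq n)
     ((\<lambda>i. Idl\<^bsub>free_algebra Kq {1..n}\<^esub> (qserre n) +>\<^bsub>free_algebra Kq {1..n}\<^esub> word [i]) ` {1..n})"

end

theory Submission
  imports Defs
begin

text \<open>
  The isomorphism sends \<open>e\<^sub>i\<^sub>j\<close> to the root vector \<open>E\<^sub>i\<^sub>j\<close> given by \<open>E\<^sub>i\<^sub>,\<^sub>i\<^sub>+\<^sub>1 = E\<^sub>i\<close> and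
  \<open>E\<^sub>i\<^sub>,\<^sub>j\<^sub>+\<^sub>1 = E\<^sub>i\<^sub>j E\<^sub>j - q\<^sup>-\<^sup>1 E\<^sub>j E\<^sub>i\<^sub>j\<close>. The quantum Serre relations imply the defining relations of
  \<open>U((sl\<^sub>n\<^sub>+\<^sub>1\<^sup>+)\<^sub>q)\<close> for the root vectors; the decisive one is that \<open>E\<^sub>i\<^sub>+\<^sub>1\<close> commutes with \<open>E\<^sub>i\<^sub>,\<^sub>i\<^sub>+\<^sub>3\<close>,
  where one divides by \<open>q + q\<^sup>-\<^sup>1\<close>. For injectivity, the relations of \<open>U((sl\<^sub>n\<^sub>+\<^sub>1\<^sup>+)\<^sub>q)\<close> allow one to
  write every element as a \<open>k\<close>-combination of sorted words. Their images are linearly independent over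
  \<open>K(q)\<close>: under Feigin's homomorphism \<open>E\<^sub>a \<mapsto> \<Sum>\<^sub>b X\<^bsub>(a,b)\<^esub>\<close> into a quantum torus the leading monomial of
  \<open>E\<^sub>i\<^sub>j\<close> is \<open>X\<^bsub>(i,0)\<^esub> X\<^bsub>(i+1,1)\<^esub> \<dots> X\<^bsub>(j-1,j-1-i)\<^esub>\<close>, and the exponents of these monomials are linearly
  independent.
\<close>

section \<open>Congruences between \<open>q\<close>-commutators\<close>

text \<open>\<open>Uq_plus\<close> is cut out of an algebra over K(q) as a
  \<open>k\<close>-subalgebra and comes without a presentation over \<open>k\<close>, so a map out
  of it cannot be given on generators. A homomorphism is therefore built in the other direction:
  \<open>Phi\<close> sends the free \<open>k\<close>-algebra on the \<open>e_ij\<close> into the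
  free algebra over K(q), its image modulo the Serre ideal is identified with
  \<open>Uq_plus\<close>, and the preimage of the Serre ideal with the ideal of \<open>U_sl\<close>.
  The two rings of scalars cannot be merged: q + q^-1 is not a unit of \<open>k\<close>, so the
  relations between root vectors are derived over K(q), whereas normal forms must have coefficients
  in \<open>k\<close>. The latter is possible because exchanging two letters costs only a unit q^c,
  besides corrections with coefficients in \<open>k\<close>. The quantum torus is never constructed:
  its letters act as twisted shifts on functions of exponent vectors, so associativity comes for
  free and a function concentrated at one exponent vector reads off a coefficient.\<close>

locale algebra_over =
  fixes scale :: "'r::comm_ring_1 \<Rightarrow> 'b::ring_1 \<Rightarrow> 'b" (infixr "\<bullet>" 75)
  assumes scale_add_right: "a \<bullet> (x + y) = a \<bullet> x + a \<bullet> y"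
    and scale_add_left: "(a + b) \<bullet> x = a \<bullet> x + b \<bullet> x"
    and scale_scale: "a \<bullet> b \<bullet> x = (a * b) \<bullet> x"
    and scale_one [simp]: "1 \<bullet> x = x"
    and mult_scale_left: "(a \<bullet> x) * y = a \<bullet> (x * y)"
    and mult_scale_right: "x * (a \<bullet> y) = a \<bullet> (x * y)"
begin

lemma scale_zero_left [simp]: "0 \<bullet> x = 0"
  using scale_add_left[of 0 0 x] by simp

lemma scale_zero_right [simp]: "a \<bullet> 0 = 0"
  using scale_add_right[of a 0 0] by simp

lemma scale_minus_left [simp]: "(- a) \<bullet> x = - (a \<bullet> x)"
  using scale_add_left[of "- a" a x] by (simp add: eq_neg_iff_add_eq_0)

lemma scale_minus_right [simp]: "a \<bullet> (- x) = - (a \<bullet> x)"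
  using scale_add_right[of a "- x" x] by (simp add: eq_neg_iff_add_eq_0)

lemma scale_diff_left: "(a - b) \<bullet> x = a \<bullet> x - b \<bullet> x"
  using scale_add_left[of a "- b" x] by simp

lemma scale_diff_right: "a \<bullet> (x - y) = a \<bullet> x - a \<bullet> y"
  using scale_add_right[of a x "- y"] by simp

lemma scale_sum_right: "a \<bullet> (\<Sum>i\<in>I. f i) = (\<Sum>i\<in>I. a \<bullet> f i)"
  by (induction I rule: infinite_finite_induct) (simp_all add: scale_add_right)

lemmas scale_simps = scale_add_right scale_add_left scale_diff_left scale_diff_right scale_scale
  mult_scale_left mult_scale_right

end

lemma nat_induct_above [consumes 1, case_names base step]:
  assumes "a < b" "P (Suc a)" "\<And>b. a < b \<Longrightarrow> P b \<Longrightarrow> P (Suc b)"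
  shows "P (b :: nat)"
  using assms(1) by (rule Suc_le_eq[THEN iffD2, THEN dec_induct]) (use assms(2,3) in auto)

locale q_algebra = algebra_over scale
  for scale :: "'r::comm_ring_1 \<Rightarrow> 'b::ring_1 \<Rightarrow> 'b" (infixr "\<bullet>" 75) +
  fixes q p :: 'r
  assumes q_p: "q * p = 1"
begin

lemma p_q: "p * q = 1"
  using q_p by (simp add: mult.commute)

lemma q_p_mult: "q * (p * a) = a" "p * (q * a) = a"
  by (simp_all add: mult.assoc[symmetric] q_p p_q)

lemmas q_simps = q_p p_q q_p_mult

text \<open>The factor \<open>p\<close>, not \<open>q\<close>, matches the relation for adjacent
  matrix units, where \<open>S\<close> contributes q^-1. It also turns the Serre relations into
  \<open>q\<close>-commutation and kills the non-increasing chains in Feigin's model.\<close>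

definition br :: "'b \<Rightarrow> 'b \<Rightarrow> 'b" where
  "br x y = x * y - p \<bullet> (y * x)"

primrec root_vector :: "(nat \<Rightarrow> 'b) \<Rightarrow> nat \<Rightarrow> nat \<Rightarrow> 'b" where
  "root_vector E i 0 = E i"
| "root_vector E i (Suc d) = br (root_vector E i d) (E (i + d + 1))"

text \<open>\<open>root_vector\<close> counts the letters after the first, so that it is primitive
  recursive. For \<open>j \<le> i\<close> truncated subtraction gives the junk value
  \<open>E i\<close>.\<close>

definition e_vec :: "(nat \<Rightarrow> 'b) \<Rightarrow> nat \<Rightarrow> nat \<Rightarrow> 'b" where
  "e_vec E i j = root_vector E i (j - Suc i)"

lemma e_vec_Suc: "e_vec E i (Suc i) = E i"
  by (simp add: e_vec_def)

lemma e_vec_Suc_right: "i < j \<Longrightarrow> e_vec E i (Suc j) = br (e_vec E i j) (E j)"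
  by (auto simp: e_vec_def dest!: less_imp_Suc_add)

end

text \<open>The quotient by a set-based ideal is not a type, so equations in it become congruences
  modulo \<open>J\<close> between elements of a ring type. \<open>J\<close> is an ideal only
  relative to the subalgebra \<open>C\<close> and the scalars \<open>R\<close>; this is why
  membership in \<open>C\<close> and \<open>R\<close> has to be tracked throughout.\<close>

locale q_congruence = q_algebra scale q p
  for scale :: "'r::comm_ring_1 \<Rightarrow> 'b::ring_1 \<Rightarrow> 'b" (infixr "\<bullet>" 75) and q p +
  fixes R :: "'r set" and C J :: "'b set"
  assumes q_in: "q \<in> R" and p_in: "p \<in> R"
    and R_mult: "a \<in> R \<Longrightarrow> b \<in> R \<Longrightarrow> a * b \<in> R"
    and C_diff: "x \<in> C \<Longrightarrow> y \<in> C \<Longrightarrow> x - y \<in> C"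
    and C_mult: "x \<in> C \<Longrightarrow> y \<in> C \<Longrightarrow> x * y \<in> C"
    and C_scale: "a \<in> R \<Longrightarrow> x \<in> C \<Longrightarrow> a \<bullet> x \<in> C"
    and J_zero: "0 \<in> J"
    and J_diff: "x \<in> J \<Longrightarrow> y \<in> J \<Longrightarrow> x - y \<in> J"
    and J_mult_left: "x \<in> C \<Longrightarrow> y \<in> J \<Longrightarrow> x * y \<in> J"
    and J_mult_right: "x \<in> J \<Longrightarrow> y \<in> C \<Longrightarrow> x * y \<in> J"
    and J_scale: "a \<in> R \<Longrightarrow> x \<in> J \<Longrightarrow> a \<bullet> x \<in> J"
begin

lemma J_minus: "x \<in> J \<Longrightarrow> - x \<in> J"
  using J_diff[OF J_zero] by simp

lemma J_add: "x \<in> J \<Longrightarrow> y \<in> J \<Longrightarrow> x + y \<in> J"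
  using J_diff[OF _ J_minus] by simp

lemma br_in: "x \<in> C \<Longrightarrow> y \<in> C \<Longrightarrow> br x y \<in> C"
  unfolding br_def by (intro C_diff C_mult C_scale p_in)

definition cong :: "'b \<Rightarrow> 'b \<Rightarrow> bool" (infix "\<doteq>" 50) where
  "x \<doteq> y \<longleftrightarrow> x - y \<in> J"

definition qcomm :: "'r \<Rightarrow> 'b \<Rightarrow> 'b \<Rightarrow> bool" where
  "qcomm c x y \<longleftrightarrow> x * y \<doteq> c \<bullet> (y * x)"

lemma cong_refl [simp]: "x \<doteq> x"
  by (simp add: cong_def J_zero)

lemma cong_sym: "x \<doteq> y \<Longrightarrow> y \<doteq> x"
  unfolding cong_def using J_minus by fastforce

lemma cong_trans [trans]: "x \<doteq> y \<Longrightarrow> y \<doteq> z \<Longrightarrow> x \<doteq> z"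
  unfolding cong_def using J_add by fastforce

lemma cong_by: "z \<in> J \<Longrightarrow> x - y = z \<Longrightarrow> x \<doteq> y"
  by (simp add: cong_def)

lemma cong_add: "x \<doteq> x' \<Longrightarrow> y \<doteq> y' \<Longrightarrow> x + y \<doteq> x' + y'"
  unfolding cong_def using J_add by (fastforce simp: algebra_simps)

lemma cong_diff: "x \<doteq> x' \<Longrightarrow> y \<doteq> y' \<Longrightarrow> x - y \<doteq> x' - y'"
  unfolding cong_def using J_diff by (fastforce simp: algebra_simps)

lemma cong_scale: "a \<in> R \<Longrightarrow> x \<doteq> y \<Longrightarrow> a \<bullet> x \<doteq> a \<bullet> y"
  unfolding cong_def using J_scale by (fastforce simp: scale_diff_right)

lemma cong_mult_left: "x \<in> C \<Longrightarrow> y \<doteq> y' \<Longrightarrow> x * y \<doteq> x * y'"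
  unfolding cong_def using J_mult_left by (fastforce simp: algebra_simps)

lemma cong_mult_right: "x \<doteq> x' \<Longrightarrow> y \<in> C \<Longrightarrow> x * y \<doteq> x' * y"
  unfolding cong_def using J_mult_right by (fastforce simp: algebra_simps)

lemma br_cong_left: "x \<doteq> x' \<Longrightarrow> y \<in> C \<Longrightarrow> br x y \<doteq> br x' y"
  unfolding br_def by (intro cong_diff cong_scale cong_mult_left cong_mult_right p_in)

lemma qcomm_cong_right:
  assumes "qcomm c x y" "y' \<doteq> y" "x \<in> C" "c \<in> R"
  shows "qcomm c x y'"
proof -
  have "x * y' \<doteq> x * y" using assms by (intro cong_mult_left)
  also have "x * y \<doteq> c \<bullet> (y * x)" using assms by (simp add: qcomm_def)
  also have "\<dots> \<doteq> c \<bullet> (y' * x)" using assms by (intro cong_scale cong_mult_right cong_sym[OF assms(2)])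
  finally show ?thesis by (simp add: qcomm_def)
qed

lemma qcomm_cong_left:
  assumes "qcomm c x y" "x' \<doteq> x" "y \<in> C" "c \<in> R"
  shows "qcomm c x' y"
proof -
  have "x' * y \<doteq> x * y" using assms by (intro cong_mult_right)
  also have "x * y \<doteq> c \<bullet> (y * x)" using assms by (simp add: qcomm_def)
  also have "\<dots> \<doteq> c \<bullet> (y * x')" using assms by (intro cong_scale cong_mult_left cong_sym[OF assms(2)])
  finally show ?thesis by (simp add: qcomm_def)
qed

lemma qcomm_one_sym: "qcomm 1 x y \<Longrightarrow> qcomm 1 y x"
  unfolding qcomm_def by (auto dest: cong_sym)

text \<open>The two sides differ by \<open>p\<close> times the commutator of \<open>y\<close> with
  \<open>x * z - z * x\<close>. So commuting outer factors allow rebracketing.\<close>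

lemma br_assoc:
  assumes "qcomm 1 x z" "y \<in> C"
  shows "br x (br y z) \<doteq> br (br x y) z"
proof -
  define u where "u = x * z - z * x"
  have "u \<in> J" using assms(1) by (simp add: u_def qcomm_def cong_def)
  then have "p \<bullet> (y * u) - p \<bullet> (u * y) \<in> J"
    using assms(2) by (intro J_diff J_scale J_mult_left J_mult_right p_in)
  then show ?thesis
    by (rule cong_by) (simp add: u_def br_def scale_simps algebra_simps)
qed

text \<open>Moving \<open>x\<close> through either product of the bracket costs \<open>c\<close>
  once and \<open>d\<close> once, in some order.\<close>

lemma qcomm_br_right:
  assumes "qcomm c x y" "qcomm d x z" "x \<in> C" "y \<in> C" "z \<in> C" "c \<in> R" "d \<in> R"
  shows "qcomm (c * d) x (br y z)"
proof -
  define u where "u = x * y - c \<bullet> (y * x)"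
  define v where "v = x * z - d \<bullet> (z * x)"
  have "u \<in> J" "v \<in> J" using assms(1,2) by (simp_all add: u_def v_def qcomm_def cong_def)
  then have "(u * z + c \<bullet> (y * v)) - p \<bullet> (v * y + d \<bullet> (z * u)) \<in> J"
    using assms by (intro J_diff J_add J_scale J_mult_left J_mult_right p_in)
  then show ?thesis unfolding qcomm_def
    by (rule cong_by) (simp add: u_def v_def br_def scale_simps algebra_simps)
qed

lemma qcomm_br_left:
  assumes "qcomm c y x" "qcomm d z x" "x \<in> C" "y \<in> C" "z \<in> C" "c \<in> R" "d \<in> R"
  shows "qcomm (c * d) (br y z) x"
proof -
  define u where "u = y * x - c \<bullet> (x * y)"
  define v where "v = z * x - d \<bullet> (x * z)"
  have "u \<in> J" "v \<in> J" using assms(1,2) by (simp_all add: u_def v_def qcomm_def cong_def)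
  then have "(y * v + d \<bullet> (u * z)) - p \<bullet> (z * u + c \<bullet> (v * y)) \<in> J"
    using assms by (intro J_diff J_add J_scale J_mult_left J_mult_right p_in)
  then show ?thesis unfolding qcomm_def
    by (rule cong_by) (simp add: u_def v_def br_def scale_simps algebra_simps)
qed

text \<open>A twisted Leibniz rule: replace \<open>x * y\<close> by
  \<open>q \<bullet> (y * x)\<close> and then \<open>x * z\<close> by
  \<open>br x z + p \<bullet> (z * x)\<close>.\<close>

lemma mult_br_cong:
  assumes "qcomm q x y" "z \<in> C"
  shows "x * br y z \<doteq> br y z * x + (q \<bullet> (y * br x z) - p \<bullet> (br x z * y))"
proof -
  define u where "u = x * y - q \<bullet> (y * x)"
  have "u \<in> J" using assms(1) by (simp add: u_def qcomm_def cong_def)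
  then have "u * z - (p * p) \<bullet> (z * u) \<in> J"
    using assms(2) by (intro J_diff J_scale J_mult_left J_mult_right R_mult p_in)
  then show ?thesis
    by (rule cong_by) (simp add: u_def br_def scale_simps algebra_simps q_simps)
qed

lemma br_mult_cong:
  assumes "qcomm q y v" "x \<in> C"
  shows "br x y * v \<doteq> v * br x y + (q \<bullet> (br x v * y) - p \<bullet> (y * br x v))"
proof -
  define u where "u = y * v - q \<bullet> (v * y)"
  have "u \<in> J" using assms(1) by (simp add: u_def qcomm_def cong_def)
  then have "x * u - (p * p) \<bullet> (u * x) \<in> J"
    using assms(2) by (intro J_diff J_scale J_mult_left J_mult_right R_mult p_in)
  then show ?thesis
    by (rule cong_by) (simp add: u_def br_def scale_simps algebra_simps q_simps)
qed

text \<open>Here the coefficient q - q^-1 of the pairing arises: both correction terms of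
  \<open>mult_br_cong\<close> become multiples of the same product once \<open>y\<close> commutes
  with \<open>br x z\<close>.\<close>

lemma interlaced_cong:
  assumes "qcomm q x y" "qcomm 1 (br x z) y" "x \<in> C" "y \<in> C" "z \<in> C"
  shows "x * br y z \<doteq> br y z * x + (q - p) \<bullet> (br x z * y)"
proof -
  have "x * br y z \<doteq> br y z * x + (q \<bullet> (y * br x z) - p \<bullet> (br x z * y))"
    using assms by (intro mult_br_cong)
  also have "\<dots> \<doteq> br y z * x + (q \<bullet> (br x z * y) - p \<bullet> (br x z * y))"
    using assms(2) by (intro cong_add cong_diff cong_scale cong_refl q_in)
      (simp add: qcomm_def cong_sym)
  finally show ?thesis by (simp add: scale_diff_left)
qed

text \<open>Expanding \<open>x * br x y - q \<bullet> (br x y * x)\<close> gives exactly the Serre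
  expression: the two middle terms carry \<open>p\<close> and \<open>q\<close>.\<close>

lemma qcomm_serre:
  assumes "x * x * y - (q + p) \<bullet> (x * y * x) + y * x * x \<in> J"
  shows "qcomm q x (br x y)"
  unfolding qcomm_def
  by (rule cong_by[OF assms]) (simp add: br_def scale_simps algebra_simps q_simps)

lemma qcomm_serre':
  assumes "y * y * x - (q + p) \<bullet> (y * x * y) + x * y * y \<in> J"
  shows "qcomm q (br x y) y"
  unfolding qcomm_def
  by (rule cong_by[OF assms]) (simp add: br_def scale_simps algebra_simps q_simps)

text \<open>Both evaluations of \<open>[x, y] [y, z]\<close> produce the same correction term up to the order of
  \<open>y\<close> and \<open>[x, y, z]\<close>, so \<open>q + p\<close> times their commutator vanishes.\<close>

lemma qcomm_middle:
  assumes "qcomm q (br x y) y" "qcomm q y (br y z)" "qcomm 1 x z"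
    and C: "x \<in> C" "y \<in> C" "z \<in> C" and r: "r \<in> R" "r * (q + p) = 1"
  shows "qcomm 1 (br (br x y) z) y"
proof -
  let ?s = "br (br x y) z" and ?s' = "br x (br y z)"
  have ss: "?s' \<doteq> ?s" using assms by (intro br_assoc)
  have "br x y * br y z \<doteq> br y z * br x y + (q \<bullet> (y * ?s) - p \<bullet> (?s * y))"
    using assms by (intro mult_br_cong)
  moreover have "br x y * br y z \<doteq> br y z * br x y + (q \<bullet> (?s' * y) - p \<bullet> (y * ?s'))"
    using assms by (intro br_mult_cong)
  moreover have "\<dots> \<doteq> br y z * br x y + (q \<bullet> (?s * y) - p \<bullet> (y * ?s))"
    using ss C by (intro cong_add cong_diff cong_scale cong_refl q_in p_in cong_mult_left cong_mult_right)
  ultimately have "br y z * br x y + (q \<bullet> (?s * y) - p \<bullet> (y * ?s))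
      \<doteq> br y z * br x y + (q \<bullet> (y * ?s) - p \<bullet> (?s * y))"
    by (meson cong_sym cong_trans)
  then have "(q + p) \<bullet> (?s * y - y * ?s) \<in> J"
    by (simp add: cong_def scale_simps algebra_simps)
  then have "r \<bullet> (q + p) \<bullet> (?s * y - y * ?s) \<in> J"
    by (rule J_scale[OF r(1)])
  then show ?thesis
    by (simp only: scale_scale r scale_one) (simp add: qcomm_def cong_def)
qed

end

section \<open>Relations between root vectors\<close>

locale quantum_serre = q_congruence scale q p R C J
  for scale :: "'r::comm_ring_1 \<Rightarrow> 'b::ring_1 \<Rightarrow> 'b" (infixr "\<bullet>" 75) and q p R C J +
  fixes E :: "nat \<Rightarrow> 'b" and r :: 'r
  assumes one_in: "1 \<in> R" and r_in: "r \<in> R" and r_inverse: "r * (q + p) = 1"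
    and E_in: "E i \<in> C"
    and serre_far: "Suc i < j \<Longrightarrow> E i * E j - E j * E i \<in> J"
    and serre_up: "E i * E i * E (Suc i) - (q + p) \<bullet> (E i * E (Suc i) * E i)
                     + E (Suc i) * E i * E i \<in> J"
    and serre_down: "E (Suc i) * E (Suc i) * E i - (q + p) \<bullet> (E (Suc i) * E i * E (Suc i))
                     + E i * E (Suc i) * E (Suc i) \<in> J"
begin

abbreviation e :: "nat \<Rightarrow> nat \<Rightarrow> 'b" where
  "e \<equiv> e_vec E"

lemma e_in: "e i j \<in> C"
proof -
  have "root_vector E i d \<in> C" for d
    by (induction d) (simp_all add: E_in br_in)
  then show ?thesis by (simp add: e_vec_def)
qed

lemmas intros = e_in E_in br_in one_in q_in p_in

lemma qcomm_E_far: "Suc i < j \<Longrightarrow> qcomm 1 (E i) (E j)"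
  using serre_far by (simp add: qcomm_def cong_def)

text \<open>The letters of \<open>e a b\<close> are \<open>E a\<close> up to
  \<open>E (b - 1)\<close>, so \<open>b < u\<close> leaves a distance of at least two between the
  indices.\<close>

lemma qcomm_e_E_above:
  assumes "a < b" "b < u" shows "qcomm 1 (e a b) (E u)"
  using assms
proof (induction b rule: nat_induct_above)
  case base
  then show ?case by (simp add: e_vec_Suc qcomm_E_far)
next
  case (step b)
  then have "qcomm (1 * 1) (br (e a b) (E b)) (E u)"
    by (intro qcomm_br_left qcomm_E_far intros) auto
  with step show ?case by (simp add: e_vec_Suc_right)
qed

lemma qcomm_E_e_below:
  assumes "a < b" "Suc u < a" shows "qcomm 1 (E u) (e a b)"
  using assms
proof (induction b rule: nat_induct_above)
  case base
  then show ?case by (simp add: e_vec_Suc qcomm_E_far)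
next
  case (step b)
  then have "qcomm (1 * 1) (E u) (br (e a b) (E b))"
    by (intro qcomm_br_right qcomm_E_far intros) auto
  with step show ?case by (simp add: e_vec_Suc_right)
qed

lemma qcomm_e_disjoint:
  assumes "u < v" "a < b" "b < u" shows "qcomm 1 (e a b) (e u v)"
  using assms
proof (induction v rule: nat_induct_above)
  case base
  then show ?case by (simp add: e_vec_Suc qcomm_e_E_above)
next
  case (step v)
  then have "qcomm (1 * 1) (e a b) (br (e u v) (E v))"
    by (intro qcomm_br_right qcomm_e_E_above intros) auto
  with step show ?case by (simp add: e_vec_Suc_right)
qed

text \<open>The definition splits off only the last letter; since \<open>E v\<close> commutes with
  \<open>e a b\<close>, \<open>br_assoc\<close> moves the cut to any \<open>b\<close> in
  between.\<close>

lemma e_br: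
  assumes "b < v" "a < b" shows "e a v \<doteq> br (e a b) (e b v)"
  using assms
proof (induction v rule: nat_induct_above)
  case base
  then show ?case by (simp add: e_vec_Suc e_vec_Suc_right)
next
  case (step v)
  then have "e a (Suc v) = br (e a v) (E v)"
    by (simp add: e_vec_Suc_right)
  also have "\<dots> \<doteq> br (br (e a b) (e b v)) (E v)"
    using step by (intro br_cong_left intros)
  also have "\<dots> \<doteq> br (e a b) (br (e b v) (E v))"
    using step by (intro cong_sym[OF br_assoc] qcomm_e_E_above intros)
  also have "\<dots> = br (e a b) (e b (Suc v))"
    using step by (simp add: e_vec_Suc_right)
  finally show ?case .
qed

lemma qcomm_e_E_middle: "qcomm 1 (e i (Suc (Suc (Suc i)))) (E (Suc i))"
proof -
  have "e i (Suc (Suc (Suc i))) = br (br (E i) (E (Suc i))) (E (Suc (Suc i)))"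
    by (simp add: e_vec_Suc_right e_vec_Suc)
  moreover have "qcomm 1 \<dots> (E (Suc i))"
    using serre_up serre_down
    by (intro qcomm_middle[of _ _ _ r] qcomm_serre' qcomm_serre qcomm_E_far intros r_in r_inverse) auto
  ultimately show ?thesis by simp
qed

text \<open>Cutting with \<open>e_br\<close> just before \<open>c - 1\<close> and just after
  \<open>c + 1\<close> removes only letters that commute with \<open>E c\<close>. What remains is
  the three-letter case \<open>qcomm_e_E_middle\<close>.\<close>

lemma qcomm_e_E_inside:
  assumes "a < c" "Suc c < b" shows "qcomm 1 (e a b) (E c)"
proof -
  have *: "qcomm 1 (e a (Suc (Suc c))) (E c)"
  proof (cases "c = Suc a")
    case True
    then show ?thesis using qcomm_e_E_middle by simp
  next
    case False
    with assms obtain c' where c: "c = Suc c'" "a < c'"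
      by (cases c) auto
    have "qcomm (1 * 1) (br (e a c') (e c' (Suc (Suc c)))) (E c)"
      using qcomm_e_E_middle[of c'] c assms
      by - (rule qcomm_br_left; auto intro: qcomm_e_E_above intros)
    moreover have "e a (Suc (Suc c)) \<doteq> br (e a c') (e c' (Suc (Suc c)))"
      using c by (intro e_br) auto
    ultimately show ?thesis
      by - (rule qcomm_cong_left[of 1 "br (e a c') (e c' (Suc (Suc c)))"]; auto intro: intros)
  qed
  show ?thesis
  proof (cases "b = Suc (Suc c)")
    case True
    with * show ?thesis by simp
  next
    case False
    let ?c = "Suc (Suc c)"
    have "qcomm (1 * 1) (br (e a ?c) (e ?c b)) (E c)"
      using * False assms
      by - (rule qcomm_br_left; auto intro: qcomm_one_sym[OF qcomm_E_e_below] intros)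
    moreover have "e a b \<doteq> br (e a ?c) (e ?c b)"
      using assms False by (intro e_br) auto
    ultimately show ?thesis
      by - (rule qcomm_cong_left[of 1 "br (e a ?c) (e ?c b)"]; auto intro: intros)
  qed
qed

lemma qcomm_e_nested:
  assumes "u < v" "a < u" "v < b" shows "qcomm 1 (e a b) (e u v)"
  using assms
proof (induction v rule: nat_induct_above)
  case base
  then show ?case by (simp add: e_vec_Suc qcomm_e_E_inside)
next
  case (step v)
  then have "qcomm (1 * 1) (e a b) (br (e u v) (E v))"
    by (intro qcomm_br_right qcomm_e_E_inside intros) auto
  with step show ?case by (simp add: e_vec_Suc_right)
qed

text \<open>The factor \<open>q\<close> comes from the Serre relation in the base case. Each further
  step only adds factors 1, because \<open>E b\<close> lies strictly inside
  \<open>e a (Suc (Suc b))\<close>.\<close>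

lemma qcomm_e_Suc_right: "a < b \<Longrightarrow> qcomm q (e a b) (e a (Suc b))"
proof (induction b rule: nat_induct_above)
  case base
  then show ?case
    using qcomm_serre[OF serre_up] by (simp add: e_vec_Suc_right e_vec_Suc)
next
  case (step b)
  let ?s = "e a (Suc (Suc b))"
  have s: "?s = br (e a (Suc b)) (E (Suc b))"
    using step by (simp add: e_vec_Suc_right)
  have "qcomm (q * 1) (e a b) ?s"
    unfolding s using step by (intro qcomm_br_right qcomm_e_E_above intros) auto
  moreover have "qcomm 1 (E b) ?s"
    using step by (intro qcomm_one_sym[OF qcomm_e_E_inside]) auto
  ultimately have "qcomm (q * 1) (br (e a b) (E b)) ?s"
    by (intro qcomm_br_left intros) auto
  with step show ?case by (simp add: e_vec_Suc_right)
qed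

lemma qcomm_e_same_row:
  assumes "a < b" "b < v" shows "qcomm q (e a b) (e a v)"
proof (cases "v = Suc b")
  case True
  with assms show ?thesis by (simp add: qcomm_e_Suc_right)
next
  case False
  then have "qcomm (q * 1) (e a b) (br (e a (Suc b)) (e (Suc b) v))"
    using assms by (intro qcomm_br_right qcomm_e_Suc_right qcomm_e_disjoint intros) auto
  moreover have "e a v \<doteq> br (e a (Suc b)) (e (Suc b) v)"
    using False assms by (intro e_br) auto
  ultimately show ?thesis
    by - (rule qcomm_cong_right[of q _ "br (e a (Suc b)) (e (Suc b) v)"]; auto intro: intros)
qed

text \<open>The mirror image of \<open>qcomm_e_Suc_right\<close>. As root vectors grow on the right
  by definition, the first letter is split off with \<open>e_br\<close> and the induction runs on
  the length \<open>b - a\<close>.\<close>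

lemma qcomm_e_Suc_left: "Suc a < b \<Longrightarrow> qcomm q (e a b) (e (Suc a) b)"
proof (induction a rule: measure_induct_rule[of "\<lambda>a. b - a"])
  case (less a)
  show ?case
  proof (cases "b = Suc (Suc a)")
    case True
    then show ?thesis
      using qcomm_serre'[OF serre_down] by (simp add: e_vec_Suc_right e_vec_Suc)
  next
    case False
    let ?y = "e (Suc a) b" and ?y' = "e (Suc (Suc a)) b" and ?s = "e a b"
    have lt: "Suc (Suc a) < b" using less.prems False by simp
    have s: "?s \<doteq> br (E a) ?y" and y: "?y \<doteq> br (E (Suc a)) ?y'"
      using e_br[of "Suc a" b a] e_br[of "Suc (Suc a)" b "Suc a"] lt by (simp_all add: e_vec_Suc)
    have "qcomm q ?y ?y'" using less.IH[of "Suc a"] lt by simp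
    then have "qcomm (1 * q) (br (E a) ?y) ?y'"
      using lt by (intro qcomm_br_left qcomm_E_e_below intros) auto
    then have "qcomm q ?s ?y'"
      using s by - (rule qcomm_cong_left[of q "br (E a) ?y"]; auto intro: intros)
    then have "qcomm (1 * q) ?s (br (E (Suc a)) ?y')"
      using lt by (intro qcomm_br_right qcomm_e_E_inside intros) auto
    then show ?thesis
      using y by - (rule qcomm_cong_right[of q _ "br (E (Suc a)) ?y'"]; auto intro: intros)
  qed
qed

lemma qcomm_e_same_column:
  assumes "a < u" "u < b" shows "qcomm q (e a b) (e u b)"
proof (cases "u = Suc a")
  case True
  with assms show ?thesis by (simp add: qcomm_e_Suc_left)
next
  case False
  with assms obtain u' where u: "u = Suc u'" "a < u'" by (cases u) auto
  have "qcomm (1 * q) (br (e a u') (e u' b)) (e u b)"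
    using assms u by (intro qcomm_br_left qcomm_e_disjoint intros)
      (auto intro: qcomm_e_Suc_left)
  moreover have "e a b \<doteq> br (e a u') (e u' b)"
    using assms u by (intro e_br) auto
  ultimately show ?thesis
    by - (rule qcomm_cong_left[of q "br (e a u') (e u' b)"]; auto intro: intros)
qed

lemma e_adjacent:
  assumes "a < b" "b < v" shows "e a b * e b v \<doteq> p \<bullet> (e b v * e a b) + e a v"
proof -
  have "br (e a b) (e b v) + p \<bullet> (e b v * e a b) \<doteq> e a v + p \<bullet> (e b v * e a b)"
    using assms by (intro cong_add cong_sym[OF e_br] cong_refl)
  then show ?thesis by (simp add: br_def add.commute)
qed

text \<open>Cut \<open>e u v\<close> at \<open>b\<close>. The piece \<open>e u b\<close> shares its
  column with \<open>e a b\<close>, and the bracket of \<open>e a b\<close> with the other piece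
  \<open>e b v\<close> is \<open>e a v\<close>, inside which \<open>e u b\<close> is nested.\<close>

lemma e_interlaced:
  assumes "a < u" "u < b" "b < v"
  shows "e a b * e u v \<doteq> e u v * e a b + (q - p) \<bullet> (e a v * e u b)"
proof -
  let ?y = "e u b" and ?z = "e b v"
  have v: "e u v \<doteq> br ?y ?z" and s: "e a v \<doteq> br (e a b) ?z"
    using assms by (auto intro: e_br)
  have "qcomm 1 (br (e a b) ?z) ?y"
    using s assms
    by - (rule qcomm_cong_left[of 1 "e a v"]; auto intro: qcomm_e_nested cong_sym[OF s] intros)
  then have *: "e a b * br ?y ?z \<doteq> br ?y ?z * e a b + (q - p) \<bullet> (br (e a b) ?z * ?y)"
    using assms by (intro interlaced_cong qcomm_e_same_column intros)
  have "e a b * e u v \<doteq> e a b * br ?y ?z"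
    using v by (intro cong_mult_left intros)
  also note *
  \<comment> \<open>\<open>R\<close> is not assumed to be closed under differences, so
    \<open>q - p\<close> is split before \<open>cong_scale\<close> is applied.\<close>
  also have "br ?y ?z * e a b + (q - p) \<bullet> (br (e a b) ?z * ?y)
      = br ?y ?z * e a b + (q \<bullet> (br (e a b) ?z * ?y) - p \<bullet> (br (e a b) ?z * ?y))"
    by (simp add: scale_diff_left)
  also have "\<dots> \<doteq> e u v * e a b + (q \<bullet> (e a v * ?y) - p \<bullet> (e a v * ?y))"
    using v s by (intro cong_add cong_diff cong_scale cong_mult_right intros) (auto intro: cong_sym)
  finally show ?thesis by (simp add: scale_diff_left)
qed

end

section \<open>Free algebras as a type\<close>

lemma subring_UNIV: "subring UNIV (ring_of_type_algebra :: 'r::comm_ring_1 ring)"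
proof -
  interpret ring "ring_of_type_algebra :: 'r ring" by (rule ring_from_type_algebra)
  show ?thesis using carrier_is_subring by (simp add: ring_of_type_algebra_def)
qed

text \<open>The ring laws of \<open>free_algebra\<close> are reused with all scalars and all
  letters, so that the convolution identities need no second proof.\<close>

lemma
  fixes f g h :: "'x list \<Rightarrow> 'r::comm_ring_1"
  assumes "finite {w. f w \<noteq> 0}" "finite {w. g w \<noteq> 0}" "finite {w. h w \<noteq> 0}"
  shows convolution_finite: "finite {w. (\<Sum>i\<le>length w. f (take i w) * g (drop i w)) \<noteq> 0}"
    and convolution_assoc:
      "(\<lambda>w. \<Sum>i\<le>length w. (\<Sum>j\<le>length (take i w). f (take j (take i w)) * g (drop j (take i w))) * h (drop i w))
        = (\<lambda>w. \<Sum>i\<le>length w. f (take i w) * (\<Sum>j\<le>length (drop i w). g (take j (drop i w)) * h (drop j (drop i w))))"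
    and convolution_one_left: "(\<lambda>w. \<Sum>i\<le>length w. (if take i w = [] then 1 else 0) * f (drop i w)) = f"
    and convolution_one_right: "(\<lambda>w. \<Sum>i\<le>length w. f (take i w) * (if drop i w = [] then 1 else 0)) = f"
proof -
  interpret monoid "free_algebra (UNIV :: 'r set) (UNIV :: 'x set)"
    by (rule ring.is_monoid[OF ring_free_algebra[OF subring_UNIV]])
  have c: "f \<in> carrier (free_algebra UNIV UNIV)" "g \<in> carrier (free_algebra UNIV UNIV)"
    "h \<in> carrier (free_algebra UNIV UNIV)"
    using assms by (simp_all add: free_algebra_def)
  note sel = free_algebra_def monoid.select_convs
  show "finite {w. (\<Sum>i\<le>length w. f (take i w) * g (drop i w)) \<noteq> 0}"
    using m_closed[OF c(1,2)] by (simp add: free_algebra_def)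
  show "(\<lambda>w. \<Sum>i\<le>length w. (\<Sum>j\<le>length (take i w). f (take j (take i w)) * g (drop j (take i w))) * h (drop i w))
        = (\<lambda>w. \<Sum>i\<le>length w. f (take i w) * (\<Sum>j\<le>length (drop i w). g (take j (drop i w)) * h (drop j (drop i w))))"
    using m_assoc[OF c] by (simp only: sel)
  show "(\<lambda>w. \<Sum>i\<le>length w. (if take i w = [] then 1 else 0) * f (drop i w)) = f"
    using l_one[OF c(1)] by (simp only: sel)
  show "(\<lambda>w. \<Sum>i\<le>length w. f (take i w) * (if drop i w = [] then 1 else 0)) = f"
    using r_one[OF c(1)] by (simp only: sel)
qed

typedef (overloaded) ('x, 'r) falg = "{f :: 'x list \<Rightarrow> 'r::comm_ring_1. finite {w. f w \<noteq> 0}}"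
  morphisms coef Falg
  by (rule exI[of _ "\<lambda>_. 0"]) simp

setup_lifting type_definition_falg

lemma finite_coef [simp]: "finite {w. coef f w \<noteq> 0}"
  using coef[of f] by simp

instantiation falg :: (type, comm_ring_1) ring_1
begin

lift_definition zero_falg :: "('a, 'b) falg" is "\<lambda>w. 0" by simp
lift_definition one_falg :: "('a, 'b) falg" is "\<lambda>w. if w = [] then 1 else 0" by simp
lift_definition plus_falg :: "('a, 'b) falg \<Rightarrow> ('a, 'b) falg \<Rightarrow> ('a, 'b) falg"
  is "\<lambda>f g w. f w + g w"
  by (erule (1) finite_subset[rotated, OF finite_UnI]) auto
lift_definition uminus_falg :: "('a, 'b) falg \<Rightarrow> ('a, 'b) falg" is "\<lambda>f w. - f w" by simp
lift_definition minus_falg :: "('a, 'b) falg \<Rightarrow> ('a, 'b) falg \<Rightarrow> ('a, 'b) falg"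
  is "\<lambda>f g w. f w - g w"
  by (erule (1) finite_subset[rotated, OF finite_UnI]) auto
lift_definition times_falg :: "('a, 'b) falg \<Rightarrow> ('a, 'b) falg \<Rightarrow> ('a, 'b) falg"
  is "\<lambda>f g w. \<Sum>i\<le>length w. f (take i w) * g (drop i w)"
  by (rule convolution_finite)

instance
proof
  fix a b c :: "('a, 'b) falg"
  show "a + b + c = a + (b + c)" by transfer (simp add: add.assoc)
  show "a + b = b + a" by transfer (simp add: add.commute)
  show "0 + a = a" by transfer simp
  show "- a + a = 0" by transfer simp
  show "a - b = a + - b" by transfer simp
  show "a * b * c = a * (b * c)" by transfer (rule convolution_assoc)
  show "1 * a = a" by transfer (rule convolution_one_left)
  show "a * 1 = a" by transfer (rule convolution_one_right)
  show "(a + b) * c = a * c + b * c"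
    by transfer (simp add: algebra_simps sum.distrib)
  show "a * (b + c) = a * b + a * c"
    by transfer (simp add: algebra_simps sum.distrib)
  show "(0 :: ('a, 'b) falg) \<noteq> 1"
    by transfer (metis zero_neq_one)
qed

end

lift_definition fscale :: "'r \<Rightarrow> ('x, 'r::comm_ring_1) falg \<Rightarrow> ('x, 'r) falg"
  is "\<lambda>c f w. c * f w"
  by (erule rev_finite_subset) auto

lift_definition fword :: "'x list \<Rightarrow> ('x, 'r::comm_ring_1) falg" is word
  by (simp add: word_def)

lemma coef_fword: "coef (fword v) w = (if w = v then 1 else 0)"
  by transfer (simp add: word_def)

lemma fword_Nil: "fword [] = 1"
  by transfer (simp add: word_def)

lemma fword_append: "fword (u @ v) = fword u * fword v"
proof (rule coef_inject[THEN iffD1], rule ext)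
  fix w
  have "(word u (take i w) * word v (drop i w) :: 'b)
      = (if i = length u then word (u @ v) w else 0)" if "i \<le> length w" for i
  proof (cases "i = length u")
    case True
    have "w = u @ v \<longleftrightarrow> take i w = u \<and> drop i w = v"
      using True by (metis append_eq_conv_conj)
    with True show ?thesis by (simp add: word_def)
  qed (use that in \<open>auto simp: word_def\<close>)
  then have "coef (fword u * fword v) w
      = (\<Sum>i\<le>length w. if i = length u then word (u @ v) w else (0 :: 'b))"
    unfolding times_falg.rep_eq fword.rep_eq by (intro sum.cong) auto
  also have "\<dots> = coef (fword (u @ v)) w"
    by (auto simp: word_def fword.rep_eq)
  finally show "coef (fword (u @ v)) w = coef (fword u * fword v :: ('a, 'b) falg) w" by simp
qed

interpretation falg: algebra_over fscale
  by standard (transfer; auto simp: algebra_simps sum_distrib_left)+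

lemma coef_sum: "coef (\<Sum>i\<in>I. f i) w = (\<Sum>i\<in>I. coef (f i) w)"
  by (induction I rule: infinite_finite_induct) (simp_all add: zero_falg.rep_eq plus_falg.rep_eq)

lemma falg_decompose: "f = (\<Sum>w | coef f w \<noteq> 0. fscale (coef f w) (fword w))"
proof (rule coef_inject[THEN iffD1], rule ext)
  fix v
  have "(\<Sum>w | coef f w \<noteq> 0. coef f w * (if v = w then 1 else 0)) = coef f v"
    by (simp add: if_distrib[of "(*) _"] sum.delta cong: if_cong)
  then show "coef f v = coef (\<Sum>w | coef f w \<noteq> 0. fscale (coef f w) (fword w)) v"
    by (simp add: coef_sum fscale.rep_eq coef_fword)
qed

lemma falg_induct [case_names zero add scale]:
  assumes "P 0" "\<And>f g. P f \<Longrightarrow> P g \<Longrightarrow> P (f + g)" "\<And>c w. P (fscale c (fword w))"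
  shows "P f"
proof -
  have "P (\<Sum>w\<in>S. fscale (c w) (fword w))" for S c
    by (induction S rule: infinite_finite_induct) (auto intro: assms)
  then show ?thesis using falg_decompose[of f] by metis
qed

definition falg_over :: "'r::comm_ring_1 set \<Rightarrow> 'x set \<Rightarrow> ('x, 'r) falg set" where
  "falg_over R B = {f. range (coef f) \<subseteq> R \<and> (\<forall>w. coef f w \<noteq> 0 \<longrightarrow> set w \<subseteq> B)}"

lemma coef_in_carrier_iff: "coef f \<in> carrier (free_algebra R B) \<longleftrightarrow> f \<in> falg_over R B"
  by (simp add: falg_over_def free_algebra_def)

lemma carrier_cases:
  assumes "f \<in> carrier (free_algebra R B)"
  obtains x where "f = coef x" "x \<in> falg_over R B"
proof
  show "f = coef (Falg f)"
    using assms by (simp add: Falg_inverse free_algebra_def)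
  then show "Falg f \<in> falg_over R B"
    using assms coef_in_carrier_iff by metis
qed

lemma free_algebra_coef:
  "coef f \<otimes>\<^bsub>free_algebra R B\<^esub> coef g = coef (f * g)"
  "coef f \<oplus>\<^bsub>free_algebra R B\<^esub> coef g = coef (f + g)"
  "\<one>\<^bsub>free_algebra R B\<^esub> = coef 1"
  "\<zero>\<^bsub>free_algebra R B\<^esub> = coef 0"
  "c \<odot>\<^bsub>free_algebra R B\<^esub> coef f = coef (fscale c f)"
  by (simp_all add: free_algebra_def times_falg.rep_eq plus_falg.rep_eq one_falg.rep_eq
      zero_falg.rep_eq fscale.rep_eq)

lemma word_eq_coef: "word w = coef (fword w)"
  by (simp add: fword.rep_eq)

locale coefficient_ring =
  fixes R :: "'r::comm_ring_1 set"
  assumes subring_R: "subring R (ring_of_type_algebra :: 'r ring)"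
begin

lemmas R_closed = subring_typeD[OF subring_R]

lemma R_diff: "a \<in> R \<Longrightarrow> b \<in> R \<Longrightarrow> a - b \<in> R"
  using R_closed(3)[of a "- b"] R_closed(5)[of b] by simp

lemma falg_over_zero: "0 \<in> falg_over R B"
  using R_closed by (simp add: falg_over_def zero_falg.rep_eq image_subset_iff)

lemma falg_over_add: "f \<in> falg_over R B \<Longrightarrow> g \<in> falg_over R B \<Longrightarrow> f + g \<in> falg_over R B"
  using ring.ring_simprules(1)[OF ring_free_algebra[OF subring_R]]
  by (metis coef_in_carrier_iff free_algebra_coef(2))

lemma falg_over_mult: "f \<in> falg_over R B \<Longrightarrow> g \<in> falg_over R B \<Longrightarrow> f * g \<in> falg_over R B"
  using ring.ring_simprules(5)[OF ring_free_algebra[OF subring_R]]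
  by (metis coef_in_carrier_iff free_algebra_coef(1))

lemma falg_over_scale: "c \<in> R \<Longrightarrow> f \<in> falg_over R B \<Longrightarrow> fscale c f \<in> falg_over R B"
  using R_closed(4)
  by (simp add: falg_over_def fscale.rep_eq image_subset_iff) (metis mult_zero_right)

lemma falg_over_diff:
  assumes "f \<in> falg_over R B" "g \<in> falg_over R B" shows "f - g \<in> falg_over R B"
  using falg_over_add[OF assms(1) falg_over_scale[OF _ assms(2), of "- 1"]] R_closed by simp

lemma falg_over_fword: "set w \<subseteq> B \<Longrightarrow> fword w \<in> falg_over R B"
  using R_closed by (auto simp: falg_over_def coef_fword)

lemma falg_over_induct [consumes 1, case_names zero add scale]:
  assumes "f \<in> falg_over R B"
    and "P 0" "\<And>f g. f \<in> falg_over R B \<Longrightarrow> g \<in> falg_over R B \<Longrightarrow> P f \<Longrightarrow> P g \<Longrightarrow> P (f + g)"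
    and "\<And>c w. c \<in> R \<Longrightarrow> set w \<subseteq> B \<Longrightarrow> P (fscale c (fword w))"
  shows "P f"
proof -
  have "(\<Sum>w\<in>S. fscale (coef f w) (fword w)) \<in> falg_over R B
      \<and> P (\<Sum>w\<in>S. fscale (coef f w) (fword w))" if "S \<subseteq> {w. coef f w \<noteq> 0}" for S
    using finite_subset[OF that finite_coef] that
  proof (induction S rule: finite_induct)
    case empty
    then show ?case using assms(2) falg_over_zero by simp
  next
    case (insert w S)
    then have "coef f w \<in> R" "set w \<subseteq> B"
      using assms(1) by (auto simp: falg_over_def)
    then have "fscale (coef f w) (fword w) \<in> falg_over R B" "P (fscale (coef f w) (fword w))"
      using assms(4) by (auto intro: falg_over_scale falg_over_fword)
    then show ?case using insert by (auto intro!: assms(3) falg_over_add)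
  qed
  then show ?thesis using falg_decompose[of f] by (metis order_refl)
qed

lemma free_algebra_minus:
  assumes "f \<in> falg_over R B" "g \<in> falg_over R B"
  shows "coef f \<ominus>\<^bsub>free_algebra R B\<^esub> coef g = coef (f - g)"
proof -
  interpret A: ring "free_algebra R B" by (rule ring_free_algebra[OF subring_R])
  have "coef (f - g) \<oplus>\<^bsub>free_algebra R B\<^esub> coef g = coef f"
    by (simp add: free_algebra_coef)
  moreover have "coef (f - g) \<in> carrier (free_algebra R B)" "coef f \<in> carrier (free_algebra R B)"
    "coef g \<in> carrier (free_algebra R B)"
    using assms falg_over_diff by (simp_all add: coef_in_carrier_iff)
  ultimately show ?thesis
    by (metis A.add.inv_solve_right a_minus_def)
qed

lemma ideal_coef:
  assumes "ideal I (free_algebra R B)"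
  shows "coef 0 \<in> I"
    and "coef f \<in> I \<Longrightarrow> coef g \<in> I \<Longrightarrow> coef (f + g) \<in> I"
    and "coef f \<in> I \<Longrightarrow> coef g \<in> I \<Longrightarrow> coef (f - g) \<in> I"
    and "f \<in> falg_over R B \<Longrightarrow> coef g \<in> I \<Longrightarrow> coef (f * g) \<in> I"
    and "coef f \<in> I \<Longrightarrow> g \<in> falg_over R B \<Longrightarrow> coef (f * g) \<in> I"
    and "c \<in> R \<Longrightarrow> coef f \<in> I \<Longrightarrow> coef (fscale c f) \<in> I"
    and "coef f \<in> I \<Longrightarrow> f \<in> falg_over R B"
proof -
  interpret I: ideal I "free_algebra R B" by fact
  note sub = ideal.axioms(1)[OF assms]
  show "coef 0 \<in> I"
    using additive_subgroup.zero_closed[OF sub] by (simp add: free_algebra_coef)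
  show add: "coef (f + g) \<in> I" if "coef f \<in> I" "coef g \<in> I" for f g
    using additive_subgroup.a_closed[OF sub that] by (simp add: free_algebra_coef)
  show over: "f \<in> falg_over R B" if "coef f \<in> I" for f
    using additive_subgroup.a_Hcarr[OF sub that] by (simp add: coef_in_carrier_iff)
  show left: "coef (f * g) \<in> I" if "f \<in> falg_over R B" "coef g \<in> I" for f g
    using I.I_l_closed[OF that(2), of "coef f"] that(1) by (simp add: free_algebra_coef coef_in_carrier_iff)
  show "coef (f * g) \<in> I" if "coef f \<in> I" "g \<in> falg_over R B" for f g
    using I.I_r_closed[OF that(1), of "coef g"] that(2) by (simp add: free_algebra_coef coef_in_carrier_iff)
  show scale: "coef (fscale c f) \<in> I" if "c \<in> R" "coef f \<in> I" for c f
    using left[of "fscale c 1" f] that falg_over_scale[of c 1 B] falg_over_fword[of "[]" B]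
    by (simp add: falg.mult_scale_left fword_Nil)
  show "coef (f - g) \<in> I" if "coef f \<in> I" "coef g \<in> I" for f g
    using add[OF that(1) scale[OF _ that(2)], of "- 1"] R_closed by simp
qed

text \<open>Used for kernels and preimages: once these are ideals, a statement about the generators
  passes to the generated ideal by its minimality.\<close>

lemma idealI_coef:
  assumes "P 0" "\<And>f g. P f \<Longrightarrow> P g \<Longrightarrow> P (f + g)" "\<And>f. P f \<Longrightarrow> P (- f)"
    and "\<And>f g. f \<in> falg_over R B \<Longrightarrow> P g \<Longrightarrow> P (f * g)"
    and "\<And>f g. P f \<Longrightarrow> g \<in> falg_over R B \<Longrightarrow> P (f * g)"
  shows "ideal (coef ` {f \<in> falg_over R B. P f}) (free_algebra R B)"
proof -
  interpret A: ring "free_algebra R B" by (rule ring_free_algebra[OF subring_R])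
  let ?I = "coef ` {f \<in> falg_over R B. P f}"
  have neg: "\<ominus>\<^bsub>free_algebra R B\<^esub> coef f = coef (- f)" if "f \<in> falg_over R B" for f
    using falg_over_diff[OF falg_over_zero that] that
    by (intro A.minus_equality) (simp_all add: free_algebra_coef coef_in_carrier_iff)
  show ?thesis
  proof (rule idealI[OF A.ring_axioms], rule group.subgroupI[OF A.a_group])
    show "?I \<subseteq> carrier (add_monoid (free_algebra R B))"
      by (auto simp: coef_in_carrier_iff)
    show "?I \<noteq> {}" using assms(1) falg_over_zero by blast
  next
    fix a assume "a \<in> ?I"
    then obtain f where f: "a = coef f" "f \<in> falg_over R B" "P f" by blast
    then have "- f \<in> falg_over R B"
      using falg_over_diff[OF falg_over_zero, of f B] by simp
    then show "inv\<^bsub>add_monoid (free_algebra R B)\<^esub> a \<in> ?I"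
      using f assms(3) neg[of f] by (auto simp: a_inv_def)
  next
    fix a b assume "a \<in> ?I" "b \<in> ?I"
    then show "a \<otimes>\<^bsub>add_monoid (free_algebra R B)\<^esub> b \<in> ?I"
      using assms(2) falg_over_add by (auto simp: free_algebra_coef intro!: imageI)
  next
    fix a x assume "a \<in> ?I" "x \<in> carrier (free_algebra R B)"
    then obtain f g where "a = coef f" "f \<in> falg_over R B" "P f" "x = coef g" "g \<in> falg_over R B"
      by (auto elim: carrier_cases)
    then show "x \<otimes>\<^bsub>free_algebra R B\<^esub> a \<in> ?I" "a \<otimes>\<^bsub>free_algebra R B\<^esub> x \<in> ?I"
      using assms(4,5) falg_over_mult by (auto simp: free_algebra_coef intro!: imageI)
  qed
qed

end

section \<open>Evaluation of the free algebra in an algebra\<close>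

context algebra_over
begin

definition ev :: "('x \<Rightarrow> 'b) \<Rightarrow> ('x, 'r) falg \<Rightarrow> 'b" where
  "ev h f = (\<Sum>w | coef f w \<noteq> 0. coef f w \<bullet> prod_list (map h w))"

lemma ev_superset:
  "finite S \<Longrightarrow> {w. coef f w \<noteq> 0} \<subseteq> S \<Longrightarrow> ev h f = (\<Sum>w\<in>S. coef f w \<bullet> prod_list (map h w))"
  unfolding ev_def by (rule sum.mono_neutral_left) auto

lemma ev_zero: "ev h 0 = 0"
  by (simp add: ev_def zero_falg.rep_eq)

lemma ev_add: "ev h (f + g) = ev h f + ev h g"
proof -
  let ?S = "{w. coef f w \<noteq> 0} \<union> {w. coef g w \<noteq> 0}"
  have "ev h (f + g) = (\<Sum>w\<in>?S. coef (f + g) w \<bullet> prod_list (map h w))"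
    by (rule ev_superset) (auto simp: plus_falg.rep_eq)
  also have "\<dots> = (\<Sum>w\<in>?S. coef f w \<bullet> prod_list (map h w)) + (\<Sum>w\<in>?S. coef g w \<bullet> prod_list (map h w))"
    by (simp add: plus_falg.rep_eq scale_add_left sum.distrib)
  also have "(\<Sum>w\<in>?S. coef f w \<bullet> prod_list (map h w)) = ev h f"
    by (rule ev_superset[symmetric]) auto
  also have "(\<Sum>w\<in>?S. coef g w \<bullet> prod_list (map h w)) = ev h g"
    by (rule ev_superset[symmetric]) auto
  finally show ?thesis .
qed

lemma ev_scale: "ev h (fscale c f) = c \<bullet> ev h f"
proof -
  have "ev h (fscale c f) = (\<Sum>w | coef f w \<noteq> 0. coef (fscale c f) w \<bullet> prod_list (map h w))"
    by (rule ev_superset) (auto simp: fscale.rep_eq)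
  then show ?thesis
    by (simp add: ev_def fscale.rep_eq scale_sum_right scale_scale)
qed

lemma ev_minus: "ev h (- f) = - ev h f"
  using ev_scale[of h "- 1" f] by simp

lemma ev_diff: "ev h (f - g) = ev h f - ev h g"
  using ev_add[of h f "- g"] by (simp add: ev_minus)

lemma ev_fword: "ev h (fword w) = prod_list (map h w)"
  using ev_superset[of "{w}" "fword w"] by (simp add: coef_fword)

lemma ev_one: "ev h 1 = 1"
  using ev_fword[of h "[]"] by (simp add: fword_Nil)

lemma ev_mult: "ev h (f * g) = ev h f * ev h g"
proof (induction f rule: falg_induct)
  case (scale c w)
  show ?case
  proof (induction g rule: falg_induct)
    case (scale d v)
    show ?case
      by (simp add: falg.scale_simps scale_simps ev_scale ev_fword fword_append[symmetric])
  qed (simp_all add: ev_zero ev_add distrib_left)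
qed (simp_all add: ev_zero ev_add distrib_right)

end

section \<open>The Feigin homomorphism\<close>

text \<open>The ring of linear operators takes the place of the quantum torus. No continuity or
  finiteness is required of an operator, and functions may have any support.\<close>

typedef (overloaded) ('e, 'r) linop =
    "{T :: ('e \<Rightarrow> 'r::comm_ring_1) \<Rightarrow> 'e \<Rightarrow> 'r.
       \<forall>F G c m. T (\<lambda>x. F x + c * G x) m = T F m + c * T G m}"
  morphisms app Linop
  by (rule exI[of _ "\<lambda>F. F"]) simp

setup_lifting type_definition_linop

lemma app_lin: "app T (\<lambda>x. F x + c * G x) m = app T F m + c * app T G m"
  using app[of T] by simp

lemma app_add: "app T (\<lambda>x. F x + G x) m = app T F m + app T G m"
  using app_lin[of T F 1 G m] by simp

lemma app_zero: "app T (\<lambda>x. 0) m = 0"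
  using app_lin[of T "\<lambda>x. 0" "- 1" "\<lambda>x. 0" m] by simp

lemma app_mult: "app T (\<lambda>x. c * F x) m = c * app T F m"
  using app_lin[of T "\<lambda>x. 0" c F m] by (simp add: app_zero)

instantiation linop :: (type, comm_ring_1) ring_1
begin

lift_definition zero_linop :: "('a, 'b) linop" is "\<lambda>F m. 0" by simp
lift_definition one_linop :: "('a, 'b) linop" is "\<lambda>F. F" by simp
lift_definition plus_linop :: "('a, 'b) linop \<Rightarrow> ('a, 'b) linop \<Rightarrow> ('a, 'b) linop"
  is "\<lambda>S T F m. S F m + T F m" by (simp add: algebra_simps)
lift_definition minus_linop :: "('a, 'b) linop \<Rightarrow> ('a, 'b) linop \<Rightarrow> ('a, 'b) linop"
  is "\<lambda>S T F m. S F m - T F m" by (simp add: algebra_simps)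
lift_definition uminus_linop :: "('a, 'b) linop \<Rightarrow> ('a, 'b) linop"
  is "\<lambda>T F m. - T F m" by simp
lift_definition times_linop :: "('a, 'b) linop \<Rightarrow> ('a, 'b) linop \<Rightarrow> ('a, 'b) linop"
  is "\<lambda>S T F. S (T F)"
proof -
  fix S T :: "('a \<Rightarrow> 'b) \<Rightarrow> 'a \<Rightarrow> 'b" and F G c m
  assume S: "\<And>F G c m. S (\<lambda>x. F x + c * G x) m = S F m + c * S G m"
    and "\<And>F G c m. T (\<lambda>x. F x + c * G x) m = T F m + c * T G m"
  then have "T (\<lambda>x. F x + c * G x) = (\<lambda>m. T F m + c * T G m)" by auto
  with S show "S (T (\<lambda>x. F x + c * G x)) m = S (T F) m + c * S (T G) m"
    by simp
qed

instance
proof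
  fix a b c :: "('a, 'b) linop"
  show "a + b + c = a + (b + c)" by transfer (simp add: add.assoc)
  show "a + b = b + a" by transfer (simp add: add.commute)
  show "0 + a = a" by transfer simp
  show "- a + a = 0" by transfer simp
  show "a - b = a + - b" by transfer simp
  show "a * b * c = a * (b * c)" by transfer simp
  show "1 * a = a" by transfer simp
  show "a * 1 = a" by transfer simp
  show "(a + b) * c = a * c + b * c" by transfer simp
  show "a * (b + c) = a * b + a * c"
    by (rule app_inject[THEN iffD1])
      (simp add: times_linop.rep_eq plus_linop.rep_eq app_add fun_eq_iff)
  show "(0 :: ('a, 'b) linop) \<noteq> 1"
    by transfer (metis zero_neq_one)
qed

end

lift_definition lscale :: "'r \<Rightarrow> ('e, 'r::comm_ring_1) linop \<Rightarrow> ('e, 'r) linop"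
  is "\<lambda>c T F m. c * T F m"
  by (simp add: algebra_simps)

lemma linop_eqI: "(\<And>F m. app S F m = app T F m) \<Longrightarrow> S = T"
  by (rule app_inject[THEN iffD1]) auto

lemma app_sum: "app (\<Sum>i\<in>I. T i) F m = (\<Sum>i\<in>I. app (T i) F m)"
  by (induction I rule: infinite_finite_induct) (simp_all add: zero_linop.rep_eq plus_linop.rep_eq)

lemma algebra_over_lscale: "algebra_over (lscale :: 'r::comm_ring_1 \<Rightarrow> ('e, 'r) linop \<Rightarrow> _)"
  by standard (rule linop_eqI,
      simp add: lscale.rep_eq plus_linop.rep_eq times_linop.rep_eq app_mult algebra_simps)+

section \<open>Serre relations from \<open>q\<close>-commuting summands\<close>

context q_algebra
begin

text \<open>With \<open>Y\<close> moved to the left, the terms in \<open>P * P\<close> and in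
  \<open>Q * Q\<close> cancel separately. The mixed ones leave (1 - q^2) \<open>P * Q\<close> + (1 -
  p^2) \<open>Q * P\<close>, which vanishes by the third assumption.\<close>

lemma serre_of_qcommuting:
  assumes "P * Y = q \<bullet> (Y * P)" "Q * Y = p \<bullet> (Y * Q)" "P * Q = (p * p) \<bullet> (Q * P)"
    and Z: "Z = P + Q"
  shows "Z * Z * Y - (q + p) \<bullet> (Z * Y * Z) + Y * Z * Z = 0"
proof -
  have "P * (Y * W) = q \<bullet> (Y * (P * W))" "Q * (Y * W) = p \<bullet> (Y * (Q * W))"
    "P * (Q * W) = (p * p) \<bullet> (Q * (P * W))" for W
    using assms by (metis mult.assoc mult_scale_left)+
  note rules = assms(1-3) this
  show ?thesis unfolding Z
    by (simp add: scale_simps algebra_simps rules q_simps)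
qed

text \<open>The Serre expression is linear in \<open>Y\<close>, so \<open>Y\<close> may be taken
  letter by letter, and the splitting of \<open>Z\<close> may depend on the letter.\<close>

lemma serre_sum:
  assumes "\<And>d. d \<in> D \<Longrightarrow> Z * Z * Y d - (q + p) \<bullet> (Z * Y d * Z) + Y d * Z * Z = 0"
  shows "Z * Z * (\<Sum>d\<in>D. Y d) - (q + p) \<bullet> (Z * (\<Sum>d\<in>D. Y d) * Z) + (\<Sum>d\<in>D. Y d) * Z * Z = 0"
proof -
  have "Z * Z * (\<Sum>d\<in>D. Y d) - (q + p) \<bullet> (Z * (\<Sum>d\<in>D. Y d) * Z) + (\<Sum>d\<in>D. Y d) * Z * Z
      = (\<Sum>d\<in>D. Z * Z * Y d - (q + p) \<bullet> (Z * Y d * Z) + Y d * Z * Z)"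
    by (simp add: sum_distrib_left sum_distrib_right scale_sum_right sum.distrib sum_subtractf)
  then show ?thesis using assms by simp
qed

end

text \<open>\<open>lam k l\<close> is the exponent that \<open>X\<^sub>k\<close> picks up from one unit of exponent at \<open>l\<close>. The letters
  \<open>(a, b)\<close> are ordered by \<open>b\<close>, and by decreasing \<open>a\<close> for equal \<open>b\<close>; an earlier \<open>l\<close> contributes
  the negative of the Cartan entry of the first components.\<close>

definition lam :: "nat \<times> nat \<Rightarrow> nat \<times> nat \<Rightarrow> int" where
  "lam k l =
     (if fst l = fst k \<and> snd l < snd k then - 2
      else if fst l = Suc (fst k) \<and> snd l \<le> snd k then 1
      else if Suc (fst l) = fst k \<and> snd l < snd k then 1
      else 0)"

text \<open>\<open>lam k\<close> vanishes outside the displayed finite rectangle, so the sum makes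
  sense for exponent vectors with infinite support.\<close>

definition lam_sum :: "nat \<times> nat \<Rightarrow> (nat \<times> nat \<Rightarrow> nat) \<Rightarrow> int" where
  "lam_sum k m = (\<Sum>l\<in>{fst k - 1..Suc (fst k)} \<times> {..snd k}. lam k l * int (m l))"

lemma lam_sum_upd: "lam_sum k (m(l := Suc (m l))) = lam_sum k m + lam k l"
proof -
  let ?S = "{fst k - 1..Suc (fst k)} \<times> {..snd k}"
  have "lam_sum k (m(l := Suc (m l)))
      = (\<Sum>j\<in>?S. lam k j * int (m j) + (if j = l then lam k l else 0))"
    unfolding lam_sum_def by (intro sum.cong) (auto simp: algebra_simps)
  also have "\<dots> = lam_sum k m + (if l \<in> ?S then lam k l else 0)"
    by (simp add: sum.distrib lam_sum_def)
  also have "(if l \<in> ?S then lam k l else 0) = lam k l"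
    by (cases l; cases k) (auto simp: lam_def)
  finally show ?thesis .
qed

locale feigin =
  fixes q p :: "'r::field" and n :: nat
  assumes q_nonzero: "q \<noteq> 0" and p_eq: "p = inverse q" and p_square: "p * p \<noteq> 1"
begin

sublocale q_algebra "lscale :: 'r \<Rightarrow> (nat \<times> nat \<Rightarrow> nat, 'r) linop \<Rightarrow> _" q p
  by (intro q_algebra.intro algebra_over_lscale q_algebra_axioms.intro)
    (simp add: p_eq q_nonzero)

text \<open>\<open>X_k\<close> acts as a shift of the argument with a twist. Only the difference
  \<open>lam l k - lam k l\<close> enters the commutation rule, which is why \<open>lam\<close> can
  be chosen one-sided.\<close>

lift_definition letter :: "nat \<times> nat \<Rightarrow> (nat \<times> nat \<Rightarrow> nat, 'r) linop"
  is "\<lambda>k F m. q powi lam_sum k m * F (m(k := Suc (m k)))"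
  by (simp add: algebra_simps)

lemma letter_comm: "letter k * letter l = lscale (q powi (lam l k - lam k l)) (letter l * letter k)"
proof (rule linop_eqI)
  fix F m
  have upd: "m(k := Suc (m k), l := Suc ((m(k := Suc (m k))) l))
      = m(l := Suc (m l), k := Suc ((m(l := Suc (m l))) k))" by auto
  show "app (letter k * letter l) F m = app (lscale (q powi (lam l k - lam k l)) (letter l * letter k)) F m"
    by (simp only: times_linop.rep_eq letter.rep_eq lscale.rep_eq upd lam_sum_upd)
      (simp add: power_int_add power_int_diff q_nonzero)
qed

lemma letter_far: "Suc a < c \<Longrightarrow> letter (a, b) * letter (c, d) = letter (c, d) * letter (a, b)"
  by (subst letter_comm) (simp add: lam_def)

lemma letter_adjacent:
  "letter (a, b) * letter (Suc a, d) = lscale (if b < d then q else p) (letter (Suc a, d) * letter (a, b))"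
  by (subst letter_comm) (simp add: lam_def p_eq)

lemma letter_same: "b < d \<Longrightarrow> letter (a, b) * letter (a, d) = lscale (p * p) (letter (a, d) * letter (a, b))"
  by (subst letter_comm) (simp add: lam_def p_eq power_int_minus power2_eq_square)

text \<open>\<open>n\<close> letters per generator suffice: a root vector has at most
  \<open>n\<close> letters, so its leading monomial uses second components below
  \<open>n\<close>.\<close>

definition E_op :: "nat \<Rightarrow> (nat \<times> nat \<Rightarrow> nat, 'r) linop" where
  "E_op a = (\<Sum>b<n. letter (a, b))"

lemma E_op_far: "Suc a < c \<Longrightarrow> E_op a * E_op c = E_op c * E_op a"
  unfolding E_op_def sum_product
  by (subst sum.swap) (intro sum.cong letter_far refl)

lemma E_op_split:
  "E_op a = (\<Sum>b | b < n \<and> Q b. letter (a, b)) + (\<Sum>b | b < n \<and> \<not> Q b. letter (a, b))"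
proof -
  have "{..<n} = {b. b < n \<and> Q b} \<union> {b. b < n \<and> \<not> Q b}" by auto
  then show ?thesis unfolding E_op_def by (simp only:) (rule sum.union_disjoint; auto)
qed

lemma E_op_serre_up:
  "E_op a * E_op a * E_op (Suc a) - lscale (q + p) (E_op a * E_op (Suc a) * E_op a)
     + E_op (Suc a) * E_op a * E_op a = 0"
  unfolding E_op_def[of "Suc a"]
proof (rule serre_sum, rule serre_of_qcommuting)
  fix d
  \<comment> \<open>The letters before \<open>(Suc a, d)\<close> pick up \<open>q\<close>, the
    others \<open>p\<close>; the tie \<open>b = d\<close> belongs to the latter.\<close>
  let ?P = "\<Sum>b | b < n \<and> b < d. letter (a, b)" and ?Q = "\<Sum>b | b < n \<and> \<not> b < d. letter (a, b)"
  show "E_op a = ?P + ?Q" by (rule E_op_split)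
  show "?P * letter (Suc a, d) = lscale q (letter (Suc a, d) * ?P)"
    by (simp add: sum_distrib_left sum_distrib_right scale_sum_right letter_adjacent)
  show "?Q * letter (Suc a, d) = lscale p (letter (Suc a, d) * ?Q)"
    by (simp add: sum_distrib_left sum_distrib_right scale_sum_right letter_adjacent)
  show "?P * ?Q = lscale (p * p) (?Q * ?P)"
    unfolding sum_product scale_sum_right
    by (subst sum.swap) (auto intro!: sum.cong letter_same)
qed

lemma E_op_serre_down:
  "E_op (Suc a) * E_op (Suc a) * E_op a - lscale (q + p) (E_op (Suc a) * E_op a * E_op (Suc a))
     + E_op a * E_op (Suc a) * E_op (Suc a) = 0"
  unfolding E_op_def[of a]
proof (rule serre_sum, rule serre_of_qcommuting)
  fix b
  \<comment> \<open>The tie \<open>d = b\<close> now goes to the first half: the letters that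
    precede \<open>(a, b)\<close>, including \<open>(Suc a, b)\<close>, form
    \<open>?P\<close>.\<close>
  let ?P = "\<Sum>d | d < n \<and> \<not> b < d. letter (Suc a, d)" and ?Q = "\<Sum>d | d < n \<and> b < d. letter (Suc a, d)"
  show "E_op (Suc a) = ?P + ?Q" using E_op_split[of "Suc a" "\<lambda>d. \<not> b < d"] by simp
  have flip: "letter (Suc a, d) * letter (a, b) = lscale (if b < d then p else q) (letter (a, b) * letter (Suc a, d))" for d
    by (simp add: letter_adjacent scale_scale q_simps)
  show "?P * letter (a, b) = lscale q (letter (a, b) * ?P)"
    by (simp add: sum_distrib_left sum_distrib_right scale_sum_right flip)
  show "?Q * letter (a, b) = lscale p (letter (a, b) * ?Q)"
    by (simp add: sum_distrib_left sum_distrib_right scale_sum_right flip)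
  show "?P * ?Q = lscale (p * p) (?Q * ?P)"
    unfolding sum_product scale_sum_right
    by (subst sum.swap) (auto intro!: sum.cong letter_same)
qed

text \<open>The part of the root vector of length \<open>d + 1\<close> starting at \<open>i\<close> whose last letter is
  \<open>X\<^bsub>(i+d, k)\<^esub>\<close>: only strictly increasing chains of second components survive the brackets.\<close>

primrec chain :: "nat \<Rightarrow> nat \<Rightarrow> nat \<Rightarrow> (nat \<times> nat \<Rightarrow> nat, 'r) linop" where
  "chain i 0 k = letter (i, k)"
| "chain i (Suc d) k = lscale (1 - p * p) ((\<Sum>l<k. chain i d l) * letter (Suc (i + d), k))"

lemma chain_far:
  "Suc (i + d) < a \<Longrightarrow> chain i d k * letter (a, b) = letter (a, b) * chain i d k"
proof (induction d arbitrary: k)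
  case (Suc d)
  then have letter: "letter (Suc (i + d), k) * letter (a, b) = letter (a, b) * letter (Suc (i + d), k)"
    by (intro letter_far) simp
  have S: "(\<Sum>l<k. chain i d l) * letter (a, b) = letter (a, b) * (\<Sum>l<k. chain i d l)"
    using Suc by (simp add: sum_distrib_left sum_distrib_right)
  have "(\<Sum>l<k. chain i d l) * letter (Suc (i + d), k) * letter (a, b)
      = letter (a, b) * ((\<Sum>l<k. chain i d l) * letter (Suc (i + d), k))"
    by (simp only: mult.assoc letter) (simp only: mult.assoc[symmetric] S)
  then show ?case by (simp add: mult_scale_left mult_scale_right)
qed (simp add: letter_far)

text \<open>Only the last letter \<open>(i + d, l)\<close> of the chain interacts with the new one;
  the earlier letters are at distance at least two.\<close>

lemma chain_adjacent:
  "chain i d l * letter (Suc (i + d), k)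
     = lscale (if l < k then q else p) (letter (Suc (i + d), k) * chain i d l)"
proof (cases d)
  case 0
  then show ?thesis by (simp add: letter_adjacent)
next
  case (Suc d')
  let ?S = "\<Sum>l<l. chain i d' l"
  have S: "?S * letter (Suc (i + d), k) = letter (Suc (i + d), k) * ?S"
    using Suc by (simp add: sum_distrib_left sum_distrib_right chain_far)
  have "?S * letter (Suc (i + d'), l) * letter (Suc (i + d), k)
      = lscale (if l < k then q else p) (?S * letter (Suc (i + d), k) * letter (Suc (i + d'), l))"
    using Suc by (simp add: mult.assoc letter_adjacent mult_scale_right)
  then have "?S * letter (Suc (i + d'), l) * letter (Suc (i + d), k)
      = lscale (if l < k then q else p) (letter (Suc (i + d), k) * (?S * letter (Suc (i + d'), l)))"
    by (simp only: S mult.assoc)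
  with Suc show ?thesis
    by (simp add: mult_scale_left mult_scale_right scale_scale mult.commute)
qed

lemma root_vector_chain: "root_vector E_op i d = (\<Sum>k<n. chain i d k)"
proof (induction d)
  case 0
  then show ?case by (simp add: E_op_def)
next
  case (Suc d)
  let ?L = "\<lambda>k. letter (Suc (i + d), k)"
  \<comment> \<open>For \<open>l < k\<close> the product in reverse order is \<open>p\<close> times
    the product, which gives 1 - p^2. For \<open>k \<le> l\<close> it is \<open>q\<close> times the
    product, and the bracket vanishes.\<close>
  have br: "chain i d l * ?L k - lscale p (?L k * chain i d l)
      = (if l < k then lscale (1 - p * p) (chain i d l * ?L k) else 0)" for l k
  proof -
    have "?L k * chain i d l = lscale (if l < k then p else q) (chain i d l * ?L k)"
      by (simp add: chain_adjacent scale_scale q_simps)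
    then show ?thesis by (simp add: scale_scale q_simps scale_diff_left)
  qed
  have "root_vector E_op i (Suc d)
      = (\<Sum>k<n. \<Sum>l<n. chain i d l * ?L k - lscale p (?L k * chain i d l))"
  proof -
    have "(\<Sum>l<n. chain i d l) * (\<Sum>k<n. ?L k) = (\<Sum>k<n. \<Sum>l<n. chain i d l * ?L k)"
      by (subst sum.swap) (simp add: sum_product)
    moreover have "(\<Sum>k<n. ?L k) * (\<Sum>l<n. chain i d l) = (\<Sum>k<n. \<Sum>l<n. ?L k * chain i d l)"
      by (simp add: sum_product)
    ultimately show ?thesis
      by (simp add: br_def Suc E_op_def scale_sum_right sum_subtractf)
  qed
  also have "\<dots> = (\<Sum>k<n. chain i (Suc d) k)"
  proof (rule sum.cong[OF refl])
    fix k assume "k \<in> {..<n}"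
    then have "{l \<in> {..<n}. l < k} = {..<k}" by auto
    then show "(\<Sum>l<n. chain i d l * ?L k - lscale p (?L k * chain i d l)) = chain i (Suc d) k"
      by (simp add: br sum.inter_filter[symmetric] sum_distrib_right scale_sum_right)
  qed
  finally show ?case .
qed

text \<open>Weighting each letter by its second component makes 0 < 1 < ... < d the unique chain of
  least grade. The index set contains every letter that occurs and keeps the sum finite.\<close>

definition grade :: "(nat \<times> nat \<Rightarrow> nat) \<Rightarrow> nat" where
  "grade m = (\<Sum>k\<in>{..n} \<times> {..<n}. snd k * m k)"

lemma grade_add: "grade (\<lambda>x. m x + v x) = grade m + grade v"
  by (simp add: grade_def algebra_simps sum.distrib)

definition unit_exp :: "nat \<times> nat \<Rightarrow> nat \<times> nat \<Rightarrow> nat" where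
  "unit_exp k = (\<lambda>x. if x = k then 1 else 0)"

lemma grade_unit_exp: "a \<le> n \<Longrightarrow> b < n \<Longrightarrow> grade (unit_exp (a, b)) = b"
proof -
  assume "a \<le> n" "b < n"
  moreover have "grade (unit_exp (a, b)) = (\<Sum>k\<in>{..n} \<times> {..<n}. if k = (a, b) then b else 0)"
    unfolding grade_def unit_exp_def by (intro sum.cong) auto
  ultimately show ?thesis by simp
qed

text \<open>A dual formulation, since operators act on functions of exponents:
  \<open>app T F m\<close> depends only on the values of \<open>F\<close> at grades from
  \<open>grade m + d\<close> on.\<close>

definition grade_ge :: "(nat \<times> nat \<Rightarrow> nat, 'r) linop \<Rightarrow> nat \<Rightarrow> bool" where
  "grade_ge T d \<longleftrightarrow>
     (\<forall>F m. (\<forall>m'. grade m + d \<le> grade m' \<longrightarrow> F m' = 0) \<longrightarrow> app T F m = 0)"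

text \<open>Up to terms of higher grade, \<open>T\<close> is the shift by \<open>v\<close> times a
  nowhere vanishing function. The coefficient depends on \<open>m\<close> because of the twist in
  \<open>letter\<close>.\<close>

definition leading :: "(nat \<times> nat \<Rightarrow> nat, 'r) linop \<Rightarrow> (nat \<times> nat \<Rightarrow> nat) \<Rightarrow> bool" where
  "leading T v \<longleftrightarrow>
     (\<exists>c. \<forall>m. c m \<noteq> 0 \<and> (\<forall>F. (\<forall>m'. grade m + grade v < grade m' \<longrightarrow> F m' = 0)
        \<longrightarrow> app T F m = c m * F (\<lambda>x. m x + v x)))"

lemma leadingE:
  assumes "leading T v"
  obtains c where "\<And>m. c m \<noteq> 0"
    and "\<And>m F. (\<And>m'. grade m + grade v < grade m' \<Longrightarrow> F m' = 0) \<Longrightarrow> app T F m = c m * F (\<lambda>x. m x + v x)"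
  using assms unfolding leading_def by blast

lemma grade_geD:
  "grade_ge T d \<Longrightarrow> (\<And>m'. grade m + d \<le> grade m' \<Longrightarrow> F m' = 0) \<Longrightarrow> app T F m = 0"
  by (auto simp: grade_ge_def)

lemma grade_ge_mono: "grade_ge T d \<Longrightarrow> d' \<le> d \<Longrightarrow> grade_ge T d'"
  by (auto simp: grade_ge_def)

lemma grade_ge_zero: "grade_ge 0 d"
  by (simp add: grade_ge_def zero_linop.rep_eq)

lemma grade_ge_sum: "(\<And>i. i \<in> I \<Longrightarrow> grade_ge (T i) d) \<Longrightarrow> grade_ge (\<Sum>i\<in>I. T i) d"
  by (auto simp: grade_ge_def app_sum)

lemma grade_ge_scale: "grade_ge T d \<Longrightarrow> grade_ge (lscale c T) d"
  by (simp add: grade_ge_def lscale.rep_eq)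

lemma grade_ge_mult:
  assumes "grade_ge S d" "grade_ge T d'" shows "grade_ge (S * T) (d + d')"
  unfolding grade_ge_def times_linop.rep_eq
  by (auto intro!: grade_geD[OF assms(1)] grade_geD[OF assms(2)])

lemma leading_imp_grade_ge: "leading T v \<Longrightarrow> grade_ge T (grade v)"
  unfolding leading_def grade_ge_def by (auto simp: grade_add)

lemma leading_mult:
  assumes "leading S v" "leading T u"
  shows "leading (S * T) (\<lambda>x. v x + u x)"
proof -
  obtain c where c: "\<And>m. c m \<noteq> 0"
    "\<And>m F. (\<And>m'. grade m + grade v < grade m' \<Longrightarrow> F m' = 0) \<Longrightarrow> app S F m = c m * F (\<lambda>x. m x + v x)"
    using assms(1) by (rule leadingE) blast
  obtain d where d: "\<And>m. d m \<noteq> 0"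
    "\<And>m F. (\<And>m'. grade m + grade u < grade m' \<Longrightarrow> F m' = 0) \<Longrightarrow> app T F m = d m * F (\<lambda>x. m x + u x)"
    using assms(2) by (rule leadingE) blast
  show ?thesis
    unfolding leading_def
  proof (intro exI[of _ "\<lambda>m. c m * d (\<lambda>x. m x + v x)"] allI conjI impI)
    fix m and F :: "_ \<Rightarrow> 'r" assume F: "\<forall>m'. grade m + grade (\<lambda>x. v x + u x) < grade m' \<longrightarrow> F m' = 0"
    have "app (S * T) F m = c m * app T F (\<lambda>x. m x + v x)"
      unfolding times_linop.rep_eq
    proof (rule c(2))
      fix m' assume m': "grade m + grade v < grade m'"
      \<comment> \<open>From \<open>m'\<close> the operator \<open>T\<close> climbs by at least
        \<open>grade u\<close>, into the region where \<open>F\<close> vanishes. Hence the leading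
        formula of \<open>S\<close> applies to \<open>app T F\<close>.\<close>
      show "app T F m' = 0"
        by (rule grade_geD[OF leading_imp_grade_ge[OF assms(2)]])
          (use F m' in \<open>simp add: grade_add\<close>)
    qed
    also have "app T F (\<lambda>x. m x + v x) = d (\<lambda>x. m x + v x) * F (\<lambda>x. m x + v x + u x)"
      by (rule d(2)) (use F in \<open>simp add: grade_add\<close>)
    finally show "app (S * T) F m = c m * d (\<lambda>x. m x + v x) * F (\<lambda>x. m x + (v x + u x))"
      by (simp add: algebra_simps)
  qed (simp add: c(1) d(1))
qed

lemma leading_add:
  assumes "leading S v" "grade_ge T (Suc (grade v))"
  shows "leading (S + T) v"
proof -
  have "app T F m = 0" if "\<forall>m'. grade m + grade v < grade m' \<longrightarrow> F m' = 0" for F m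
    using that by (intro grade_geD[OF assms(2)]) auto
  with assms(1) show ?thesis by (simp add: leading_def plus_linop.rep_eq)
qed

lemma leading_scale:
  assumes "leading T v" "c \<noteq> 0" shows "leading (lscale c T) v"
proof -
  obtain d where d: "\<And>m. d m \<noteq> 0"
    "\<And>m F. (\<And>m'. grade m + grade v < grade m' \<Longrightarrow> F m' = 0) \<Longrightarrow> app T F m = d m * F (\<lambda>x. m x + v x)"
    using assms(1) by (rule leadingE) blast
  show ?thesis unfolding leading_def lscale.rep_eq
    by (rule exI[of _ "\<lambda>m. c * d m"]) (simp add: d assms(2))
qed

lemma leading_one: "leading 1 (\<lambda>x. 0)"
  unfolding leading_def by (rule exI[of _ "\<lambda>m. 1"]) (simp add: one_linop.rep_eq)

lemma leading_letter: "leading (letter k) (unit_exp k)"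
proof -
  have "(\<lambda>x. m x + unit_exp k x) = m(k := Suc (m k))" for m
    by (auto simp: unit_exp_def)
  then show ?thesis unfolding leading_def
    by (intro exI[of _ "\<lambda>m. q powi lam_sum k m"]) (simp add: letter.rep_eq q_nonzero)
qed

definition root_exp :: "nat \<Rightarrow> nat \<Rightarrow> nat \<times> nat \<Rightarrow> nat" where
  "root_exp i d = (\<lambda>x. if snd x \<le> d \<and> fst x = i + snd x then 1 else 0)"

lemma root_exp_Suc: "root_exp i (Suc d) = (\<lambda>x. root_exp i d x + unit_exp (Suc (i + d), Suc d) x)"
  by (auto simp: root_exp_def unit_exp_def fun_eq_iff)

lemma root_exp_0: "root_exp i 0 = unit_exp (i, 0)"
  by (auto simp: root_exp_def unit_exp_def fun_eq_iff)

text \<open>A strictly increasing sequence of \<open>d + 1\<close> naturals ending in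
  \<open>k\<close> needs \<open>d \<le> k\<close>; for \<open>k = d\<close> it is 0, 1, ..., d, and
  for larger \<open>k\<close> its sum is larger.\<close>

lemma chain_leading:
  assumes "1 \<le> i" "i + d \<le> n" "k < n"
  shows "(k < d \<longrightarrow> chain i d k = 0) \<and> (k = d \<longrightarrow> leading (chain i d k) (root_exp i d))
    \<and> (d < k \<longrightarrow> grade_ge (chain i d k) (Suc (grade (root_exp i d))))"
  using assms(2,3)
proof (induction d arbitrary: k)
  case 0
  have "grade_ge (letter (i, k)) k"
    using leading_imp_grade_ge[OF leading_letter, of "(i, k)"] 0 by (simp add: grade_unit_exp)
  moreover have "grade (unit_exp (i, 0)) = 0"
    using 0 by (simp add: grade_unit_exp)
  ultimately show ?case
    using leading_letter[of "(i, k)"] by (auto simp: root_exp_0 intro: grade_ge_mono)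
next
  case (Suc d)
  let ?v = "root_exp i d" and ?L = "letter (Suc (i + d), k)"
  have IH: "l < d \<Longrightarrow> chain i d l = 0" "leading (chain i d d) ?v"
    "d < l \<Longrightarrow> grade_ge (chain i d l) (Suc (grade ?v))" if "l < n" for l
    using Suc.IH[of l] Suc.IH[of d] Suc.prems assms(1) that by auto
  have grade: "grade (root_exp i (Suc d)) = grade ?v + Suc d"
    using Suc.prems assms(1) by (simp add: root_exp_Suc grade_add grade_unit_exp)
  have letter: "grade_ge ?L k"
    using leading_imp_grade_ge[OF leading_letter, of "(Suc (i + d), k)"] Suc.prems
    by (simp add: grade_unit_exp)
  consider "k < Suc d" | "k = Suc d" | "Suc d < k" by linarith
  then show ?case
  proof cases
    case 1
    then have "(\<Sum>l<k. chain i d l) = 0"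
      using Suc.prems by (intro sum.neutral) (auto intro: IH)
    with 1 show ?thesis by simp
  next
    case 2
    have "(\<Sum>l<k. chain i d l) = chain i d d"
      using 2 Suc.prems by (simp add: IH)
    \<comment> \<open>The hypothesis \<open>p_square\<close> keeps the coefficient of the leading
      monomial nonzero.\<close>
    moreover have "leading (lscale (1 - p * p) (chain i d d * ?L)) (root_exp i (Suc d))"
      unfolding root_exp_Suc using 2 Suc.prems p_square
      by (intro leading_scale leading_mult IH) (use leading_letter in auto)
    ultimately show ?thesis using 2 by simp
  next
    case 3
    \<comment> \<open>The shorter chain contributes at least its minimal grade whatever its end
      \<open>l\<close> is; the surplus comes from the last letter, as
      \<open>k > Suc d\<close>.\<close>
    have "grade_ge (chain i d l) (grade ?v)" if "l < k" for l
    proof -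
      consider "l < d" | "l = d" | "d < l" by linarith
      then show ?thesis
        using IH[of l] that Suc.prems
        by cases (auto simp: grade_ge_zero intro: leading_imp_grade_ge grade_ge_mono)
    qed
    then have "grade_ge (chain i (Suc d) k) (grade ?v + k)"
      unfolding chain.simps by (intro grade_ge_scale grade_ge_mult grade_ge_sum letter) auto
    then have "grade_ge (chain i (Suc d) k) (Suc (grade (root_exp i (Suc d))))"
      by (rule grade_ge_mono) (use 3 in \<open>simp add: grade\<close>)
    with 3 show ?thesis by simp
  qed
qed

lemma root_vector_leading:
  assumes "1 \<le> i" "i + d \<le> n"
  shows "leading (root_vector E_op i d) (root_exp i d)"
proof -
  have d: "d < n" using assms by simp
  have "root_vector E_op i d = chain i d d + (\<Sum>k\<in>{..<n} - {d}. chain i d k)"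
    unfolding root_vector_chain by (rule sum.remove) (use d in auto)
  moreover have "grade_ge (chain i d k) (Suc (grade (root_exp i d)))" if "k \<in> {..<n} - {d}" for k
    using chain_leading[OF assms, of k] that by (cases "k < d") (auto simp: grade_ge_zero)
  ultimately show ?thesis
    using chain_leading[OF assms d] by (auto intro: leading_add grade_ge_sum)
qed

section \<open>Independence of the sorted monomials\<close>

definition word_exp :: "(nat \<times> nat) list \<Rightarrow> nat \<times> nat \<Rightarrow> nat" where
  "word_exp w = (\<lambda>x. \<Sum>(i, j)\<leftarrow>w. root_exp i (j - Suc i) x)"

abbreviation e_op :: "nat \<times> nat \<Rightarrow> (nat \<times> nat \<Rightarrow> nat, 'r) linop" where
  "e_op \<equiv> \<lambda>(i, j). e_vec E_op i j"

lemma word_leading: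
  "set w \<subseteq> sl_basis n \<Longrightarrow> leading (prod_list (map e_op w)) (word_exp w)"
proof (induction w)
  case Nil
  then show ?case using leading_one by (simp add: word_exp_def)
next
  case (Cons x w)
  obtain i j where x: "x = (i, j)" by (cases x)
  have "leading (e_op x) (root_exp i (j - Suc i))"
    using Cons.prems by (auto simp: x e_vec_def sl_basis_def intro!: root_vector_leading)
  from leading_mult[OF this Cons.IH] Cons.prems show ?case
    by (simp add: word_exp_def x)
qed

text \<open>On the diagonal starting at \<open>(i, 0)\<close>, the factor \<open>(a, b)\<close> of a
  word contributes exactly if \<open>a = i\<close>, and then up to the first component
  \<open>b - 1\<close>. So the drop between the components \<open>j - 1\<close> and \<open>j\<close>
  counts the factors \<open>(i, j)\<close>.\<close>

lemma word_exp_count: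
  assumes "set w \<subseteq> sl_basis n" "i < j"
  shows "word_exp w (j - 1, j - Suc i) = word_exp w (j, j - i) + count (mset w) (i, j)"
  using assms(1)
proof (induction w)
  case (Cons x w)
  obtain a b where x: "x = (a, b)" by (cases x)
  have "root_exp a (b - Suc a) (j - 1, j - Suc i)
      = root_exp a (b - Suc a) (j, j - i) + (if x = (i, j) then 1 else 0)"
    using Cons.prems assms(2) by (auto simp: x root_exp_def sl_basis_def)
  with Cons show ?case by (simp add: word_exp_def x)
qed (simp add: word_exp_def)

lemma word_exp_inject:
  assumes "set w \<subseteq> sl_basis n" "set w' \<subseteq> sl_basis n" "word_exp w = word_exp w'"
  shows "mset w = mset w'"
proof (rule multiset_eqI)
  fix x :: "nat \<times> nat"
  obtain i j where x: "x = (i, j)" by (cases x)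
  show "count (mset w) x = count (mset w') x"
  proof (cases "i < j")
    case True
    then show ?thesis
      using word_exp_count[OF assms(1) True] word_exp_count[OF assms(2) True] assms(3)
      by (simp add: x)
  next
    case False
    then have "x \<notin> set w" "x \<notin> set w'" using assms(1,2) by (auto simp: x sl_basis_def)
    then show ?thesis by (metis count_mset_0_iff)
  qed
qed

text \<open>Evaluation at a suitable test function isolates one coefficient. The condition on
  multisets is needed because rearrangements of a word share their leading exponent.\<close>

theorem monomials_independent:
  assumes supp: "\<And>w. coef g w \<noteq> 0 \<Longrightarrow> set w \<subseteq> sl_basis n"
    and inj: "\<And>w w'. coef g w \<noteq> 0 \<Longrightarrow> coef g w' \<noteq> 0 \<Longrightarrow> mset w = mset w' \<Longrightarrow> w = w'"
    and "ev e_op g = 0"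
  shows "g = 0"
proof (rule ccontr)
  assume "g \<noteq> 0"
  let ?S = "{w. coef g w \<noteq> 0}"
  have "?S \<noteq> {}"
    using \<open>g \<noteq> 0\<close> falg_decompose[of g] by (metis sum.empty)
  then obtain w0 where w0: "w0 \<in> ?S" "\<And>w. w \<in> ?S \<Longrightarrow> grade (word_exp w0) \<le> grade (word_exp w)"
    using ex_is_arg_min_if_finite[OF finite_coef, of g "\<lambda>w. grade (word_exp w)"]
    by (auto simp: is_arg_min_linorder)
  \<comment> \<open>Since \<open>w0\<close> has least grade, \<open>F\<close> vanishes above the
    grade of every word in the support. So the leading term determines each summand, and it sees
    \<open>F\<close> only for the exponent of \<open>w0\<close>.\<close>
  define F where "F = (\<lambda>m. if m = word_exp w0 then 1 else (0 :: 'r))"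
  have P: "\<exists>c. c \<noteq> 0 \<and> app (prod_list (map e_op w)) F (\<lambda>x. 0) = c * F (word_exp w)"
    if "w \<in> ?S" for w
  proof -
    have "leading (prod_list (map e_op w)) (word_exp w)"
      using that by (intro word_leading supp) simp
    then obtain c where c: "\<And>m. c m \<noteq> 0" "\<And>m F. (\<And>m'. grade m + grade (word_exp w) < grade m' \<Longrightarrow> F m' = 0)
        \<Longrightarrow> app (prod_list (map e_op w)) F m = c m * F (\<lambda>x. m x + word_exp w x)"
      by (rule leadingE) blast
    have "app (prod_list (map e_op w)) F (\<lambda>x. 0) = c (\<lambda>x. 0) * F (\<lambda>x. 0 + word_exp w x)"
      using w0(2)[OF that] by (intro c(2)) (auto simp: F_def)
    with c(1) show ?thesis by auto
  qed
  have "0 = app (ev e_op g) F (\<lambda>x. 0)"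
    using assms(3) by (simp add: zero_linop.rep_eq)
  also have "\<dots> = (\<Sum>w\<in>?S. coef g w * app (prod_list (map e_op w)) F (\<lambda>x. 0))"
    by (simp add: ev_def app_sum lscale.rep_eq)
  also have "\<dots> = (\<Sum>w\<in>?S. if w = w0 then coef g w0 * app (prod_list (map e_op w0)) F (\<lambda>x. 0) else 0)"
  proof (rule sum.cong[OF refl])
    fix w assume w: "w \<in> ?S"
    have "w = w0" if "word_exp w = word_exp w0"
      using word_exp_inject[OF supp supp that] inj w w0(1) by blast
    then show "coef g w * app (prod_list (map e_op w)) F (\<lambda>x. 0)
        = (if w = w0 then coef g w0 * app (prod_list (map e_op w0)) F (\<lambda>x. 0) else 0)"
      using P[OF w] by (auto simp: F_def split: if_splits)
  qed
  also have "\<dots> = coef g w0 * app (prod_list (map e_op w0)) F (\<lambda>x. 0)"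
    using w0(1) by simp
  also have "\<dots> \<noteq> 0"
    using P[OF w0(1)] w0(1) by (auto simp: F_def)
  finally show False by simp
qed

end

section \<open>Sorting words in the enveloping algebra\<close>

interpretation k: coefficient_ring k_ring
  by (rule coefficient_ring.intro[OF subring_k_ring])

lemma qpar_in: "qpar \<in> k_ring" "inverse qpar \<in> k_ring"
  using qpar_powi_in[of 1] qpar_powi_in[of "- 1"] by simp_all

section \<open>The defining relations on basis tensors\<close>

lemma lin_ext2_word:
  assumes "subring R (ring_of_type_algebra :: 'r::comm_ring_1 ring)"
    and "F x y \<in> carrier (free_algebra R B)"
  shows "lin_ext2 (free_algebra R B) F (word [x, y]) = F x y"
proof -
  have S: "{w. word [x, y] w \<noteq> (0 :: 'r) \<and> length w = 2} = {[x, y]}"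
    by (auto simp: word_def split: if_splits)
  have one: "word [x, y] [x, y] \<odot>\<^bsub>free_algebra R B\<^esub> F x y = F x y"
    by (simp add: word_def free_algebra_def)
  show ?thesis
    unfolding lin_ext2_def S using assms(2)
    by (subst finsum_free_algebra[OF assms(1)]) (simp_all add: one)
qed

text \<open>This and the next three definitions record the values of the structure maps on
  \<open>x \<otimes> y\<close> as elements of \<open>falg\<close>, so that \<open>lin_ext2\<close>
  disappears from the later calculations.\<close>

definition S_term :: "nat \<Rightarrow> nat \<times> nat \<Rightarrow> nat \<times> nat \<Rightarrow> (nat \<times> nat, 'a::field_char_0 fls) falg" where
  "S_term n x y =
     (if basis_less x y then fscale (qpar powi weight n x y) (fword [y, x])
      else if x = y then fword [x, x]
      else fscale (qpar powi (- weight n y x)) (fword [y, x]))"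

definition pairing_term :: "nat \<times> nat \<Rightarrow> nat \<times> nat \<Rightarrow> (nat \<times> nat, 'a::field_char_0 fls) falg" where
  "pairing_term x y =
     (if fst x < fst y \<and> fst y < snd x \<and> snd x < snd y
        then fscale (qpar - inverse qpar) (fword [(fst x, snd y), (fst y, snd x)])
      else if fst y < fst x \<and> fst x < snd y \<and> snd y < snd x
        then fscale (inverse qpar - qpar) (fword [(fst y, snd x), (fst x, snd y)])
      else 0)"

definition commutator_term :: "nat \<times> nat \<Rightarrow> nat \<times> nat \<Rightarrow> (nat \<times> nat, 'a::field_char_0 fls) falg" where
  "commutator_term x y = (if snd x = fst y then fword [(fst x, snd y)] else 0)"

definition bracket_term :: "nat \<Rightarrow> nat \<times> nat \<Rightarrow> nat \<times> nat \<Rightarrow> (nat \<times> nat, 'a::field_char_0 fls) falg" where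
  "bracket_term n x y =
     (if basis_less x y then commutator_term x y
      else if x = y then 0
      else fscale (- (qpar powi (- weight n y x))) (commutator_term y x))"

definition relator :: "nat \<Rightarrow> nat \<times> nat \<Rightarrow> nat \<times> nat \<Rightarrow> (nat \<times> nat, 'a::field_char_0 fls) falg" where
  "relator n x y = fword [x, y] - (S_term n x y + pairing_term x y) - bracket_term n x y"

text \<open>The first clause makes one of the two matrix products in the commutator vanish; the last
  one excludes the second branch of the pairing.\<close>

lemma basis_less_fst_snd:
  assumes "basis_less x y" "x \<in> sl_basis n" "y \<in> sl_basis n"
  shows "fst x < snd y" "fst x = fst y \<Longrightarrow> snd x < snd y" "snd x = snd y \<Longrightarrow> fst x < fst y"
    "\<not> (fst y < fst x \<and> fst x < snd y \<and> snd y < snd x)"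
  using assms by (auto simp: basis_less_def sl_basis_def)

lemma of_matrix_commutator:
  assumes "basis_less x y" "x \<in> sl_basis n" "y \<in> sl_basis n"
  shows "of_matrix n (commutator n (munit x) (munit y))
    = coef (commutator_term x y :: (nat \<times> nat, 'a::field_char_0 fls) falg)"
proof -
  have prod: "(\<Sum>l = 1..n + 1. munit x r l * munit y l s)
      = (if snd x = fst y \<and> r = fst x \<and> s = snd y then 1 else 0)"
    if "x \<in> sl_basis n" for x y r s
  proof -
    have "(\<Sum>l = 1..n + 1. munit x r l * munit y l s)
        = (\<Sum>l = 1..n + 1. if l = snd x then (if snd x = fst y \<and> r = fst x \<and> s = snd y then 1 else 0) else 0)"
      by (intro sum.cong) (auto simp: munit_def prod_eq_iff)
    then show ?thesis using that by (auto simp: sl_basis_def)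
  qed
  have "commutator n (munit x) (munit y) r s
      = (if snd x = fst y \<and> r = fst x \<and> s = snd y then 1 else 0)" for r s
    unfolding commutator_def prod[OF assms(2)] prod[OF assms(3)]
    using basis_less_fst_snd(1)[OF assms] by auto
  then show ?thesis
    using assms by (intro ext)
      (auto simp: of_matrix_def commutator_term_def coef_fword zero_falg.rep_eq length_Suc_conv
        sl_basis_def prod_eq_iff)
qed

lemma basis_less_linear: "basis_less x y \<or> x = y \<or> basis_less y x"
  by (cases x; cases y) (auto simp: basis_less_def)

lemma basis_less_asym: "basis_less x y \<Longrightarrow> \<not> basis_less y x \<and> x \<noteq> y"
  by (auto simp: basis_less_def)

lemma relator_terms_over:
  assumes "x \<in> sl_basis n" "y \<in> sl_basis n"
  shows "S_term n x y \<in> falg_over k_ring (sl_basis n)"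
    and "pairing_term x y \<in> falg_over k_ring (sl_basis n)"
    and "commutator_term x y \<in> falg_over k_ring (sl_basis n)"
    and "bracket_term n x y \<in> falg_over k_ring (sl_basis n)"
proof -
  note intros = k.falg_over_scale k.falg_over_fword k.falg_over_zero qpar_powi_in k.R_diff qpar_in
    k.R_closed
  show "S_term n x y \<in> falg_over k_ring (sl_basis n)"
    using assms by (auto simp: S_term_def intro!: intros)
  show "pairing_term x y \<in> falg_over k_ring (sl_basis n)"
    using assms by (auto simp: pairing_term_def sl_basis_def intro!: intros)
  have c: "commutator_term x y \<in> falg_over k_ring (sl_basis n)"
    if "x \<in> sl_basis n" "y \<in> sl_basis n" for x y
    using that by (auto simp: commutator_term_def sl_basis_def intro!: intros)
  then show "commutator_term x y \<in> falg_over k_ring (sl_basis n)" using assms by blast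
  show "bracket_term n x y \<in> falg_over k_ring (sl_basis n)"
    unfolding bracket_term_def using assms
    by (auto intro!: intros c simp del: falg.scale_minus_left)
qed

lemma relator_over:
  "x \<in> sl_basis n \<Longrightarrow> y \<in> sl_basis n \<Longrightarrow> relator n x y \<in> falg_over k_ring (sl_basis n)"
  unfolding relator_def
  by (intro k.falg_over_diff k.falg_over_add k.falg_over_fword relator_terms_over) auto

lemma relator_eq:
  fixes x y :: "nat \<times> nat"
  assumes x: "x \<in> sl_basis n" and y: "y \<in> sl_basis n"
  shows "(word [x, y] \<ominus>\<^bsub>sl_tensor n\<^esub> sl_T n (word [x, y]) \<ominus>\<^bsub>sl_tensor n\<^esub> sl_bracket n (word [x, y])
      :: (nat \<times> nat) list \<Rightarrow> 'a::field_char_0 fls) = coef (relator n x y)"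
proof -
  note over = relator_terms_over[OF x y]
  let ?A = "sl_tensor n :: ('a fls, (nat \<times> nat) list \<Rightarrow> 'a fls) module"
  have S: "sl_S n (word [x, y]) = (coef (S_term n x y) :: _ \<Rightarrow> 'a fls)"
  proof -
    have F: "(if basis_less x y then (qpar powi weight n x y) \<odot>\<^bsub>?A\<^esub> word [y, x]
        else if x = y then word [x, x]
        else (qpar powi (- weight n y x)) \<odot>\<^bsub>?A\<^esub> word [y, x]) = coef (S_term n x y)"
      by (auto simp: S_term_def word_eq_coef free_algebra_coef)
    show ?thesis
      unfolding sl_S_def
      by (subst lin_ext2_word[OF subring_k_ring]; subst F) (simp_all add: coef_in_carrier_iff over)
  qed
  have P: "sl_pairing n (word [x, y]) = (coef (pairing_term x y) :: _ \<Rightarrow> 'a fls)"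
  proof -
    let ?F = "\<lambda>(i, j) (u, v).
      if i < u \<and> u < j \<and> j < v then (qpar - inverse qpar) \<odot>\<^bsub>?A\<^esub> word [(i, v), (u, j)]
      else if u < i \<and> i < v \<and> v < j then (inverse qpar - qpar) \<odot>\<^bsub>?A\<^esub> word [(u, j), (i, v)]
      else \<zero>\<^bsub>?A\<^esub>"
    have F: "?F x y = coef (pairing_term x y)"
      by (cases x; cases y)
        (simp only: prod.case pairing_term_def fst_conv snd_conv if_distrib[of coef] word_eq_coef
          free_algebra_coef)
    show ?thesis
      unfolding sl_pairing_def
      by (subst lin_ext2_word[OF subring_k_ring]; subst F) (simp_all add: coef_in_carrier_iff over)
  qed
  have B: "sl_bracket n (word [x, y]) = (coef (bracket_term n x y) :: _ \<Rightarrow> 'a fls)"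
  proof -
    have F: "(if basis_less x y then of_matrix n (commutator n (munit x) (munit y))
       else if x = y then \<zero>\<^bsub>?A\<^esub>
       else (- (qpar powi (- weight n y x))) \<odot>\<^bsub>?A\<^esub> of_matrix n (commutator n (munit y) (munit x)))
        = coef (bracket_term n x y)"
      using of_matrix_commutator[OF _ x y, where 'a = 'a] of_matrix_commutator[OF _ y x, where 'a = 'a]
        basis_less_linear[of x y]
      by (auto simp: bracket_term_def free_algebra_coef simp del: falg.scale_minus_left)
    show ?thesis
      unfolding sl_bracket_def
      by (subst lin_ext2_word[OF subring_k_ring]; subst F) (simp_all add: coef_in_carrier_iff over)
  qed
  have xy: "fword [x, y] \<in> falg_over k_ring (sl_basis n)"
    using x y by (intro k.falg_over_fword) auto
  show ?thesis
    unfolding sl_T_def S P B relator_def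
    unfolding word_eq_coef free_algebra_coef
    by (simp add: k.free_algebra_minus xy over k.falg_over_add k.falg_over_diff)
qed

definition sl_ideal :: "nat \<Rightarrow> ((nat \<times> nat) list \<Rightarrow> 'a::field_char_0 fls) set" where
  "sl_ideal n = Idl\<^bsub>sl_tensor n\<^esub> ((\<lambda>(x, y). coef (relator n x y)) ` (sl_basis n \<times> sl_basis n))"

lemma U_sl_eq: "U_sl n = quot_algebra (sl_tensor n) (sl_ideal n)"
proof -
  have "{word [x, y] \<ominus>\<^bsub>sl_tensor n\<^esub> sl_T n (word [x, y]) \<ominus>\<^bsub>sl_tensor n\<^esub> sl_bracket n (word [x, y])
       | x y. x \<in> sl_basis n \<and> y \<in> sl_basis n}
      = {coef (relator n x y) :: _ \<Rightarrow> 'a fls | x y. x \<in> sl_basis n \<and> y \<in> sl_basis n}"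
    by (intro Collect_cong) (metis (no_types, opaque_lifting) relator_eq)
  also have "\<dots> = (\<lambda>(x, y). coef (relator n x y)) ` (sl_basis n \<times> sl_basis n)"
    by auto
  finally show ?thesis by (simp only: U_sl_def sl_ideal_def)
qed

lemma relators_in_carrier:
  "(\<lambda>(x, y). coef (relator n x y)) ` (sl_basis n \<times> sl_basis n) \<subseteq> carrier (sl_tensor n)"
  by (auto simp: coef_in_carrier_iff relator_over)

lemma ideal_sl_ideal: "ideal (sl_ideal n) (sl_tensor n)"
  unfolding sl_ideal_def
  by (intro ring.genideal_ideal ring_free_algebra subring_k_ring relators_in_carrier)

lemma relator_in_sl_ideal:
  assumes "x \<in> sl_basis n" "y \<in> sl_basis n"
  shows "coef (relator n x y) \<in> sl_ideal n"
  using ring.genideal_self[OF ring_free_algebra[OF subring_k_ring] relators_in_carrier] assms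
  unfolding sl_ideal_def by blast

lemmas sl_ideal_closed = k.ideal_coef[OF ideal_sl_ideal]

text \<open>The numbering \<open>prod_encode\<close> has nothing to do with
  \<open>basis_less\<close>; it serves as a key for sorting. Any order would do, as exchanges of
  letters are reversible by units of \<open>k\<close>.\<close>

definition normal_words :: "(nat \<times> nat) list set" where
  "normal_words = {w. sorted (map prod_encode w)}"

lemma normal_words_inject:
  assumes "w \<in> normal_words" "w' \<in> normal_words" "mset w = mset w'"
  shows "w = w'"
proof -
  have "mset (map prod_encode w) = mset (map prod_encode w')"
    using assms(3) by simp
  then have "map prod_encode w = map prod_encode w'"
    using assms(1,2) by (metis mem_Collect_eq normal_words_def properties_for_sort)
  then show ?thesis
    by (simp add: inj_map_eq_map[OF inj_prod_encode])
qed

text \<open>Insertion sort, read backwards as a sequence of adjacent exchanges. They are only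
  requested for rearrangements of \<open>w\<close>, because the induction below controls only
  these.\<close>

lemma sort_by_swaps:
  assumes "P (sort_key f w)"
    and swap: "\<And>u v x y. mset (u @ x # y # v) = mset w \<Longrightarrow> P (u @ y # x # v) \<Longrightarrow> P (u @ x # y # v)"
  shows "P w"
proof -
  have insert: "P (u @ x # v)" if "mset (u @ x # v) = mset w" "P (u @ insort_key f x v)" for u x v
    using that
  proof (induction v arbitrary: u)
    case (Cons y v)
    show ?case
    proof (cases "f x \<le> f y")
      case False
      then have "P ((u @ [y]) @ insort_key f x v)" using Cons.prems by simp
      then have "P ((u @ [y]) @ x # v)"
        using Cons.prems(1) by (intro Cons.IH) (simp_all add: add_mset_commute)
      then show ?thesis using swap[of u x y v] Cons.prems(1) by simp
    qed (use Cons in simp)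
  qed simp
  have "P (u @ v)" if "mset (u @ v) = mset w" "P (u @ sort_key f v)" for u v
    using that
  proof (induction v arbitrary: u)
    case (Cons x v)
    have "P ((u @ [x]) @ sort_key f v)"
      using insert[of u x "sort_key f v"] Cons.prems by simp
    then have "P ((u @ [x]) @ v)"
      using Cons.prems(1) by (intro Cons.IH) simp_all
    then show ?case by simp
  qed simp
  from this[of "[]" w] show ?thesis using assms(1) by simp
qed

definition normalizable :: "nat \<Rightarrow> (nat \<times> nat, 'a::field_char_0 fls) falg \<Rightarrow> bool" where
  "normalizable n f \<longleftrightarrow>
     (\<exists>g \<in> falg_over k_ring (sl_basis n). (\<forall>w. coef g w \<noteq> 0 \<longrightarrow> w \<in> normal_words)
        \<and> coef (f - g) \<in> sl_ideal n)"

lemma normalizable_add: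
  assumes "normalizable n f" "normalizable n g" shows "normalizable n (f + g)"
proof -
  obtain f' where f: "f' \<in> falg_over k_ring (sl_basis n)" "\<forall>w. coef f' w \<noteq> 0 \<longrightarrow> w \<in> normal_words"
    "coef (f - f') \<in> sl_ideal n" using assms(1) unfolding normalizable_def by blast
  obtain g' where g: "g' \<in> falg_over k_ring (sl_basis n)" "\<forall>w. coef g' w \<noteq> 0 \<longrightarrow> w \<in> normal_words"
    "coef (g - g') \<in> sl_ideal n" using assms(2) unfolding normalizable_def by blast
  have "coef ((f - f') + (g - g')) \<in> sl_ideal n"
    using f(3) g(3) by (rule sl_ideal_closed)
  then have "coef ((f + g) - (f' + g')) \<in> sl_ideal n"
    by (simp add: algebra_simps)
  moreover have "\<forall>w. coef (f' + g') w \<noteq> 0 \<longrightarrow> w \<in> normal_words"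
    using f(2) g(2) by (simp add: plus_falg.rep_eq) (metis add.right_neutral)
  ultimately show ?thesis
    unfolding normalizable_def using f(1) g(1) k.falg_over_add by blast
qed

lemma normalizable_scale:
  assumes "c \<in> k_ring" "normalizable n f" shows "normalizable n (fscale c f)"
proof -
  obtain f' where f: "f' \<in> falg_over k_ring (sl_basis n)" "\<forall>w. coef f' w \<noteq> 0 \<longrightarrow> w \<in> normal_words"
    "coef (f - f') \<in> sl_ideal n" using assms(2) unfolding normalizable_def by blast
  have "coef (fscale c (f - f')) \<in> sl_ideal n"
    using assms(1) f(3) by (rule sl_ideal_closed)
  then show ?thesis
    unfolding normalizable_def using f assms(1)
    by (intro bexI[of _ "fscale c f'"] conjI k.falg_over_scale)
      (auto simp: fscale.rep_eq falg.scale_diff_right)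
qed

lemma normalizable_ideal: "coef f \<in> sl_ideal n \<Longrightarrow> normalizable n f"
  unfolding normalizable_def
  by (rule bexI[of _ 0]) (auto simp: zero_falg.rep_eq k.falg_over_zero)

section \<open>The measure that controls the correction terms\<close>

definition weight_sum :: "(nat \<times> nat) list \<Rightarrow> nat" where
  "weight_sum w = (\<Sum>(i, j)\<leftarrow>w. j - i)"

definition square_sum :: "(nat \<times> nat) list \<Rightarrow> nat" where
  "square_sum w = (\<Sum>(i, j)\<leftarrow>w. (j - i)\<^sup>2)"

lemma sum_simps:
  "weight_sum ((i, j) # w) = (j - i) + weight_sum w"
  "weight_sum (u @ w) = weight_sum u + weight_sum w"
  "square_sum ((i, j) # w) = (j - i)\<^sup>2 + square_sum w"
  "square_sum (u @ w) = square_sum u + square_sum w"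
  by (simp_all add: weight_sum_def square_sum_def)

text \<open>Ensures that the measure \<open>(weight_sum w)\<^sup>2 - square_sum w\<close> is not
  truncated, so it decreases strictly when the square sum grows.\<close>

lemma square_sum_le: "square_sum w \<le> (weight_sum w)\<^sup>2"
proof (induction w)
  case (Cons x w)
  then show ?case
    by (cases x) (simp add: square_sum_def weight_sum_def power2_sum)
qed (simp add: square_sum_def weight_sum_def)

lemma
  assumes "mset w = mset w'"
  shows weight_sum_cong: "weight_sum w = weight_sum w'"
    and square_sum_cong: "square_sum w = square_sum w'"
proof -
  have "sum_list (map f w) = sum_list (map f w')" for f :: "nat \<times> nat \<Rightarrow> nat"
    using assms mset_map[of f w] mset_map[of f w'] by (simp flip: sum_mset_sum_list)
  then show "weight_sum w = weight_sum w'" "square_sum w = square_sum w'"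
    by (simp_all add: weight_sum_def square_sum_def)
qed

lemma square_sum_adjacent:
  fixes a b v :: nat assumes "a < b" "b < v"
  shows "(b - a)\<^sup>2 + (v - b)\<^sup>2 < (v - a)\<^sup>2" "(b - a) + (v - b) = v - a"
proof -
  obtain x y where "b = a + x" "v = b + y" "x > 0" "y > 0"
    using assms by (metis less_imp_add_positive)
  then show "(b - a)\<^sup>2 + (v - b)\<^sup>2 < (v - a)\<^sup>2" "(b - a) + (v - b) = v - a"
    by (simp_all add: power2_eq_square algebra_simps)
qed

text \<open>With the gaps \<open>x\<close>, \<open>y\<close>, \<open>z\<close> between the four
  endpoints, the two square sums differ by \<open>2 * x * z\<close>.\<close>

lemma square_sum_interlaced:
  fixes a b u v :: nat assumes "a < u" "u < b" "b < v"
  shows "(b - a)\<^sup>2 + (v - u)\<^sup>2 < (v - a)\<^sup>2 + (b - u)\<^sup>2" "(b - a) + (v - u) = (v - a) + (b - u)"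
proof -
  obtain x y z where "u = a + x" "b = u + y" "v = b + z" "x > 0" "y > 0" "z > 0"
    using assms by (metis less_imp_add_positive)
  then show "(b - a)\<^sup>2 + (v - u)\<^sup>2 < (v - a)\<^sup>2 + (b - u)\<^sup>2" "(b - a) + (v - u) = (v - a) + (b - u)"
    by (simp_all add: power2_eq_square algebra_simps)
qed

text \<open>Every correction term of a relation keeps the sum of the lengths \<open>j - i\<close> and strictly
  increases the sum of their squares, so words can be sorted modulo already treated words.\<close>

lemma normalizable_fword:
  "set w \<subseteq> sl_basis n \<Longrightarrow> normalizable n (fword w :: (nat \<times> nat, 'a::field_char_0 fls) falg)"
proof (induction w rule: measure_induct_rule[of "\<lambda>w. (weight_sum w)\<^sup>2 - square_sum w"])
  case (less w)
  let ?N = "\<lambda>w. normalizable n (fword w :: (nat \<times> nat, 'a fls) falg)"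
  have higher: "?N w'"
    if "weight_sum w' = weight_sum w" "square_sum w < square_sum w'" "set w' \<subseteq> sl_basis n" for w'
    using that square_sum_le[of w'] by (intro less.IH) auto
  \<comment> \<open>An equivalence, since the exchange coefficient is a unit of \<open>k\<close>:
    sorting may need the exchange in either direction relative to \<open>basis_less\<close>.\<close>
  have swap: "?N (u @ x # y # v) \<longleftrightarrow> ?N (u @ y # x # v)"
    if m: "mset (u @ x # y # v) = mset w" and xy: "basis_less x y" for u v x y
  proof -
    have set: "set u \<subseteq> sl_basis n" "set v \<subseteq> sl_basis n" "x \<in> sl_basis n" "y \<in> sl_basis n"
      using arg_cong[OF m, of set_mset] less.prems by auto
    obtain a b c d where x: "x = (a, b)" and y: "y = (c, d)" by (cases x; cases y)
    note sums = weight_sum_cong[OF m] square_sum_cong[OF m]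
    let ?r = "relator n x y :: (nat \<times> nat, 'a fls) falg"
      and ?p = "pairing_term x y :: (nat \<times> nat, 'a fls) falg"
      and ?b = "commutator_term x y :: (nat \<times> nat, 'a fls) falg"
    let ?c = "qpar powi weight n x y :: 'a fls"
    have "normalizable n (fword u * ?p * fword v)"
    proof (cases "a < c \<and> c < b \<and> b < d")
      case True
      then have "?N (u @ (a, d) # (c, b) # v)"
      proof (intro higher)
        have "a < c" "c < b" "b < d" using True by auto
        note i = square_sum_interlaced[OF this]
        show "weight_sum (u @ (a, d) # (c, b) # v) = weight_sum w"
          using sums(1) i(2) True unfolding x y sum_simps by linarith
        show "square_sum w < square_sum (u @ (a, d) # (c, b) # v)"
          using sums(2) i(1) True unfolding x y sum_simps by linarith
      qed (use set True in \<open>auto simp: x y sl_basis_def\<close>)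
      then have "normalizable n (fscale (qpar - inverse qpar) (fword (u @ (a, d) # (c, b) # v))
          :: (nat \<times> nat, 'a fls) falg)"
        by (intro normalizable_scale k.R_diff qpar_in)
      moreover have "fword u * ?p * fword v
          = fscale (qpar - inverse qpar) (fword (u @ [(a, d), (c, b)] @ v))"
        using True by (simp add: pairing_term_def x y fword_append falg.mult_scale_left
            falg.mult_scale_right mult.assoc del: append_Cons append_Nil)
      ultimately show ?thesis by simp
    next
      case False
      then have "?p = 0"
        using basis_less_fst_snd(4)[OF xy set(3,4)] by (auto simp: pairing_term_def x y)
      then show ?thesis
        by (simp add: normalizable_ideal sl_ideal_closed(1))
    qed
    moreover have "normalizable n (fword u * ?b * fword v)"
    proof (cases "b = c")
      case True
      then have "?N (u @ (a, d) # v)"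
      proof (intro higher)
        have "a < b" "b < d" using set True by (auto simp: x y sl_basis_def)
        note i = square_sum_adjacent[OF this]
        show "weight_sum (u @ (a, d) # v) = weight_sum w"
          using sums(1) i(2) unfolding x y sum_simps True[symmetric] by linarith
        show "square_sum w < square_sum (u @ (a, d) # v)"
          using sums(2) i(1) unfolding x y sum_simps True[symmetric] by linarith
      qed (use set True in \<open>auto simp: x y sl_basis_def\<close>)
      moreover have "fword u * ?b * fword v = fword (u @ [(a, d)] @ v)"
        using True by (simp add: commutator_term_def x y fword_append mult.assoc
            del: append_Cons append_Nil)
      ultimately show ?thesis by simp
    next
      case False
      then show ?thesis
        by (simp add: commutator_term_def x y normalizable_ideal sl_ideal_closed(1))
    qed
    moreover have "normalizable n (fword u * ?r * fword v)"
      using set by (intro normalizable_ideal sl_ideal_closed(4,5) relator_in_sl_ideal k.falg_over_fword)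
    ultimately have N: "normalizable n (fword u * (?r + ?p + ?b) * fword v)"
      by (simp add: distrib_left distrib_right normalizable_add)
    \<comment> \<open>Adding pairing and bracket back to the relator leaves the pure
      \<open>q\<close>-exchange.\<close>
    have "?r + ?p + ?b = fword [x, y] - fscale ?c (fword [y, x])"
      using xy by (simp add: relator_def S_term_def bracket_term_def)
    moreover have "fword (u @ a # b # v) = (fword u * (fword [a, b] * fword v) :: (nat \<times> nat, 'a fls) falg)"
      for a b
      by (simp flip: fword_append)
    ultimately have eq: "fword u * (?r + ?p + ?b) * fword v
        = fword (u @ x # y # v) - fscale ?c (fword (u @ y # x # v))"
      by (simp add: left_diff_distrib right_diff_distrib falg.mult_scale_left
          falg.mult_scale_right mult.assoc)
    define h where "h = fword u * (?r + ?p + ?b) * fword v"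
    have h: "normalizable n h" "h = fword (u @ x # y # v) - fscale ?c (fword (u @ y # x # v))"
      using N eq by (simp_all add: h_def)
    show ?thesis
    proof
      assume "?N (u @ x # y # v)"
      \<comment> \<open>Solving for the other word divides by a power of \<open>qpar\<close>, which
        stays inside \<open>k\<close>.\<close>
      then have "normalizable n (fscale (inverse ?c) (fword (u @ x # y # v) + fscale (- 1) h))"
        using h(1) by (intro normalizable_scale normalizable_add)
          (auto simp: power_int_minus[symmetric] intro: qpar_powi_in k.R_closed)
      then show "?N (u @ y # x # v)"
        by (simp add: h(2) falg.scale_scale)
    next
      assume "?N (u @ y # x # v)"
      then have "normalizable n (h + fscale ?c (fword (u @ y # x # v)))"
        using h(1) by (intro normalizable_scale normalizable_add qpar_powi_in)
      then show "?N (u @ x # y # v)" by (simp add: h(2))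
    qed
  qed
  show "?N w"
  proof (rule sort_by_swaps[where f = prod_encode])
    have "sort_key prod_encode w \<in> normal_words"
      by (simp add: normal_words_def)
    then show "?N (sort_key prod_encode w)"
      unfolding normalizable_def using less.prems
      by (intro bexI[of _ "fword (sort_key prod_encode w)"] k.falg_over_fword)
        (auto simp: coef_fword sl_ideal_closed(1))
  next
    fix u v x y
    assume m: "mset (u @ x # y # v) = mset w" and "?N (u @ y # x # v)"
    then show "?N (u @ x # y # v)"
      using swap[of u x y v] swap[of u y x v] basis_less_linear[of x y]
      by (auto simp: add_mset_commute)
  qed
qed

lemma normalizable_all:
  assumes "f \<in> falg_over k_ring (sl_basis n)" shows "normalizable n f"
  using assms
proof (induction f rule: k.falg_over_induct)
  case zero
  then show ?case by (intro normalizable_ideal sl_ideal_closed)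
qed (auto intro: normalizable_add normalizable_scale normalizable_fword)

section \<open>The Serre ideal\<close>

lemma inverse_in_Kq:
  assumes "a \<in> Kq" "a \<noteq> (0 :: 'a::field_char_0 fls)" shows "inverse a \<in> Kq"
proof -
  interpret ring "ring_of_type_algebra :: 'a fls ring" by (rule ring_from_type_algebra)
  obtain b where "b \<in> Kq" "a * b = 1"
    using subfield_m_inv[OF subfield_Kq, of a] assms by (auto simp: ring_of_type_algebra_def)
  then show ?thesis using assms(2) by (metis inverse_unique)
qed

lemma qpar_in_Kq: "qpar \<in> Kq" "inverse qpar \<in> Kq"
proof -
  show q: "qpar \<in> Kq" unfolding Kq_def by (rule generate_field.incl) simp
  show "inverse qpar \<in> Kq" by (intro inverse_in_Kq q) simp
qed

interpretation K: coefficient_ring Kq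
  by (intro coefficient_ring.intro subfieldE(1) subfield_Kq)

lemma k_ring_subset_Kq: "k_ring \<subseteq> (Kq :: 'a::field_char_0 fls set)"
proof -
  interpret ring "ring_of_type_algebra :: 'a fls ring" by (rule ring_from_type_algebra)
  have "range fls_const \<union> {qpar, inverse qpar} \<subseteq> (Kq :: 'a fls set)"
    using qpar_in_Kq by (auto simp: Kq_def intro: generate_field.incl)
  then show ?thesis
    unfolding k_ring_def by (rule generate_ring_min_subring1[OF _ K.subring_R, rotated])
      (simp add: ring_of_type_algebra_def)
qed

lemma qpar_square: "qpar * qpar = (fps_to_fls (fps_exp 2) :: 'a::field_char_0 fls)"
proof -
  have "fps_exp 1 * fps_exp 1 = (fps_exp 2 :: 'a fps)"
    by (simp flip: fps_exp_add_mult)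
  then show ?thesis
    by (simp add: qpar_def flip: fls_times_fps_to_fls)
qed

text \<open>The series exp(2t) has the coefficients 1 and 2 at t^0 and t^1. The first excludes -1,
  the second excludes 1 in characteristic zero.\<close>

lemma qpar_square_neq: "qpar * qpar \<noteq> (1 :: 'a::field_char_0 fls)" "qpar * qpar \<noteq> (- 1 :: 'a fls)"
proof -
  have "fls_nth (qpar * qpar) 1 = (2 :: 'a)" "fls_nth (qpar * qpar) 0 = (1 :: 'a)"
    by (simp_all add: qpar_square)
  then show "qpar * qpar \<noteq> (1 :: 'a fls)" "qpar * qpar \<noteq> (- 1 :: 'a fls)"
    by (auto dest: arg_cong[where f = "\<lambda>f. fls_nth f 1"] arg_cong[where f = "\<lambda>f. fls_nth f 0"])
qed

lemma qpar_plus_inverse: "qpar + inverse qpar \<noteq> (0 :: 'a::field_char_0 fls)"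
proof
  assume "qpar + inverse qpar = (0 :: 'a fls)"
  then have "qpar * qpar + qpar * inverse qpar = (0 :: 'a fls)"
    by (metis distrib_left mult_zero_right)
  then show False
    using qpar_square_neq(2)[where 'a = 'a] by (simp add: eq_neg_iff_add_eq_0)
qed

lemma feigin_qpar: "feigin (qpar :: 'a::field_char_0 fls) (inverse qpar)"
proof
  show "inverse qpar * inverse qpar \<noteq> (1 :: 'a fls)"
    using qpar_square_neq(1)[where 'a = 'a] by (metis inverse_mult_distrib inverse_eq_1_iff)
qed simp_all

interpretation fq: q_algebra "fscale :: 'a::field_char_0 fls \<Rightarrow> (nat, 'a fls) falg \<Rightarrow> _" qpar "inverse qpar"
  by (intro q_algebra.intro falg.algebra_over_axioms q_algebra_axioms.intro) simp

abbreviation (input) serre_relator ::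
    "nat \<Rightarrow> nat \<Rightarrow> (nat, 'a::field_char_0 fls) falg" where
  "serre_relator i j \<equiv> fword [i] * fword [i] * fword [j]
     - fscale (qpar + inverse qpar) (fword [i] * fword [j] * fword [i])
     + fword [j] * fword [i] * fword [i]"

definition serre_relators :: "nat \<Rightarrow> (nat, 'a::field_char_0 fls) falg set" where
  "serre_relators n =
     {fword [i] * fword [j] - fword [j] * fword [i]
       | i j. i \<in> {1..n} \<and> j \<in> {1..n} \<and> \<bar>int i - int j\<bar> > 1} \<union>
     {serre_relator i j | i j. i \<in> {1..n} \<and> j \<in> {1..n} \<and> \<bar>int i - int j\<bar> = 1}"

lemma letter_over: "i \<in> {1..n} \<Longrightarrow> fword [i] \<in> falg_over Kq {1..n}"
  by (intro K.falg_over_fword) simp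

lemmas Kq_intros = K.falg_over_diff K.falg_over_add K.falg_over_mult K.falg_over_scale
  K.falg_over_zero qpar_in_Kq K.R_closed

lemma serre_relators_over: "serre_relators n \<subseteq> falg_over Kq {1..n}"
  unfolding serre_relators_def by (auto simp del: One_nat_def intro!: Kq_intros letter_over)

lemma qserre_eq: "qserre n = coef ` serre_relators n"
proof -
  let ?A = "free_algebra Kq {1..n} :: ('a fls, nat list \<Rightarrow> 'a fls) module"
  have far: "word [i] \<otimes>\<^bsub>?A\<^esub> word [j] \<ominus>\<^bsub>?A\<^esub> word [j] \<otimes>\<^bsub>?A\<^esub> word [i]
      = coef (fword [i] * fword [j] - fword [j] * fword [i])"
    if "i \<in> {1..n}" "j \<in> {1..n}" for i j
    using that unfolding word_eq_coef free_algebra_coef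
    by (intro K.free_algebra_minus Kq_intros letter_over)
  have near: "word [i] \<otimes>\<^bsub>?A\<^esub> word [i] \<otimes>\<^bsub>?A\<^esub> word [j]
          \<ominus>\<^bsub>?A\<^esub> (qpar + inverse qpar) \<odot>\<^bsub>?A\<^esub> (word [i] \<otimes>\<^bsub>?A\<^esub> word [j] \<otimes>\<^bsub>?A\<^esub> word [i])
          \<oplus>\<^bsub>?A\<^esub> word [j] \<otimes>\<^bsub>?A\<^esub> word [i] \<otimes>\<^bsub>?A\<^esub> word [i]
      = coef (serre_relator i j)" if "i \<in> {1..n}" "j \<in> {1..n}" for i j
  proof -
    have "(fword [i] * fword [i] * fword [j] :: (nat, 'a fls) falg) \<in> falg_over Kq {1..n}"
      "(fscale (qpar + inverse qpar) (fword [i] * fword [j] * fword [i]) :: (nat, 'a fls) falg)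
        \<in> falg_over Kq {1..n}"
      using that by (auto simp del: One_nat_def intro!: Kq_intros letter_over)
    then show ?thesis
      unfolding word_eq_coef free_algebra_coef by (simp add: K.free_algebra_minus free_algebra_coef)
  qed
  have "(qserre n :: (nat list \<Rightarrow> 'a fls) set) = {coef (fword [i] * fword [j] - fword [j] * fword [i])
        | i j. i \<in> {1..n} \<and> j \<in> {1..n} \<and> \<bar>int i - int j\<bar> > 1}
      \<union> {coef (serre_relator i j) | i j. i \<in> {1..n} \<and> j \<in> {1..n} \<and> \<bar>int i - int j\<bar> = 1}"
    unfolding qserre_def Let_def
  proof (intro arg_cong2[where f = "(\<union>)"] Collect_cong iff_exI)
    fix f i j
    show "(f = word [i] \<otimes>\<^bsub>?A\<^esub> word [j] \<ominus>\<^bsub>?A\<^esub> word [j] \<otimes>\<^bsub>?A\<^esub> word [i]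
        \<and> i \<in> {1..n} \<and> j \<in> {1..n} \<and> \<bar>int i - int j\<bar> > 1)
      = (f = coef (fword [i] * fword [j] - fword [j] * fword [i])
        \<and> i \<in> {1..n} \<and> j \<in> {1..n} \<and> \<bar>int i - int j\<bar> > 1)"
      using far[of i j] by metis
    show "(f = word [i] \<otimes>\<^bsub>?A\<^esub> word [i] \<otimes>\<^bsub>?A\<^esub> word [j]
          \<ominus>\<^bsub>?A\<^esub> (qpar + inverse qpar) \<odot>\<^bsub>?A\<^esub> (word [i] \<otimes>\<^bsub>?A\<^esub> word [j] \<otimes>\<^bsub>?A\<^esub> word [i])
          \<oplus>\<^bsub>?A\<^esub> word [j] \<otimes>\<^bsub>?A\<^esub> word [i] \<otimes>\<^bsub>?A\<^esub> word [i]
        \<and> i \<in> {1..n} \<and> j \<in> {1..n} \<and> \<bar>int i - int j\<bar> = 1)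
      = (f = coef (serre_relator i j) \<and> i \<in> {1..n} \<and> j \<in> {1..n} \<and> \<bar>int i - int j\<bar> = 1)"
      using near[of i j] by metis
  qed
  then show ?thesis
    unfolding serre_relators_def image_Un
    by (elim trans) (intro arg_cong2[where f = "(\<union>)"]; blast)
qed

definition serre_ideal :: "nat \<Rightarrow> (nat list \<Rightarrow> 'a::field_char_0 fls) set" where
  "serre_ideal n = Idl\<^bsub>free_algebra Kq {1..n}\<^esub> (coef ` serre_relators n)"

lemma serre_relators_in_carrier: "coef ` serre_relators n \<subseteq> carrier (free_algebra Kq {1..n})"
  by (auto simp: coef_in_carrier_iff simp del: One_nat_def intro: subsetD[OF serre_relators_over])

lemma ideal_serre_ideal: "ideal (serre_ideal n) (free_algebra Kq {1..n})"
  unfolding serre_ideal_def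
  by (intro ring.genideal_ideal ring_free_algebra K.subring_R serre_relators_in_carrier)

lemma serre_relator_in_ideal: "f \<in> serre_relators n \<Longrightarrow> coef f \<in> serre_ideal n"
  using ring.genideal_self[OF ring_free_algebra[OF K.subring_R] serre_relators_in_carrier, of n]
  unfolding serre_ideal_def by blast

lemmas serre_ideal_closed = K.ideal_coef[OF ideal_serre_ideal]

text \<open>Zero outside the alphabet, so that the Serre relations hold for all natural indices and
  the locale \<open>quantum_serre\<close> carries no bounds.\<close>

definition gen :: "nat \<Rightarrow> nat \<Rightarrow> (nat, 'a::field_char_0 fls) falg" where
  "gen n i = (if i \<in> {1..n} then fword [i] else 0)"

lemma quantum_serre_gen:
  "quantum_serre (fscale :: 'a::field_char_0 fls \<Rightarrow> (nat, 'a fls) falg \<Rightarrow> _)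
    qpar (inverse qpar) Kq (falg_over Kq {1..n}) {f. coef f \<in> serre_ideal n} (gen n)
    (inverse (qpar + inverse qpar))"
proof
  note mem = mem_Collect_eq
  let ?J = "{f. coef f \<in> serre_ideal n} :: (nat, 'a fls) falg set"
  show "qpar \<in> Kq" "inverse qpar \<in> Kq" "1 \<in> Kq" by (auto intro: Kq_intros)
  show "inverse (qpar + inverse qpar) \<in> Kq"
    by (intro inverse_in_Kq Kq_intros qpar_plus_inverse)
  show "inverse (qpar + inverse qpar) * (qpar + inverse qpar) = (1 :: 'a fls)"
    by (rule left_inverse[OF qpar_plus_inverse])
  show "gen n i \<in> falg_over Kq {1..n}" for i
    by (auto simp: gen_def simp del: One_nat_def intro: letter_over Kq_intros)
  show "a * b \<in> Kq" if "a \<in> Kq" "b \<in> Kq" for a b :: "'a fls"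
    using that by (rule K.R_closed)
  fix f g :: "(nat, 'a fls) falg" and a :: "'a fls"
  show "f \<in> falg_over Kq {1..n} \<Longrightarrow> g \<in> falg_over Kq {1..n} \<Longrightarrow> f - g \<in> falg_over Kq {1..n}"
    "f \<in> falg_over Kq {1..n} \<Longrightarrow> g \<in> falg_over Kq {1..n} \<Longrightarrow> f * g \<in> falg_over Kq {1..n}"
    "a \<in> Kq \<Longrightarrow> f \<in> falg_over Kq {1..n} \<Longrightarrow> fscale a f \<in> falg_over Kq {1..n}"
    by (intro Kq_intros; assumption)+
  show "0 \<in> ?J" "f \<in> ?J \<Longrightarrow> g \<in> ?J \<Longrightarrow> f - g \<in> ?J"
    "f \<in> falg_over Kq {1..n} \<Longrightarrow> g \<in> ?J \<Longrightarrow> f * g \<in> ?J"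
    "f \<in> ?J \<Longrightarrow> g \<in> falg_over Kq {1..n} \<Longrightarrow> f * g \<in> ?J"
    "a \<in> Kq \<Longrightarrow> f \<in> ?J \<Longrightarrow> fscale a f \<in> ?J"
    unfolding mem by (fact serre_ideal_closed)+
next
  fix i j :: nat assume ij: "Suc i < j"
  show "gen n i * gen n j - gen n j * gen n i \<in> {f :: (nat, 'a fls) falg. coef f \<in> serre_ideal n}"
  proof (cases "i \<in> {1..n} \<and> j \<in> {1..n}")
    case True
    with ij have "(fword [i] * fword [j] - fword [j] * fword [i] :: (nat, 'a fls) falg) \<in> serre_relators n"
      unfolding serre_relators_def by (intro UnI1 CollectI exI[of _ i] exI[of _ j]) auto
    with True show ?thesis by (simp add: gen_def serre_relator_in_ideal)
  qed (auto simp: gen_def serre_ideal_closed(1))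
next
  fix i :: nat
  \<comment> \<open>Each monomial contains both generators, so an index out of range makes the whole
    expression zero.\<close>
  have *: "coef (gen n a * gen n a * gen n b
      - fscale (qpar + inverse qpar) (gen n a * gen n b * gen n a) + gen n b * gen n a * gen n a :: (nat, 'a fls) falg)
      \<in> serre_ideal n" if "\<bar>int a - int b\<bar> = 1" for a b
  proof (cases "a \<in> {1..n} \<and> b \<in> {1..n}")
    case True
    with that have "(serre_relator a b :: (nat, 'a fls) falg) \<in> serre_relators n"
      unfolding serre_relators_def by (intro UnI2 CollectI exI[of _ a] exI[of _ b]) auto
    with True show ?thesis by (simp add: gen_def serre_relator_in_ideal)
  qed (auto simp: gen_def serre_ideal_closed(1))
  show "gen n i * gen n i * gen n (Suc i)
      - fscale (qpar + inverse qpar) (gen n i * gen n (Suc i) * gen n i)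
      + gen n (Suc i) * gen n i * gen n i \<in> {f :: (nat, 'a fls) falg. coef f \<in> serre_ideal n}"
    using *[of i "Suc i"] by simp
  show "gen n (Suc i) * gen n (Suc i) * gen n i
      - fscale (qpar + inverse qpar) (gen n (Suc i) * gen n i * gen n (Suc i))
      + gen n i * gen n (Suc i) * gen n (Suc i) \<in> {f :: (nat, 'a fls) falg. coef f \<in> serre_ideal n}"
    using *[of "Suc i" i] by simp
qed

section \<open>Root vectors satisfy the defining relations\<close>

definition Phi :: "nat \<Rightarrow> (nat \<times> nat, 'a::field_char_0 fls) falg \<Rightarrow> (nat, 'a fls) falg" where
  "Phi n = falg.ev (\<lambda>(i, j). fq.e_vec (gen n) i j)"

lemma Phi_simps:
  "Phi n 0 = 0" "Phi n (f + g) = Phi n f + Phi n g" "Phi n (f - g) = Phi n f - Phi n g"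
  "Phi n (- f) = - Phi n f" "Phi n (f * g) = Phi n f * Phi n g" "Phi n (fscale c f) = fscale c (Phi n f)"
  "Phi n 1 = 1"
  "Phi n (fword w) = prod_list (map (\<lambda>(i, j). fq.e_vec (gen n) i j) w)"
  by (simp_all add: Phi_def falg.ev_zero falg.ev_add falg.ev_diff falg.ev_minus falg.ev_mult
      falg.ev_scale falg.ev_one falg.ev_fword)

text \<open>The dummy parameter fixes the type variable \<open>'a\<close>, so that the
  interpretations and the later definitions refer to one field.\<close>

context
  fixes n :: nat and field_type :: "'a::field_char_0 itself"
begin

interpretation qs: quantum_serre "fscale :: 'a fls \<Rightarrow> (nat, 'a fls) falg \<Rightarrow> _"
    qpar "inverse qpar" Kq "falg_over Kq {1..n}" "{f. coef f \<in> serre_ideal n}" "gen n"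
    "inverse (qpar + inverse qpar)"
  by (rule quantum_serre_gen)

interpretation fg: feigin "qpar :: 'a fls" "inverse qpar" n
  by (rule feigin_qpar)

lemma Phi_over:
  "f \<in> falg_over k_ring (sl_basis n) \<Longrightarrow> (Phi n f :: (nat, 'a fls) falg) \<in> falg_over Kq {1..n}"
proof (induction f rule: k.falg_over_induct)
  case (scale c w)
  have "prod_list (map (\<lambda>(i, j). qs.e i j) w) \<in> falg_over Kq {1..n}"
    by (induction w) (auto simp del: One_nat_def simp: K.falg_over_fword[of "[]", unfolded fword_Nil]
        intro!: K.falg_over_mult qs.e_in)
  then show ?case
    using scale k_ring_subset_Kq by (auto simp: Phi_simps simp del: One_nat_def intro: K.falg_over_scale)
qed (simp_all add: Phi_simps K.falg_over_zero K.falg_over_add)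

lemma Phi_relator_less:
  assumes "basis_less x y" and x: "x \<in> sl_basis n" and y: "y \<in> sl_basis n"
  shows "coef (Phi n (relator n x y :: (nat \<times> nat, 'a fls) falg)) \<in> serre_ideal n"
proof -
  obtain a b c d where xy: "x = (a, b)" "y = (c, d)" by (cases x; cases y)
  have lt: "a < b" "c < d" using x y by (auto simp: sl_basis_def xy)
  note less = basis_less_fst_snd[OF assms, unfolded xy fst_conv snd_conv]
  let ?R = "fscale (qpar powi weight n x y) (qs.e c d * qs.e a b)
    + Phi n (pairing_term x y) + Phi n (commutator_term x y) :: (nat, 'a fls) falg"
  have cong: "qs.cong (qs.e a b * qs.e c d) ?R"
  proof -
    \<comment> \<open>The possible positions of two intervals in the given order: adjacent, same
      row, same column, interlaced, disjoint, and nested in either way. Each is settled by one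
      relation between root vectors.\<close>
    have "b = c \<or> b \<noteq> c \<and> a = c \<and> b < d \<or> b \<noteq> c \<and> a < c \<and> b = d
      \<or> a < c \<and> c < b \<and> b < d \<or> a < c \<and> b < c \<or> a < c \<and> d < b \<or> c < a \<and> b < d"
      using lt assms(1) unfolding basis_less_def xy fst_conv snd_conv by linarith
    then consider "b = c" | "b \<noteq> c" "a = c" "b < d" | "b \<noteq> c" "a < c" "b = d"
      | "a < c" "c < b" "b < d" | "a < c" "b < c"
      | "a < c" "d < b" | "c < a" "b < d"
      by blast
    then show ?thesis
    proof cases
      case 1
      then have W: "weight n x y = - 1"
        using less(1) lt by (simp add: weight_eq[OF x y]) (simp add: xy)
      show ?thesis
        using qs.e_adjacent[of a b d] lt less(1) 1 unfolding W
        by (simp add: xy pairing_term_def commutator_term_def Phi_simps power_int_minus)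
    next
      case 2
      then have W: "weight n x y = 1"
        using less(1) lt by (simp add: weight_eq[OF x y]) (simp add: xy)
      show ?thesis
        using qs.qcomm_e_same_row[of a b d] lt less(1) 2 unfolding W
        by (simp add: xy pairing_term_def commutator_term_def Phi_simps qs.qcomm_def)
    next
      case 3
      then have W: "weight n x y = 1"
        using less(1) lt by (simp add: weight_eq[OF x y]) (simp add: xy)
      show ?thesis
        using qs.qcomm_e_same_column[of a c b] lt less(1) 3 unfolding W
        by (simp add: xy pairing_term_def commutator_term_def Phi_simps qs.qcomm_def)
    next
      case 4
      then have W: "weight n x y = 0"
        using less(1) lt by (simp add: weight_eq[OF x y]) (simp add: xy)
      show ?thesis
        using qs.e_interlaced[of a c b d] lt less(1) 4 unfolding W
        by (simp add: xy pairing_term_def commutator_term_def Phi_simps)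
    next
      case 5
      then have W: "weight n x y = 0"
        using less(1) lt by (simp add: weight_eq[OF x y]) (simp add: xy)
      show ?thesis
        using qs.qcomm_e_disjoint[of c d a b] lt less(1) 5 unfolding W
        by (simp add: xy pairing_term_def commutator_term_def Phi_simps qs.qcomm_def)
    next
      case 6
      then have W: "weight n x y = 0"
        using less(1) lt by (simp add: weight_eq[OF x y]) (simp add: xy)
      show ?thesis
        using qs.qcomm_e_nested[of c d a b] lt less(1) 6 unfolding W
        by (simp add: xy pairing_term_def commutator_term_def Phi_simps qs.qcomm_def)
    next
      case 7
      then have W: "weight n x y = 0"
        using less(1) lt by (simp add: weight_eq[OF x y]) (simp add: xy)
      show ?thesis
        using qs.qcomm_one_sym[OF qs.qcomm_e_nested[of a b c d]] lt less(1) 7 unfolding W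
        by (simp add: xy pairing_term_def commutator_term_def Phi_simps qs.qcomm_def)
    qed
  qed
  have "Phi n (relator n x y) = qs.e a b * qs.e c d - ?R"
    using assms(1) by (simp add: relator_def S_term_def bracket_term_def Phi_simps xy algebra_simps)
  then show ?thesis using cong by (simp add: qs.cong_def)
qed

text \<open>The pairing is nonzero only for interlaced units; these have weight 0, and its two
  branches produce the same word with opposite signs. So the relations for \<open>x > y\<close> add
  nothing to the ideal.\<close>

lemma relator_swap:
  assumes "basis_less y x" and x: "x \<in> sl_basis n" and y: "y \<in> sl_basis n"
  shows "relator n x y = fscale (- (qpar powi (- weight n y x))) (relator n y x :: (nat \<times> nat, 'a fls) falg)"
proof -
  obtain a b c d where xy: "y = (a, b)" "x = (c, d)" by (cases x; cases y)
  have lt: "a < b" "c < d" using x y by (auto simp: sl_basis_def xy)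
  have q: "qpar powi (- weight n y x) * qpar powi weight n y x = (1 :: 'a fls)"
    by (simp add: power_int_minus)
  have "pairing_term x y
      = fscale (- (qpar powi (- weight n y x))) (pairing_term y x :: (nat \<times> nat, 'a fls) falg)"
  proof (cases "a < c \<and> c < b \<and> b < d")
    case True
    then have "weight n y x = 0" by (simp add: weight_eq[OF y x]) (simp add: xy)
    with True show ?thesis
      by (simp add: pairing_term_def xy falg.scale_diff_left)
  next
    case False
    then show ?thesis
      using basis_less_fst_snd(4)[OF assms(1) y x] by (auto simp: pairing_term_def xy)
  qed
  moreover have "\<not> basis_less x y" "x \<noteq> y" using basis_less_asym[OF assms(1)] by auto
  ultimately show ?thesis
    using assms(1) q
    by (simp add: relator_def S_term_def bracket_term_def falg.scale_diff_right falg.scale_add_right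
        falg.scale_scale)
qed

lemma Phi_relator:
  assumes x: "x \<in> sl_basis n" and y: "y \<in> sl_basis n"
  shows "coef (Phi n (relator n x y :: (nat \<times> nat, 'a fls) falg)) \<in> serre_ideal n"
proof -
  consider "basis_less x y" | "x = y" | "basis_less y x" using basis_less_linear by blast
  then show ?thesis
  proof cases
    case 1
    then show ?thesis using assms by (rule Phi_relator_less)
  next
    case 2
    have "\<not> basis_less y y" by (simp add: basis_less_def)
    then have "relator n x y = (0 :: (nat \<times> nat, 'a fls) falg)"
      by (simp add: 2 relator_def S_term_def pairing_term_def bracket_term_def)
    then show ?thesis by (simp add: Phi_simps serre_ideal_closed(1))
  next
    case 3
    have "qpar powi (- weight n y x) \<in> (Kq :: 'a fls set)"
      using qpar_powi_in k_ring_subset_Kq by blast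
    then have "coef (fscale (- (qpar powi (- weight n y x))) (Phi n (relator n y x))
        :: (nat, 'a fls) falg) \<in> serre_ideal n"
      using Phi_relator_less[OF 3 y x] by (intro serre_ideal_closed(6) K.R_closed)
    then show ?thesis
      by (simp only: relator_swap[OF 3 x y] Phi_simps)
  qed
qed

section \<open>Feigin's homomorphism applied to root vectors, and the kernel of
  \<open>Phi\<close>\<close>

definition rho :: "(nat, 'a fls) falg \<Rightarrow> (nat \<times> nat \<Rightarrow> nat, 'a fls) linop" where
  "rho = fg.ev fg.E_op"

text \<open>The bounds keep every generator inside the alphabet: outside it \<open>gen\<close> is
  zero, while \<open>E_op\<close> is not cut off.\<close>

lemma rho_root_vector: "1 \<le> i \<Longrightarrow> i + d \<le> n \<Longrightarrow> rho (fq.root_vector (gen n) i d) = fg.root_vector fg.E_op i d"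
  by (induction d)
    (simp_all add: rho_def gen_def fg.ev_fword fq.br_def fg.br_def fg.ev_diff fg.ev_mult fg.ev_scale)

lemma rho_Phi:
  assumes "f \<in> falg_over k_ring (sl_basis n)"
  shows "rho (Phi n f) = fg.ev fg.e_op f"
  using assms
proof (induction f rule: k.falg_over_induct)
  case (scale c w)
  have "rho (prod_list (map (\<lambda>(i, j). fq.e_vec (gen n) i j) w)) = prod_list (map fg.e_op w)"
    using scale(2)
  proof (induction w)
    case Nil
    then show ?case by (simp add: rho_def fg.ev_one)
  next
    case (Cons x w)
    obtain i j where "x = (i, j)" "1 \<le> i" "i < j" "j \<le> n + 1"
      using Cons.prems by (cases x) (auto simp: sl_basis_def)
    moreover from this have "rho (fq.e_vec (gen n) i j) = fg.e_vec fg.E_op i j"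
      unfolding fq.e_vec_def fg.e_vec_def by (intro rho_root_vector) auto
    ultimately show ?case
      using Cons by (simp add: rho_def fg.ev_mult)
  qed
  then show ?case by (simp add: Phi_simps fg.ev_scale fg.ev_fword rho_def)
qed (simp_all add: Phi_simps rho_def fg.ev_zero fg.ev_add)

lemma rho_serre_ideal:
  assumes "coef f \<in> serre_ideal n" shows "rho f = 0"
proof -
  let ?I = "coef ` {f \<in> falg_over Kq {1..n}. rho f = 0}"
  have "ideal ?I (free_algebra Kq {1..n})"
    by (rule K.idealI_coef) (simp_all add: rho_def fg.ev_zero fg.ev_add fg.ev_minus fg.ev_mult)
  moreover have "rho g = 0" if "g \<in> serre_relators n" for g
  proof -
    from that consider i j where "\<bar>int i - int j\<bar> > 1" "g = fword [i] * fword [j] - fword [j] * fword [i]"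
      | i j where "\<bar>int i - int j\<bar> = 1" "g = serre_relator i j"
      unfolding serre_relators_def by blast
    then show ?thesis
    proof cases
      case 1
      then have "Suc i < j \<or> Suc j < i" by linarith
      with 1 show ?thesis
        using fg.E_op_far[of i j] fg.E_op_far[of j i]
        by (auto simp: rho_def fg.ev_diff fg.ev_mult fg.ev_fword)
    next
      case 2
      then have "j = Suc i \<or> i = Suc j" by linarith
      with 2 show ?thesis
        using fg.E_op_serre_up[of i] fg.E_op_serre_down[of j]
        by (auto simp: rho_def fg.ev_diff fg.ev_add fg.ev_mult fg.ev_scale fg.ev_fword)
    qed
  qed
  then have "coef ` serre_relators n \<subseteq> ?I"
    using serre_relators_over by blast
  ultimately have "serre_ideal n \<subseteq> ?I"
    unfolding serre_ideal_def
    by (intro ring.genideal_minimal ring_free_algebra K.subring_R)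
  then show ?thesis
    using assms by (auto simp: coef_inject)
qed

lemma Phi_sl_ideal:
  assumes "coef f \<in> sl_ideal n"
  shows "coef (Phi n f :: (nat, 'a fls) falg) \<in> serre_ideal n"
proof -
  \<comment> \<open>Membership in \<open>falg_over\<close> is part of the predicate because closure
    under products must know that \<open>Phi\<close> maps both factors into the algebra over
    K(q).\<close>
  let ?P = "\<lambda>f. f \<in> falg_over k_ring (sl_basis n) \<and> coef (Phi n f :: (nat, 'a fls) falg) \<in> serre_ideal n"
  let ?I = "coef ` {f \<in> falg_over k_ring (sl_basis n). ?P f}"
  have "ideal ?I (sl_tensor n)"
  proof (rule k.idealI_coef)
    fix f :: "(nat \<times> nat, 'a fls) falg" assume "?P f"
    then show "?P (- f)"
      using k.falg_over_scale[of "- 1" f] serre_ideal_closed(6)[of "- 1" "Phi n f" n]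
      by (simp add: Phi_simps k.R_closed K.R_closed)
  qed (auto simp: Phi_simps k.falg_over_zero k.falg_over_add k.falg_over_mult Phi_over
      simp del: One_nat_def intro: serre_ideal_closed)
  moreover have "(\<lambda>(x, y). coef (relator n x y)) ` (sl_basis n \<times> sl_basis n) \<subseteq> ?I"
    by (auto intro!: imageI Phi_relator relator_over)
  ultimately have "sl_ideal n \<subseteq> ?I"
    unfolding sl_ideal_def
    by (intro ring.genideal_minimal ring_free_algebra subring_k_ring)
  then show ?thesis
    using assms by (auto simp: coef_inject)
qed

text \<open>If \<open>Phi n f\<close> lies in the Serre ideal, then so does the image of its normal
  form \<open>g\<close>. Applying \<open>rho\<close> gives a vanishing combination of sorted
  monomials, so \<open>g = 0\<close>, and \<open>f\<close> differs from \<open>g\<close> only by the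
  ideal of \<open>U_sl\<close>.\<close>

lemma Phi_kernel:
  assumes f: "f \<in> falg_over k_ring (sl_basis n)"
  shows "coef (Phi n f :: (nat, 'a fls) falg) \<in> serre_ideal n \<longleftrightarrow> coef f \<in> sl_ideal n"
proof
  assume Phi: "coef (Phi n f) \<in> serre_ideal n"
  obtain g where g: "g \<in> falg_over k_ring (sl_basis n)"
    "\<And>w. coef g w \<noteq> 0 \<Longrightarrow> w \<in> normal_words" "coef (f - g) \<in> sl_ideal n"
    using normalizable_all[OF f] unfolding normalizable_def by blast
  have "rho (Phi n f) - rho (Phi n g) = 0"
    using rho_serre_ideal[OF Phi_sl_ideal[OF g(3)]] by (simp add: Phi_simps rho_def fg.ev_diff)
  then have "fg.ev fg.e_op g = 0"
    using rho_serre_ideal[OF Phi] by (simp add: rho_Phi[OF g(1)])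
  then have "g = 0"
    using g(1,2) normal_words_inject by (intro fg.monomials_independent) (auto simp: falg_over_def)
  with g(3) show "coef f \<in> sl_ideal n" by simp
qed (rule Phi_sl_ideal)

end

section \<open>Quotients and the isomorphism\<close>

context coefficient_ring
begin

definition coset :: "('x list \<Rightarrow> 'r) set \<Rightarrow> 'x set \<Rightarrow> ('x, 'r) falg \<Rightarrow> ('x list \<Rightarrow> 'r) set" where
  "coset I B f = I +>\<^bsub>free_algebra R B\<^esub> coef f"

context
  fixes I :: "('x list \<Rightarrow> 'r) set" and B :: "'x set"
  assumes I: "ideal I (free_algebra R B)"
begin

interpretation I: ideal I "free_algebra R B"
  by (rule I)

lemma coset_eq_iff:
  assumes "f \<in> falg_over R B" "g \<in> falg_over R B"
  shows "coset I B f = coset I B g \<longleftrightarrow> coef (f - g) \<in> I"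
  unfolding coset_def
  using I.quotient_eq_iff_same_a_r_cos[OF I, of "coef f" "coef g"] assms
  by (simp add: coef_in_carrier_iff free_algebra_minus)

lemma carrier_quot: "carrier (quot_algebra (free_algebra R B) I) = coset I B ` falg_over R B"
proof -
  have "carrier (quot_algebra (free_algebra R B) I) = (\<lambda>x. I +>\<^bsub>free_algebra R B\<^esub> x) ` carrier (free_algebra R B)"
    by (auto simp: quot_algebra_def ring.defs FactRing_simps)
  also have "\<dots> = coset I B ` falg_over R B"
    by (auto simp: coset_def coef_in_carrier_iff elim!: carrier_cases intro!: imageI)
  finally show ?thesis .
qed

lemma coset_mult:
  assumes "f \<in> falg_over R B" "g \<in> falg_over R B"
  shows "coset I B f \<otimes>\<^bsub>quot_algebra (free_algebra R B) I\<^esub> coset I B g = coset I B (f * g)"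
  using I.rcoset_mult_add[of "coef f" "coef g"] assms
  by (simp add: coset_def quot_algebra_def ring.defs FactRing_def coef_in_carrier_iff free_algebra_coef)

lemma coset_add:
  assumes "f \<in> falg_over R B" "g \<in> falg_over R B"
  shows "coset I B f \<oplus>\<^bsub>quot_algebra (free_algebra R B) I\<^esub> coset I B g = coset I B (f + g)"
  using I.a_rcos_sum[of "coef f" "coef g"] assms
  by (simp add: coset_def quot_algebra_def ring.defs FactRing_def coef_in_carrier_iff free_algebra_coef)

lemma coset_one: "\<one>\<^bsub>quot_algebra (free_algebra R B) I\<^esub> = coset I B 1"
  by (simp add: coset_def quot_algebra_def ring.defs FactRing_def free_algebra_coef)

text \<open>The scalar multiplication of the quotient is a union over all representatives. They all
  yield the same coset because \<open>I\<close> is closed under scalars from \<open>R\<close>, and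
  the union is not empty.\<close>

lemma coset_scale:
  assumes "c \<in> R" "f \<in> falg_over R B"
  shows "c \<odot>\<^bsub>quot_algebra (free_algebra R B) I\<^esub> coset I B f = coset I B (fscale c f)"
proof -
  have "I +>\<^bsub>free_algebra R B\<^esub> (c \<odot>\<^bsub>free_algebra R B\<^esub> x) = coset I B (fscale c f)" if x: "x \<in> coset I B f" for x
  proof -
    obtain h where "h \<in> I" "x = h \<oplus>\<^bsub>free_algebra R B\<^esub> coef f"
      using x by (auto simp: coset_def a_r_coset_def r_coset_def)
    moreover from this obtain y where y: "h = coef y" "y \<in> falg_over R B"
      using I.a_Hcarr carrier_cases by metis
    ultimately have "coef y \<in> I" "x = coef (y + f)"
      by (simp_all add: free_algebra_coef)
    then have "coset I B (fscale c (y + f)) = coset I B (fscale c f)"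
      using assms y by (subst coset_eq_iff)
        (auto intro!: falg_over_scale falg_over_add ideal_coef(6)[OF I] simp: falg.scale_add_right)
    then show ?thesis
      by (simp add: \<open>x = coef (y + f)\<close> coset_def free_algebra_coef)
  qed
  moreover have "coset I B f \<noteq> {}"
    using I.a_rcos_self[of "coef f"] assms by (auto simp: coset_def coef_in_carrier_iff)
  ultimately show ?thesis
    by (auto simp: quot_algebra_def ring.defs module.defs)
qed

text \<open>\<open>quot_algebra\<close> only appends a scalar multiplication to the record of the
  factor ring, so the ring theory of \<open>Quot\<close> can be used for it.\<close>

lemma subring_quot_iff:
  "subring H (quot_algebra (free_algebra R B) I) \<longleftrightarrow> subring H (free_algebra R B Quot I)"
  by (simp add: quot_algebra_def ring.defs subring_def submonoid_def subgroup_def m_inv_def)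

end

end

section \<open>Identification of \<open>Uq_plus\<close> with the image of \<open>Phi\<close>\<close>

context
  fixes n :: nat and field_type :: "'a::field_char_0 itself"
begin

text \<open>Keeps the alphabet in the form \<open>{1..n}\<close>; otherwise simplification turns its
  lower bound into \<open>Suc 0\<close>.\<close>

declare One_nat_def [simp del]

abbreviation U_class :: "(nat \<times> nat, 'a fls) falg \<Rightarrow> ((nat \<times> nat) list \<Rightarrow> 'a fls) set" where
  "U_class \<equiv> k.coset (sl_ideal n) (sl_basis n)"

abbreviation Uq_class :: "(nat, 'a fls) falg \<Rightarrow> (nat list \<Rightarrow> 'a fls) set" where
  "Uq_class \<equiv> K.coset (serre_ideal n) {1..n}"

lemmas U_class_simps =
  k.carrier_quot[OF ideal_sl_ideal, of n, folded U_sl_eq]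
  k.coset_mult[OF ideal_sl_ideal, of _ n, folded U_sl_eq]
  k.coset_add[OF ideal_sl_ideal, of _ n, folded U_sl_eq]
  k.coset_one[OF ideal_sl_ideal, of n, folded U_sl_eq]
  k.coset_scale[OF ideal_sl_ideal, of _ _ n, folded U_sl_eq]

lemma Uq_plus_Kq_eq: "Uq_plus_Kq n = quot_algebra (free_algebra Kq {1..n}) (serre_ideal n)"
  by (simp only: Uq_plus_Kq_def qserre_eq serre_ideal_def)

lemmas Uq_class_simps =
  K.carrier_quot[OF ideal_serre_ideal, of n, folded Uq_plus_Kq_eq]
  K.coset_mult[OF ideal_serre_ideal, of _ n, folded Uq_plus_Kq_eq]
  K.coset_add[OF ideal_serre_ideal, of _ n, folded Uq_plus_Kq_eq]
  K.coset_one[OF ideal_serre_ideal, of n, folded Uq_plus_Kq_eq]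
  K.coset_scale[OF ideal_serre_ideal, of _ _ n, folded Uq_plus_Kq_eq]

text \<open>Root vectors arise from the generators by products, differences and multiplication by
  q^-1, all available over \<open>k\<close>; the inverse of q + q^-1 entered only into their
  relations.\<close>

lemma Uq_class_Phi_in:
  assumes H: "subring H (Uq_plus_Kq n)" "\<And>c x. c \<in> k_ring \<Longrightarrow> x \<in> H \<Longrightarrow> c \<odot>\<^bsub>Uq_plus_Kq n\<^esub> x \<in> H"
    and gens: "\<And>i. i \<in> {1..n} \<Longrightarrow> Uq_class (fword [i]) \<in> H"
    and f: "f \<in> falg_over k_ring (sl_basis n)"
  shows "Uq_class (Phi n f) \<in> H"
proof -
  have kK: "c \<in> Kq" if "c \<in> k_ring" for c :: "'a fls"
    using that k_ring_subset_Kq by blast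
  have sub: "H \<subseteq> carrier (Uq_plus_Kq n)" "\<one>\<^bsub>Uq_plus_Kq n\<^esub> \<in> H"
      "x \<in> H \<Longrightarrow> y \<in> H \<Longrightarrow> x \<otimes>\<^bsub>Uq_plus_Kq n\<^esub> y \<in> H"
      "x \<in> H \<Longrightarrow> y \<in> H \<Longrightarrow> x \<oplus>\<^bsub>Uq_plus_Kq n\<^esub> y \<in> H" for x y
    using subring.axioms[OF H(1)] subgroup.m_closed[of H "add_monoid (Uq_plus_Kq n)"]
    by (auto simp: submonoid_def)
  define C where "C = {f \<in> falg_over Kq {1..n}. Uq_class f \<in> H}"
  have mult: "f * g \<in> C" and add: "f + g \<in> C" if "f \<in> C" "g \<in> C" for f g
    using sub(3,4)[of "Uq_class f" "Uq_class g"] that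
    by (auto simp: C_def Uq_class_simps simp del: One_nat_def intro: K.falg_over_mult K.falg_over_add)
  have scale: "fscale c f \<in> C" if "c \<in> k_ring" "f \<in> C" for c f
    using H(2)[of c "Uq_class f"] that
    by (auto simp: C_def Uq_class_simps kK simp del: One_nat_def intro: K.falg_over_scale)
  have one: "1 \<in> C"
    using sub(2) K.falg_over_fword[of "[]"] by (simp add: C_def Uq_class_simps fword_Nil)
  have zero: "0 \<in> C"
    using scale[OF _ one, of 0] k.R_closed by simp
  have gen: "gen n i \<in> C" for i
    using zero by (auto simp: gen_def C_def intro: gens letter_over)
  have br: "fq.br f g \<in> C" if "f \<in> C" "g \<in> C" for f g
    using add[OF mult[OF that] scale[OF k.R_closed(5)[OF qpar_in(2)] mult[OF that(2,1)]]]
    by (simp add: fq.br_def)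
  have root: "fq.root_vector (gen n) i d \<in> C" for i d
    by (induction d) (simp_all add: gen br)
  have word: "prod_list (map (\<lambda>(i, j). fq.e_vec (gen n) i j) w) \<in> C" for w
    by (induction w) (auto simp: one fq.e_vec_def intro!: mult root)
  have "Phi n f \<in> C"
    using f by (induction f rule: k.falg_over_induct) (simp_all add: Phi_simps zero add scale word)
  then show ?thesis by (simp add: C_def)
qed

lemma subring_Phi_image:
  "subring (Uq_class ` Phi n ` falg_over k_ring (sl_basis n)) (Uq_plus_Kq n)"
proof -
  let ?F = "free_algebra Kq {1..n} :: ('a fls, nat list \<Rightarrow> 'a fls) module"
  let ?Q = "?F Quot serre_ideal n"
  interpret Q: ring ?Q by (rule ideal.quotient_is_ring[OF ideal_serre_ideal])
  have eq: "carrier ?Q = carrier (Uq_plus_Kq n)" "monoid.mult ?Q = monoid.mult (Uq_plus_Kq n)"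
    "ring.add ?Q = ring.add (Uq_plus_Kq n)" "monoid.one ?Q = monoid.one (Uq_plus_Kq n)"
    "ring.zero ?Q = ring.zero (Uq_plus_Kq n)"
    by (simp_all add: Uq_plus_Kq_eq quot_algebra_def ring.defs)
  \<comment> \<open>The class of 0 is identified as the zero of the quotient by being idempotent
    under addition.\<close>
  have zero: "ring.zero ?Q = Uq_class 0"
  proof -
    have "Uq_class 0 \<oplus>\<^bsub>?Q\<^esub> Uq_class 0 = Uq_class 0" "Uq_class 0 \<in> carrier ?Q"
      unfolding eq by (auto simp: Uq_class_simps K.falg_over_zero simp del: One_nat_def)
    then show ?thesis using Q.add.r_cancel_one by metis
  qed
  show ?thesis
    unfolding Uq_plus_Kq_eq K.subring_quot_iff[OF ideal_serre_ideal]
  proof (rule Q.subringI)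
    show "Uq_class ` Phi n ` falg_over k_ring (sl_basis n) \<subseteq> carrier ?Q"
      unfolding eq by (auto simp: Uq_class_simps simp del: One_nat_def intro!: imageI Phi_over)
    have "\<one>\<^bsub>?Q\<^esub> = Uq_class (Phi n 1)"
      by (simp add: eq Uq_class_simps Phi_simps)
    moreover have "(1 :: (nat \<times> nat, 'a fls) falg) \<in> falg_over k_ring (sl_basis n)"
      using k.falg_over_fword[of "[]"] by (simp add: fword_Nil)
    ultimately show "\<one>\<^bsub>?Q\<^esub> \<in> Uq_class ` Phi n ` falg_over k_ring (sl_basis n)" by blast
  next
    fix x assume "x \<in> Uq_class ` Phi n ` falg_over k_ring (sl_basis n)"
    then obtain f where f: "x = Uq_class (Phi n f)" "f \<in> falg_over k_ring (sl_basis n)" by blast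
    have f': "- f \<in> falg_over k_ring (sl_basis n)"
      using k.falg_over_diff[OF k.falg_over_zero f(2)] by simp
    have "Uq_class (Phi n (- f)) \<oplus>\<^bsub>?Q\<^esub> x = \<zero>\<^bsub>?Q\<^esub>"
      unfolding zero eq f(1) using Phi_over[OF f(2)] Phi_over[OF f']
      by (simp add: Uq_class_simps del: One_nat_def flip: Phi_simps(2)) (simp add: Phi_simps)
    then have "\<ominus>\<^bsub>?Q\<^esub> x = Uq_class (Phi n (- f))"
      using Phi_over[OF f(2)] Phi_over[OF f']
      by (intro Q.minus_equality) (auto simp: eq f(1) Uq_class_simps)
    then show "\<ominus>\<^bsub>?Q\<^esub> x \<in> Uq_class ` Phi n ` falg_over k_ring (sl_basis n)"
      using f' by blast
  next
    fix x y
    assume "x \<in> Uq_class ` Phi n ` falg_over k_ring (sl_basis n)"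
      "y \<in> Uq_class ` Phi n ` falg_over k_ring (sl_basis n)"
    then obtain f g where fg: "x = Uq_class (Phi n f)" "f \<in> falg_over k_ring (sl_basis n)"
      "y = Uq_class (Phi n g)" "g \<in> falg_over k_ring (sl_basis n)" by blast
    have "x \<otimes>\<^bsub>?Q\<^esub> y = Uq_class (Phi n (f * g))" "x \<oplus>\<^bsub>?Q\<^esub> y = Uq_class (Phi n (f + g))"
      unfolding eq fg(1,3) using Phi_over[OF fg(2)] Phi_over[OF fg(4)]
      by (simp_all add: Uq_class_simps Phi_simps)
    then show "x \<otimes>\<^bsub>?Q\<^esub> y \<in> Uq_class ` Phi n ` falg_over k_ring (sl_basis n)"
      "x \<oplus>\<^bsub>?Q\<^esub> y \<in> Uq_class ` Phi n ` falg_over k_ring (sl_basis n)"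
      using fg k.falg_over_mult k.falg_over_add by blast+
  qed
qed

text \<open>The image of \<open>Phi\<close> belongs to the family of subalgebras being intersected
  and is contained in each member, so it is the intersection.\<close>

lemma carrier_Uq_plus:
  "carrier (Uq_plus n) = Uq_class ` Phi n ` falg_over k_ring (sl_basis n)" (is "_ = ?H")
proof -
  let ?gens = "(\<lambda>i. Uq_class (fword [i])) ` {1..n}"
  let ?S = "{H. subring H (Uq_plus_Kq n)
      \<and> (\<forall>c\<in>k_ring. \<forall>x\<in>H. c \<odot>\<^bsub>Uq_plus_Kq n\<^esub> x \<in> H) \<and> ?gens \<subseteq> H}"
  have carrier: "carrier (Uq_plus n) = \<Inter> ?S"
    unfolding Uq_plus_def gen_subalgebra_def qserre_eq serre_ideal_def[symmetric]
    by (simp add: K.coset_def word_eq_coef)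
  have mem: "?H \<in> ?S"
  proof (intro CollectI conjI ballI subring_Phi_image)
    fix c :: "'a fls" and x assume c: "c \<in> k_ring" and "x \<in> ?H"
    then obtain f where f: "x = Uq_class (Phi n f)" "f \<in> falg_over k_ring (sl_basis n)" by blast
    have "c \<in> Kq" using c k_ring_subset_Kq by blast
    then have "c \<odot>\<^bsub>Uq_plus_Kq n\<^esub> x = Uq_class (Phi n (fscale c f))"
      using Phi_over[OF f(2)] by (simp add: f(1) Uq_class_simps Phi_simps)
    then show "c \<odot>\<^bsub>Uq_plus_Kq n\<^esub> x \<in> ?H"
      using k.falg_over_scale[OF c f(2)] by blast
  next
    show "?gens \<subseteq> ?H"
    proof (intro image_subsetI)
      fix i assume i: "i \<in> {1..n}"
      \<comment> \<open>The generator \<open>E i\<close> is the root vector of the simple root,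
        hence the image of the matrix unit \<open>(i, Suc i)\<close>.\<close>
      let ?w = "fword [(i, Suc i)] :: (nat \<times> nat, 'a fls) falg"
      have "Phi n ?w = fword [i]"
        using i by (simp add: Phi_simps fq.e_vec_Suc gen_def)
      moreover have "?w \<in> falg_over k_ring (sl_basis n)"
        using i by (intro k.falg_over_fword) (auto simp: sl_basis_def)
      ultimately show "Uq_class (fword [i]) \<in> ?H"
        by (intro image_eqI[of _ _ "fword [i]"] image_eqI[of "fword [i]" _ ?w]) simp_all
    qed
  qed
  have least: "?H \<subseteq> H" if H: "H \<in> ?S" for H
  proof
    fix x assume "x \<in> ?H"
    then obtain f where f: "x = Uq_class (Phi n f)" "f \<in> falg_over k_ring (sl_basis n)" by blast
    show "x \<in> H"
      unfolding f(1)
    proof (rule Uq_class_Phi_in[OF _ _ _ f(2)])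
      show "subring H (Uq_plus_Kq n)" using H by simp
      show "c \<odot>\<^bsub>Uq_plus_Kq n\<^esub> x \<in> H" if "c \<in> k_ring" "x \<in> H" for c x
        using H that by simp
      show "Uq_class (fword [i]) \<in> H" if "i \<in> {1..n}" for i
        using H that by (simp add: image_subset_iff)
    qed
  qed
  show ?thesis
    unfolding carrier by (rule antisym[OF Inter_lower[OF mem] Inter_greatest[OF least]])
qed

lemma Uq_plus_sel:
  "monoid.mult (Uq_plus n) = monoid.mult (Uq_plus_Kq n :: ('a fls, _) module)"
  "ring.add (Uq_plus n) = ring.add (Uq_plus_Kq n :: ('a fls, _) module)"
  "monoid.one (Uq_plus n) = monoid.one (Uq_plus_Kq n :: ('a fls, _) module)"
  "module.smult (Uq_plus n) = module.smult (Uq_plus_Kq n :: ('a fls, _) module)"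
  by (simp_all add: Uq_plus_def gen_subalgebra_def)

text \<open>From left to right this makes the isomorphism below well defined, from right to left
  injective.\<close>

lemma classes_agree:
  assumes "f \<in> falg_over k_ring (sl_basis n)" "g \<in> falg_over k_ring (sl_basis n)"
  shows "Uq_class (Phi n f) = Uq_class (Phi n g) \<longleftrightarrow> U_class f = U_class g"
  using Phi_kernel[OF k.falg_over_diff[OF assms]] assms
  by (simp add: K.coset_eq_iff[OF ideal_serre_ideal Phi_over Phi_over] k.coset_eq_iff[OF ideal_sl_ideal]
      Phi_simps)

lemma Uq_plus_isomorphic_U_sl: "alg_isomorphic (k_ring :: 'a fls set) (Uq_plus n) (U_sl n)"
proof -
  let ?A = "falg_over k_ring (sl_basis n) :: (nat \<times> nat, 'a fls) falg set"
  \<comment> \<open>The map leaves \<open>Uq_plus\<close>, against the direction of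
    \<open>Phi\<close>, so a preimage has to be chosen; its class in \<open>U_sl\<close> does not
    depend on the choice.\<close>
  define h where "h x = U_class (SOME f. f \<in> ?A \<and> Uq_class (Phi n f) = x)" for x
  have h: "h (Uq_class (Phi n f)) = U_class f" if f: "f \<in> ?A" for f
  proof -
    define g where "g = (SOME g. g \<in> ?A \<and> Uq_class (Phi n g) = Uq_class (Phi n f))"
    have "g \<in> ?A \<and> Uq_class (Phi n g) = Uq_class (Phi n f)"
      unfolding g_def by (rule someI[of _ f]) (use f in simp)
    then have "U_class g = U_class f" using f by (auto simp only: classes_agree)
    then show ?thesis by (simp add: h_def g_def)
  qed
  have one: "1 \<in> ?A" using k.falg_over_fword[of "[]"] by (simp add: fword_Nil)
  have "h \<in> ring_hom (Uq_plus n) (U_sl n)"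
  proof (rule ring_hom_memI; (unfold carrier_Uq_plus Uq_plus_sel)?)
    fix x assume "x \<in> Uq_class ` Phi n ` ?A"
    then show "h x \<in> carrier (U_sl n)" by (auto simp: h U_class_simps)
  next
    fix x y assume "x \<in> Uq_class ` Phi n ` ?A" "y \<in> Uq_class ` Phi n ` ?A"
    then obtain f g where fg: "x = Uq_class (Phi n f)" "f \<in> ?A" "y = Uq_class (Phi n g)" "g \<in> ?A"
      by blast
    then have "x \<otimes>\<^bsub>Uq_plus_Kq n\<^esub> y = Uq_class (Phi n (f * g))"
      "x \<oplus>\<^bsub>Uq_plus_Kq n\<^esub> y = Uq_class (Phi n (f + g))"
      using Phi_over[OF fg(2)] Phi_over[OF fg(4)] by (simp_all add: Uq_class_simps Phi_simps)
    then show "h (x \<otimes>\<^bsub>Uq_plus_Kq n\<^esub> y) = h x \<otimes>\<^bsub>U_sl n\<^esub> h y"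
      "h (x \<oplus>\<^bsub>Uq_plus_Kq n\<^esub> y) = h x \<oplus>\<^bsub>U_sl n\<^esub> h y"
      using fg by (simp_all add: h U_class_simps k.falg_over_mult k.falg_over_add)
  next
    have "\<one>\<^bsub>Uq_plus_Kq n\<^esub> = Uq_class (Phi n 1)"
      by (simp add: Uq_class_simps Phi_simps)
    then show "h \<one>\<^bsub>Uq_plus_Kq n\<^esub> = \<one>\<^bsub>U_sl n\<^esub>"
      using one by (simp add: h U_class_simps)
  qed
  moreover have "bij_betw h (carrier (Uq_plus n)) (carrier (U_sl n))"
    unfolding bij_betw_def carrier_Uq_plus
  proof
    show "inj_on h (Uq_class ` Phi n ` ?A)"
    proof (rule inj_onI)
      fix x y assume "x \<in> Uq_class ` Phi n ` ?A" "y \<in> Uq_class ` Phi n ` ?A" and eq: "h x = h y"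
      then obtain f g where fg: "x = Uq_class (Phi n f)" "f \<in> ?A" "y = Uq_class (Phi n g)" "g \<in> ?A"
        by blast
      then show "x = y" using eq by (simp only: h classes_agree)
    qed
    show "h ` Uq_class ` Phi n ` ?A = carrier (U_sl n)"
      by (auto simp: h U_class_simps image_image)
  qed
  moreover have "h (c \<odot>\<^bsub>Uq_plus n\<^esub> x) = c \<odot>\<^bsub>U_sl n\<^esub> h x"
    if c: "c \<in> k_ring" and x: "x \<in> carrier (Uq_plus n)" for c x
  proof -
    obtain f where f: "x = Uq_class (Phi n f)" "f \<in> ?A"
      using x by (auto simp: carrier_Uq_plus)
    have "c \<in> Kq" using c k_ring_subset_Kq by blast
    then have "c \<odot>\<^bsub>Uq_plus n\<^esub> x = Uq_class (Phi n (fscale c f))"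
      using Phi_over[OF f(2)] by (simp add: Uq_plus_sel f(1) Uq_class_simps Phi_simps)
    then show ?thesis
      using c f by (simp add: h U_class_simps k.falg_over_scale)
  qed
  ultimately show ?thesis
    unfolding alg_isomorphic_def ring_iso_def by blast
qed

end

theorem theorem10p4:
  fixes n :: nat
  assumes "n \<ge> 1"
  shows "alg_isomorphic (k_ring :: 'a::field_char_0 fls set) (Uq_plus n) (U_sl n)"
  by (rule Uq_plus_isomorphic_U_sl)

end
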